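(* Let $\Phi_{K,f}:\mathfrak{T}(\mathcal{H}_A)\to\mathfrak{T}(\mathcal{H}_B)$ be a Bosonic linear channel such that $Z_f:=f^{-1}(1)=\{z\in Z_B : f(z)=1\}\neq\{0\}$. Let $\mathcal{A}=\left[\{W_A(Kz)\}_{z\in Z_f}\right]''\subseteq\mathfrak{B}(\mathcal{H}_A)$ and $\mathcal{B}=\left[\{W_B(z)\}_{z\in Z_f}\right]''\subseteq\mathfrak{B}(\mathcal{H}_B)$ be the von Neumann algebras generated by the indicated families of Weyl operators. Then for an arbitrary orthogonal resolution of the identity $\{P_k\}\subset\mathcal{A}$ there exists an orthogonal resolution of the identity $\{Q_k\}\subset\mathcal{B}$ (indexed by the same set) such that $P_k=\Phi_{K,f}^*(Q_k)$ for all $k$, and hence $$\Phi_{K,f}\left(\mathfrak{T}(\mathcal{H}_A^k)\right)\subseteq\mathfrak{T}(\mathcal{H}_B^k)\quad\text{for all } k,$$ where $\mathcal{H}_A^k=P_k(\mathcal{H}_A)$ and $\mathcal{H}_B^k=Q_k(\mathcal{H}_B)$ (so that $\mathcal{H}_X=\bigoplus_k\mathcal{H}_X^k$ for $X=A,B$).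
   Context: For a separable Hilbert space $\mathcal{H}$, $\mathfrak{B}(\mathcal{H})$ denotes the bounded operators and $\mathfrak{T}(\mathcal{H})$ the trace-class operators on $\mathcal{H}$. For a closed subspace $\mathcal{H}'\subseteq\mathcal{H}$ with orthogonal projector $P$, $\mathfrak{T}(\mathcal{H}')$ is identified with $P\,\mathfrak{T}(\mathcal{H})P\subseteq\mathfrak{T}(\mathcal{H})$. A quantum channel is a completely positive trace-preserving linear map $\Phi:\mathfrak{T}(\mathcal{H}_A)\to\mathfrak{T}(\mathcal{H}_B)$; its dual $\Phi^*:\mathfrak{B}(\mathcal{H}_B)\to\mathfrak{B}(\mathcal{H}_A)$ is defined by $\mathrm{Tr}\,\Phi(\rho)Y=\mathrm{Tr}\,\rho\,\Phi^*(Y)$. A double prime denotes the bicommutant. For $X=A,B$, let $(Z_X,\Delta_X)$ be a finite-dimensional real symplectic space, $\dim Z_X=2s_X$, where $\Delta_X$ denotes both the symplectic form and its matrix, $\Delta_X(z,z')=z^\top\Delta_X z'$. $\mathcal{H}_X$ is the space of an irreducible (strongly continuous) unitary representation $z\mapsto W_X(z)$ (Weyl operators) of the Canonical Commutation Relations $W_X(z)W_X(z')=\exp\left[-\frac{\mathrm{i}}{2}z^\top\Delta_X z'\right]W_X(z+z')$. A Bosonic linear channel $\Phi_{K,f}:\mathfrak{T}(\mathcal{H}_A)\to\mathfrak{T}(\mathcal{H}_B)$ is the channel defined by $\Phi_{K,f}^*(W_B(z))=W_A(Kz)f(z)$, $z\in Z_B$, where $K:Z_B\to Z_A$ is a linear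 operator and $f$ is a complex continuous function on $Z_B$ such that $f(0)=1$ and for every finite subset $\{z_s\}\subset Z_B$ the matrix with elements $f(z_s-z_r)\exp\left(\frac{\mathrm{i}}{2}z_s^\top[\Delta_B-K^\top\Delta_A K]z_r\right)$ is positive (semidefinite). The set $Z_f$ is a linear subspace of $Z_B$. An orthogonal resolution of the identity is a family of mutually orthogonal projectors whose sum is the identity operator. *)

theory Defs
  imports "HOL-Analysis.Analysis"
begin

text \<open>The inner product is antilinear in the first and linear in the second argument. Its real part
  is the inner product of the underlying real Hilbert space, which fixes norm and topology.\<close>

class chilbert_space = real_inner + banach +
  fixes scaleC :: "complex \<Rightarrow> 'a \<Rightarrow> 'a" (infixr "*\<^sub>C" 75)
    and cinner :: "'a \<Rightarrow> 'a \<Rightarrow> complex"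
  assumes scaleC_add_right: "c *\<^sub>C (x + y) = c *\<^sub>C x + c *\<^sub>C y"
    and scaleC_add_left: "(c + d) *\<^sub>C x = c *\<^sub>C x + d *\<^sub>C x"
    and scaleC_scaleC: "c *\<^sub>C (d *\<^sub>C x) = (c * d) *\<^sub>C x"
    and scaleC_of_real: "complex_of_real r *\<^sub>C x = r *\<^sub>R x"
    and cinner_commute: "cinner x y = cnj (cinner y x)"
    and cinner_add_right: "cinner x (y + z) = cinner x y + cinner x z"
    and cinner_scaleC_right: "cinner x (c *\<^sub>C y) = c * cinner x y"
    and inner_eq_Re_cinner: "x \<bullet> y = Re (cinner x y)"

definition csubspace :: "'a::chilbert_space set \<Rightarrow> bool" where
  "csubspace M \<longleftrightarrow> 0 \<in> M \<and> (\<forall>x\<in>M. \<forall>y\<in>M. x + y \<in> M) \<and> (\<forall>c. \<forall>x\<in>M. c *\<^sub>C x \<in> M)"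

definition is_onb :: "'a::chilbert_space set \<Rightarrow> bool" where
  "is_onb E \<longleftrightarrow>
     (\<forall>x\<in>E. \<forall>y\<in>E. cinner x y = (if x = y then 1 else 0)) \<and>
     (\<forall>x. (\<forall>e\<in>E. cinner e x = 0) \<longrightarrow> x = 0)"

definition orthogonal_direct_sum :: "'i set \<Rightarrow> ('i \<Rightarrow> 'a::chilbert_space set) \<Rightarrow> bool" where
  "orthogonal_direct_sum I M \<longleftrightarrow>
     (\<forall>k\<in>I. closed (M k) \<and> csubspace (M k)) \<and>
     (\<forall>j\<in>I. \<forall>k\<in>I. j \<noteq> k \<longrightarrow> (\<forall>x\<in>M j. \<forall>y\<in>M k. cinner x y = 0)) \<and>
     (\<forall>x. \<exists>y. (\<forall>k\<in>I. y k \<in> M k) \<and> (y has_sum x) I)"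

text \<open>Operators are functions. Membership in the algebra of bounded operators is the predicate
  \<open>bounded_clinear\<close>, and the product of operators is composition.\<close>

definition bounded_clinear :: "('a::chilbert_space \<Rightarrow> 'b::chilbert_space) \<Rightarrow> bool" where
  "bounded_clinear T \<longleftrightarrow> bounded_linear T \<and> (\<forall>c x. T (c *\<^sub>C x) = c *\<^sub>C T x)"

definition cadjoint :: "('a::chilbert_space \<Rightarrow> 'b::chilbert_space) \<Rightarrow> 'b \<Rightarrow> 'a" where
  "cadjoint T = (THE S. bounded_clinear S \<and> (\<forall>x y. cinner (S y) x = cinner y (T x)))"

definition positive_op :: "('a::chilbert_space \<Rightarrow> 'a) \<Rightarrow> bool" where
  "positive_op T \<longleftrightarrow> bounded_clinear T \<and> (\<forall>x. cinner x (T x) \<in> \<real>\<^sub>\<ge>\<^sub>0)"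

definition abs_op :: "('a::chilbert_space \<Rightarrow> 'a) \<Rightarrow> 'a \<Rightarrow> 'a" where
  "abs_op T = (THE S. positive_op S \<and> S \<circ> S = cadjoint T \<circ> T)"

definition unitary_op :: "('a::chilbert_space \<Rightarrow> 'a) \<Rightarrow> bool" where
  "unitary_op U \<longleftrightarrow> bounded_clinear U \<and> U \<circ> cadjoint U = id \<and> cadjoint U \<circ> U = id"

definition projector :: "('a::chilbert_space \<Rightarrow> 'a) \<Rightarrow> bool" where
  "projector P \<longleftrightarrow> bounded_clinear P \<and> P \<circ> P = P \<and> cadjoint P = P"

text \<open>The sum of the family is taken in the strong operator topology.\<close>

definition orthogonal_resolution :: "'i set \<Rightarrow> ('i \<Rightarrow> 'a::chilbert_space \<Rightarrow> 'a) \<Rightarrow> bool" where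
  "orthogonal_resolution I P \<longleftrightarrow>
     (\<forall>k\<in>I. projector (P k)) \<and>
     (\<forall>j\<in>I. \<forall>k\<in>I. j \<noteq> k \<longrightarrow> P j \<circ> P k = (\<lambda>x. 0)) \<and>
     (\<forall>x. ((\<lambda>k. P k x) has_sum x) I)"

definition commutant :: "('a::chilbert_space \<Rightarrow> 'a) set \<Rightarrow> ('a \<Rightarrow> 'a) set" where
  "commutant M = {T. bounded_clinear T \<and> (\<forall>S\<in>M. T \<circ> S = S \<circ> T)}"

definition bicommutant :: "('a::chilbert_space \<Rightarrow> 'a) set \<Rightarrow> ('a \<Rightarrow> 'a) set" where
  "bicommutant M = commutant (commutant M)"

definition trace_class :: "('a::chilbert_space \<Rightarrow> 'a) set" where
  "trace_class = {T. bounded_clinear T \<and>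
     (\<exists>E. is_onb E \<and> (\<lambda>e. cinner e (abs_op T e)) summable_on E)}"

text \<open>On trace class operators the value does not depend on the chosen orthonormal basis.\<close>

definition trace_op :: "('a::chilbert_space \<Rightarrow> 'a) \<Rightarrow> complex" where
  "trace_op T = (\<Sum>\<^sub>\<infinity>e\<in>(SOME E. is_onb E). cinner e (T e))"

text \<open>The trace class operators of a closed subspace \<open>M\<close> with projector \<open>P\<close>, embedded into those of
  the whole space as the operators \<open>P T P\<close>.\<close>

definition trace_class_on :: "'a::chilbert_space set \<Rightarrow> ('a \<Rightarrow> 'a) set" where
  "trace_class_on M = {P \<circ> T \<circ> P | P T. projector P \<and> range P = M \<and> T \<in> trace_class}"

text \<open>An operator on the tensor product of a Hilbert space with the \<open>n\<close>-dimensional one is an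
  \<open>n \<times> n\<close> matrix of operators, acting on \<open>n\<close>-tuples of vectors, and the map that tensors \<open>\<Phi>\<close> with the
  identity acts entrywise. The matrix is trace class iff all its entries are.\<close>

definition positive_block :: "nat \<Rightarrow> (nat \<Rightarrow> nat \<Rightarrow> 'a::chilbert_space \<Rightarrow> 'a) \<Rightarrow> bool" where
  "positive_block n T \<longleftrightarrow> (\<forall>x. (\<Sum>i<n. \<Sum>j<n. cinner (x i) (T i j (x j))) \<in> \<real>\<^sub>\<ge>\<^sub>0)"

definition completely_positive ::
    "(('a::chilbert_space \<Rightarrow> 'a) \<Rightarrow> ('b::chilbert_space \<Rightarrow> 'b)) \<Rightarrow> bool" where
  "completely_positive \<Phi> \<longleftrightarrow>
     (\<forall>n T. (\<forall>i<n. \<forall>j<n. T i j \<in> trace_class) \<longrightarrow> positive_block n T \<longrightarrow>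
            positive_block n (\<lambda>i j. \<Phi> (T i j)))"

definition quantum_channel ::
    "(('a::chilbert_space \<Rightarrow> 'a) \<Rightarrow> ('b::chilbert_space \<Rightarrow> 'b)) \<Rightarrow> bool" where
  "quantum_channel \<Phi> \<longleftrightarrow>
     (\<forall>\<rho>\<in>trace_class. \<Phi> \<rho> \<in> trace_class) \<and>
     (\<forall>\<rho>\<in>trace_class. \<forall>\<sigma>\<in>trace_class. \<Phi> (\<lambda>x. \<rho> x + \<sigma> x) = (\<lambda>y. \<Phi> \<rho> y + \<Phi> \<sigma> y)) \<and>
     (\<forall>c. \<forall>\<rho>\<in>trace_class. \<Phi> (\<lambda>x. c *\<^sub>C \<rho> x) = (\<lambda>y. c *\<^sub>C \<Phi> \<rho> y)) \<and>
     (\<forall>\<rho>\<in>trace_class. trace_op (\<Phi> \<rho>) = trace_op \<rho>) \<and>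
     completely_positive \<Phi>"

definition dual_channel ::
    "(('a::chilbert_space \<Rightarrow> 'a) \<Rightarrow> ('b::chilbert_space \<Rightarrow> 'b)) \<Rightarrow> ('b \<Rightarrow> 'b) \<Rightarrow> ('a \<Rightarrow> 'a)" where
  "dual_channel \<Phi> Y =
     (THE X. bounded_clinear X \<and> (\<forall>\<rho>\<in>trace_class. trace_op (\<Phi> \<rho> \<circ> Y) = trace_op (\<rho> \<circ> X)))"

text \<open>The norm on the finite-dimensional space only provides its canonical topology.\<close>

definition symplectic_form :: "('z::real_normed_vector \<Rightarrow> 'z \<Rightarrow> real) \<Rightarrow> bool" where
  "symplectic_form \<Delta> \<longleftrightarrow>
     (\<exists>B::'z set. finite B \<and> span B = UNIV) \<and>
     bilinear \<Delta> \<and> (\<forall>z. \<Delta> z z = 0) \<and> (\<forall>z. (\<forall>z'. \<Delta> z z' = 0) \<longrightarrow> z = 0)"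

definition irreducible_family :: "('a::chilbert_space \<Rightarrow> 'a) set \<Rightarrow> bool" where
  "irreducible_family S \<longleftrightarrow>
     (UNIV :: 'a set) \<noteq> {0} \<and>
     (\<forall>M. closed M \<longrightarrow> csubspace M \<longrightarrow> (\<forall>T\<in>S. T ` M \<subseteq> M) \<longrightarrow> M = {0} \<or> M = UNIV)"

definition weyl_system ::
    "('z::real_normed_vector \<Rightarrow> 'z \<Rightarrow> real) \<Rightarrow> ('z \<Rightarrow> 'a::chilbert_space \<Rightarrow> 'a) \<Rightarrow> bool" where
  "weyl_system \<Delta> W \<longleftrightarrow>
     (\<forall>z. unitary_op (W z)) \<and>
     (\<forall>x. continuous_on UNIV (\<lambda>z. W z x)) \<and>
     (\<forall>z z'. W z \<circ> W z' = (\<lambda>x. exp (- (\<i> / 2) * of_real (\<Delta> z z')) *\<^sub>C W (z + z') x)) \<and>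
     irreducible_family (range W)"

definition psd_kernel :: "('z \<Rightarrow> 'z \<Rightarrow> complex) \<Rightarrow> bool" where
  "psd_kernel M \<longleftrightarrow>
     (\<forall>F c. finite F \<longrightarrow> (\<Sum>s\<in>F. \<Sum>r\<in>F. cnj (c s) * M s r * c r) \<in> \<real>\<^sub>\<ge>\<^sub>0)"

definition bosonic_linear_channel ::
    "('za::real_normed_vector \<Rightarrow> 'za \<Rightarrow> real) \<Rightarrow> ('za \<Rightarrow> 'a::chilbert_space \<Rightarrow> 'a) \<Rightarrow>
     ('zb::real_normed_vector \<Rightarrow> 'zb \<Rightarrow> real) \<Rightarrow> ('zb \<Rightarrow> 'b::chilbert_space \<Rightarrow> 'b) \<Rightarrow>
     ('zb \<Rightarrow> 'za) \<Rightarrow> ('zb \<Rightarrow> complex) \<Rightarrow> (('a \<Rightarrow> 'a) \<Rightarrow> ('b \<Rightarrow> 'b)) \<Rightarrow> bool" where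
  "bosonic_linear_channel \<Delta>A WA \<Delta>B WB K f \<Phi> \<longleftrightarrow>
     quantum_channel \<Phi> \<and> linear K \<and> continuous_on UNIV f \<and> f 0 = 1 \<and>
     psd_kernel (\<lambda>s r. f (s - r) * exp ((\<i> / 2) * of_real (\<Delta>B s r - \<Delta>A (K s) (K r)))) \<and>
     (\<forall>z. dual_channel \<Phi> (WB z) = (\<lambda>x. f z *\<^sub>C WA (K z) x))"

end

theory Submission
  imports Defs
begin

text \<open>For \<open>z \<in> Z\<^sub>f\<close> the dual channel maps the unitary \<open>W\<^sub>B z\<close> to the unitary \<open>W\<^sub>A (K z)\<close>, so \<open>W\<^sub>B z\<close>
  lies in its multiplicative domain, which on the predual reads
  \<open>\<Phi> (|U x\<rangle>\<langle>y|) = V \<Phi> (|x\<rangle>\<langle>y|)\<close> with \<open>U = W\<^sub>A (K z)\<close> and \<open>V = W\<^sub>B z\<close>. Consequently, for \<open>b\<close> in the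
  commutant of the \<open>W\<^sub>B z\<close>, the form \<open>(\<psi>, \<phi>) \<mapsto> \<langle>c, \<Phi> (|p\<rangle>\<langle>\<psi>|) b \<Phi> (|\<phi>\<rangle>\<langle>q|) d\<rangle>\<close> is given by an operator that
  commutes with all \<open>W\<^sub>A (K z)\<close>, hence with every \<open>P\<^sub>k\<close>. So the spaces generated by the vectors
  \<open>b \<Phi> (|P\<^sub>k \<phi>\<rangle>\<langle>q|) d\<close> are mutually orthogonal for different \<open>k\<close> and invariant under the commutant, and
  the projectors \<open>Q\<^sub>k\<close> onto them (with the common complement added to one of them) satisfy
  \<open>Q\<^sub>k \<Phi> (|\<phi>\<rangle>\<langle>q|) = \<Phi> (|P\<^sub>k \<phi>\<rangle>\<langle>q|)\<close>.\<close>

section \<open>Complex Hilbert spaces\<close>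

text \<open>In Kraus form, where \<Phi> sends \<rho> to the sum of A_i \<rho> followed by the
  adjoint of A_i, the vectors \<Phi> (|x><q|) d are combinations of the A_i x. Covariance then reads
  V A_i = A_i U, and the aim is Q_k A_i = A_i P_k. Images of rank one operators give access to these
  ranges without choosing Kraus operators. The obstacle is that the dual of \<Phi> may have a
  kernel, so preimages of the P_k are neither unique nor automatically orthogonal projectors.
  Building ranges invariant under the commutant yields projectors in the right algebra, straight
  from the definition of the bicommutant. The projector onto the common complement annihilates every
  \<Phi> (|x><q|), hence has dual zero; this is why it may be added to any one index. A second
  obstacle is that \<open>cadjoint\<close>, \<open>abs_op\<close> and \<open>dual_channel\<close>
  are definite descriptions and \<open>trace_op\<close> sums over a chosen basis. Existence and
  uniqueness need square roots, cyclicity of the trace and the density of rank one operators; this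
  explains the long operator-theoretic prelude.\<close>

lemma cinner_add_left: "cinner (x + y) z = cinner x z + cinner y z"
  by (metis cinner_add_right cinner_commute complex_cnj_add)

lemma cinner_scaleC_left: "cinner (c *\<^sub>C x) y = cnj c * cinner x y"
  by (metis cinner_scaleC_right cinner_commute complex_cnj_mult)

lemma cinner_self: "cinner x x = complex_of_real ((norm x)\<^sup>2)"
proof (rule complex_eqI)
  show "Re (cinner x x) = Re (complex_of_real ((norm x)\<^sup>2))"
    by (simp add: inner_eq_Re_cinner[symmetric] power2_norm_eq_inner)
  have "cinner x x = cnj (cinner x x)" by (rule cinner_commute)
  then show "Im (cinner x x) = Im (complex_of_real ((norm x)\<^sup>2))"
    by (simp add: complex_eq_iff)
qed

lemma norm_eq_cinner: "(norm x)\<^sup>2 = Re (cinner x x)"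
  by (simp add: cinner_self)

lemma scaleC_zero_left [simp]: "0 *\<^sub>C x = (0::'a::chilbert_space)"
  using scaleC_of_real[of 0 x] by simp

lemma scaleC_zero_right [simp]: "c *\<^sub>C 0 = (0::'a::chilbert_space)"
  using scaleC_add_right[of c 0 "0::'a"] by simp

lemma scaleC_one [simp]: "1 *\<^sub>C x = (x::'a::chilbert_space)"
  using scaleC_of_real[of 1 x] by simp

lemma scaleC_minus_one: "(-1) *\<^sub>C x = - (x::'a::chilbert_space)"
  using scaleC_of_real[of "-1" x] by simp

lemma norm_scaleC: "norm (c *\<^sub>C x) = cmod c * norm (x::'a::chilbert_space)"
proof -
  have "cinner (c *\<^sub>C x) (c *\<^sub>C x) = (c * cnj c) * cinner x x"
    by (simp add: cinner_scaleC_left cinner_scaleC_right)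
  then have "(norm (c *\<^sub>C x))\<^sup>2 = (cmod c * norm x)\<^sup>2"
    unfolding cinner_self complex_norm_square[symmetric]
    by (metis of_real_eq_iff of_real_mult power_mult_distrib)
  then show ?thesis
    by (metis mult_nonneg_nonneg norm_ge_zero power2_eq_imp_eq)
qed

lemma norm_cinner_le: "cmod (cinner x y) \<le> norm x * norm y"
proof (cases "cinner x y = 0")
  case False
  \<comment> \<open>The phase \<open>u\<close> makes the inner product real and nonnegative, so the
    real Cauchy-Schwarz inequality yields the complex one.\<close>
  define u where "u = cnj (cinner x y) / cmod (cinner x y)"
  have "cinner x (u *\<^sub>C y) = (cinner x y * cnj (cinner x y)) / cmod (cinner x y)"
    by (simp add: cinner_scaleC_right u_def)
  also have "\<dots> = cmod (cinner x y)"
    unfolding complex_norm_square[symmetric] using False by (simp add: power2_eq_square)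
  finally have "cmod (cinner x y) = x \<bullet> (u *\<^sub>C y)"
    by (simp add: inner_eq_Re_cinner)
  also have "\<dots> \<le> norm x * norm (u *\<^sub>C y)" by (rule norm_cauchy_schwarz)
  also have "norm (u *\<^sub>C y) = norm y"
    using False by (simp add: norm_scaleC u_def norm_divide)
  finally show ?thesis .
qed simp

lemma bounded_bilinear_cinner: "bounded_bilinear (cinner :: 'a::chilbert_space \<Rightarrow> 'a \<Rightarrow> complex)"
proof
  fix r :: real and x y :: 'a
  show "cinner (r *\<^sub>R x) y = r *\<^sub>R cinner x y"
    by (metis cinner_scaleC_left complex_cnj_complex_of_real scaleC_of_real scaleR_conv_of_real)
  show "cinner x (r *\<^sub>R y) = r *\<^sub>R cinner x y"
    by (metis cinner_scaleC_right scaleC_of_real scaleR_conv_of_real)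
  show "\<exists>K. \<forall>a b. cmod (cinner a b) \<le> norm (a::'a) * norm b * K"
    by (rule exI[of _ 1]) (simp add: norm_cinner_le)
qed (simp_all add: cinner_add_left cinner_add_right)

interpretation cinner: bounded_bilinear "cinner :: 'a::chilbert_space \<Rightarrow> 'a \<Rightarrow> complex"
  by (rule bounded_bilinear_cinner)

lemma bounded_bilinear_scaleC: "bounded_bilinear (scaleC :: complex \<Rightarrow> 'a::chilbert_space \<Rightarrow> 'a)"
proof
  fix r :: real and c :: complex and y :: 'a
  show "(r *\<^sub>R c) *\<^sub>C y = r *\<^sub>R c *\<^sub>C y"
    by (metis scaleC_of_real scaleC_scaleC scaleR_conv_of_real)
  show "c *\<^sub>C (r *\<^sub>R y) = r *\<^sub>R c *\<^sub>C y"
    by (metis mult.commute scaleC_of_real scaleC_scaleC)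
  show "\<exists>K. \<forall>c x. norm (c *\<^sub>C (x::'a)) \<le> norm c * norm x * K"
    by (rule exI[of _ 1]) (simp add: norm_scaleC)
qed (simp_all add: scaleC_add_left scaleC_add_right)

interpretation scaleC: bounded_bilinear "scaleC :: complex \<Rightarrow> 'a::chilbert_space \<Rightarrow> 'a"
  by (rule bounded_bilinear_scaleC)

lemmas cinner_simps = cinner_add_left cinner_add_right cinner.diff_left cinner.diff_right
  cinner.minus_left cinner.minus_right cinner_scaleC_left cinner_scaleC_right
  cinner.zero_left cinner.zero_right

declare cinner.zero_left [simp] cinner.zero_right [simp]

lemma cinner_eqI: "(\<And>y. cinner y x = cinner y x') \<Longrightarrow> x = x'"
proof -
  assume "\<And>y. cinner y x = cinner y x'"
  then have "cinner (x - x') (x - x') = 0" by (simp add: cinner.diff_right)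
  then show ?thesis by (simp add: cinner_self)
qed

lemma cinner_eqI_left: "(\<And>y. cinner x y = cinner x' y) \<Longrightarrow> x = x'"
  by (metis cinner_commute cinner_eqI)

lemma cinner_self_eq_0 [simp]: "cinner x x = 0 \<longleftrightarrow> x = 0"
  by (simp add: cinner_self)

lemma cinner_zero_commute: "cinner x y = 0 \<Longrightarrow> cinner y x = 0"
  by (metis cinner_commute complex_cnj_zero)

section \<open>Closest points and orthogonal complements\<close>

lemma parallelogram:
  fixes x y :: "'a::real_inner"
  shows "(norm (x - y))\<^sup>2 = 2 * (norm x)\<^sup>2 + 2 * (norm y)\<^sup>2 - (norm (x + y))\<^sup>2"
  by (simp add: power2_norm_eq_inner inner_add_left inner_add_right inner_diff_left
      inner_diff_right inner_commute)

lemma csubspace_simps: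
  assumes "csubspace M"
  shows "0 \<in> M" "\<And>x y. x \<in> M \<Longrightarrow> y \<in> M \<Longrightarrow> x + y \<in> M" "\<And>c x. x \<in> M \<Longrightarrow> c *\<^sub>C x \<in> M"
    "\<And>x y. x \<in> M \<Longrightarrow> y \<in> M \<Longrightarrow> x - y \<in> M" "\<And>r x. x \<in> M \<Longrightarrow> r *\<^sub>R x \<in> M"
proof -
  show *: "0 \<in> M" "\<And>x y. x \<in> M \<Longrightarrow> y \<in> M \<Longrightarrow> x + y \<in> M"
    and **: "\<And>c x. x \<in> M \<Longrightarrow> c *\<^sub>C x \<in> M"
    using assms unfolding csubspace_def by auto
  show "x - y \<in> M" if "x \<in> M" "y \<in> M" for x y
    using *(2)[of x "(-1) *\<^sub>C y"] **[of y "-1"] that by (simp add: scaleC_minus_one)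
  show "r *\<^sub>R x \<in> M" if "x \<in> M" for r x
    using **[of x "complex_of_real r"] that by (simp add: scaleC_of_real)
qed

lemma csubspace_closure:
  assumes "csubspace M"
  shows "csubspace (closure M)"
  unfolding csubspace_def
proof (intro conjI ballI allI)
  show "0 \<in> closure M" using csubspace_simps(1)[OF assms] closure_subset by auto
next
  fix x y assume "x \<in> closure M" "y \<in> closure M"
  then obtain u v where "\<And>n. u n \<in> M" "u \<longlonglongrightarrow> x" "\<And>n. v n \<in> M" "v \<longlonglongrightarrow> y"
    by (auto simp: closure_sequential)
  then show "x + y \<in> closure M"
    unfolding closure_sequential
    by (intro exI[of _ "\<lambda>n. u n + v n"]) (auto intro: csubspace_simps[OF assms] tendsto_add)
next
  fix c x assume "x \<in> closure M"
  then obtain u where "\<And>n. u n \<in> M" "u \<longlonglongrightarrow> x"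
    by (auto simp: closure_sequential)
  then show "c *\<^sub>C x \<in> closure M"
    unfolding closure_sequential
    by (intro exI[of _ "\<lambda>n. c *\<^sub>C u n"])
      (auto intro: csubspace_simps[OF assms] scaleC.tendsto)
qed

text \<open>Arbitrary sets are allowed because the complement is a closed subspace in any case. So
  \<open>orth (orth S)\<close> later plays the part of the closed linear span of
  \<open>S\<close>.\<close>

definition orth :: "'a::chilbert_space set \<Rightarrow> 'a set" where
  "orth S = {x. \<forall>y\<in>S. cinner y x = 0}"

lemma csubspace_orth: "csubspace (orth S)"
  by (simp add: csubspace_def orth_def cinner_add_right cinner_scaleC_right)

lemma closed_orth: "closed (orth S)"
proof -
  have "orth S = (\<Inter>y\<in>S. {x. cinner y x = 0})" by (auto simp: orth_def)
  moreover have "closed {x. cinner y x = 0}" for y :: 'a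
    by (intro closed_Collect_eq cinner.continuous_on continuous_intros)
  ultimately show ?thesis by auto
qed

text \<open>A minimising sequence is Cauchy by the parallelogram law, so completeness supplies the
  limit and closedness keeps it in \<open>M\<close>.\<close>

lemma closest_point_exists:
  fixes x :: "'a::chilbert_space"
  assumes "closed M" "csubspace M"
  shows "\<exists>m\<in>M. \<forall>y\<in>M. norm (x - m) \<le> norm (x - y)"
proof -
  define d where "d = Inf ((\<lambda>y. norm (x - y)) ` M)"
  have ne: "M \<noteq> {}" using csubspace_simps(1)[OF assms(2)] by auto
  have bdd: "bdd_below ((\<lambda>y. norm (x - y)) ` M)" by (rule bdd_belowI[of _ 0]) auto
  have d_le: "d \<le> norm (x - y)" if "y \<in> M" for y
    unfolding d_def by (rule cInf_lower[OF _ bdd]) (use that in auto)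
  have d0: "0 \<le> d" unfolding d_def by (rule cInf_greatest) (use ne in auto)
  have "\<exists>y\<in>M. norm (x - y) < d + e" if "e > 0" for e
    using cInf_lessD[of "(\<lambda>y. norm (x - y)) ` M" "d + e"] ne that unfolding d_def by auto
  then have "\<forall>n. \<exists>y\<in>M. norm (x - y) < d + 1 / real (Suc n)" by simp
  then obtain u where uM: "\<And>n. u n \<in> M" and ud: "\<And>n. norm (x - u n) < d + 1 / real (Suc n)"
    by metis
  have lim: "(\<lambda>n. norm (x - u n)) \<longlonglongrightarrow> d"
  proof (rule tendsto_sandwich[of "\<lambda>n. d" _ _ "\<lambda>n. d + 1 / real (Suc n)"])
    show "(\<lambda>n. d + 1 / real (Suc n)) \<longlonglongrightarrow> d"
      using tendsto_add[OF tendsto_const LIMSEQ_inverse_real_of_nat, of d]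
      by (simp add: inverse_eq_divide)
  qed (use d_le uM ud in \<open>auto intro!: always_eventually less_imp_le\<close>)
  \<comment> \<open>Parallelogram law for the two error vectors: half their sum is the error of the
    midpoint, which lies in \<open>M\<close> and so has norm at least \<open>d\<close>.\<close>
  have bound: "(norm (u n - u m))\<^sup>2 \<le> 2 * (norm (x - u n))\<^sup>2 + 2 * (norm (x - u m))\<^sup>2 - 4 * d\<^sup>2"
    for n m
  proof -
    have "(1/2) *\<^sub>R (u n + u m) \<in> M" by (intro csubspace_simps[OF assms(2)] uM)
    then have "d\<^sup>2 \<le> (norm (x - (1/2) *\<^sub>R (u n + u m)))\<^sup>2" using d_le d0 by (simp add: power_mono)
    moreover have "(x - u m) + (x - u n) = 2 *\<^sub>R (x - (1/2) *\<^sub>R (u n + u m))"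
      by (simp add: algebra_simps scaleR_2)
    then have "(norm ((x - u m) + (x - u n)))\<^sup>2 = 4 * (norm (x - (1/2) *\<^sub>R (u n + u m)))\<^sup>2"
      by (simp add: power_mult_distrib)
    ultimately show ?thesis
      using parallelogram[of "x - u m" "x - u n"] by simp
  qed
  have "Cauchy u"
  proof (rule metric_CauchyI)
    fix e :: real assume "e > 0"
    have "(\<lambda>n. (norm (x - u n))\<^sup>2) \<longlonglongrightarrow> d\<^sup>2" by (intro tendsto_power lim)
    then obtain N where N: "\<And>n. n \<ge> N \<Longrightarrow> \<bar>(norm (x - u n))\<^sup>2 - d\<^sup>2\<bar> < e\<^sup>2 / 4"
      using \<open>e > 0\<close> unfolding LIMSEQ_iff by (metis divide_pos_pos real_norm_def zero_less_numeral
        zero_less_power)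
    have "dist (u m) (u n) < e" if "m \<ge> N" "n \<ge> N" for m n
    proof -
      have "(norm (u m - u n))\<^sup>2 < e\<^sup>2"
        using bound[of m n] N[OF that(1)] N[OF that(2)] by linarith
      then show ?thesis using \<open>e > 0\<close> by (simp add: dist_norm power2_less_imp_less)
    qed
    then show "\<exists>N. \<forall>m\<ge>N. \<forall>n\<ge>N. dist (u m) (u n) < e" by blast
  qed
  then obtain m where m: "u \<longlonglongrightarrow> m" using Cauchy_convergent convergent_def by blast
  have mM: "m \<in> M" using closed_sequentially[OF assms(1)] uM m by blast
  have "(\<lambda>n. norm (x - u n)) \<longlonglongrightarrow> norm (x - m)" by (intro tendsto_intros m)
  then have "norm (x - m) = d" using lim LIMSEQ_unique by blast
  with mM d_le show ?thesis by auto
qed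

text \<open>The discriminant argument behind every inequality of Cauchy-Schwarz type below.\<close>

lemma quadratic_form_nonneg:
  fixes a c :: real and b :: complex
  assumes "0 \<le> c" and nonneg: "\<And>t. 0 \<le> a + 2 * Re (t * b) + (cmod t)\<^sup>2 * c"
  shows "(cmod b)\<^sup>2 \<le> a * c"
proof -
  define m where "m = (cmod b)\<^sup>2"
  \<comment> \<open>Choosing \<open>t\<close> as a real multiple of \<open>- cnj b\<close> aligns
    the phases and leaves a real quadratic in \<open>s\<close>.\<close>
  have *: "0 \<le> a - 2 * s * m + s\<^sup>2 * m * c" for s
  proof -
    have "(- of_real s * cnj b) * b = of_real (- s * m)"
      using complex_norm_square[of b] by (simp add: m_def mult.commute mult.left_commute)
    then have "Re ((- of_real s * cnj b) * b) = - s * m" by (metis Re_complex_of_real)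
    moreover have "(cmod (- of_real s * cnj b))\<^sup>2 = s\<^sup>2 * m"
      by (simp add: m_def norm_mult power_mult_distrib)
    ultimately show ?thesis using nonneg[of "- of_real s * cnj b"] by simp
  qed
  show ?thesis
  proof (cases "c = 0")
    case True
    have "m = 0"
    proof (rule ccontr)
      assume "m \<noteq> 0"
      then show False using *[of "(a + 1) / m"] *[of 0] True by simp
    qed
    then show ?thesis using True by (simp add: m_def)
  next
    case False
    then have "0 \<le> a - m / c" using *[of "1 / c"] by (simp add: power2_eq_square)
    then show ?thesis using False assms(1) by (simp add: m_def field_simps)
  qed
qed

text \<open>Moving \<open>m\<close> inside \<open>M\<close> along \<open>y\<close> cannot decrease
  the distance. The resulting quadratic in \<open>t\<close> has constant term 0, so its linear
  coefficient, the inner product, must vanish.\<close>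

lemma closest_point_orth:
  fixes x :: "'a::chilbert_space"
  assumes "csubspace M" "m \<in> M" and min: "\<forall>y\<in>M. norm (x - m) \<le> norm (x - y)"
  shows "x - m \<in> orth M"
  unfolding orth_def
proof (clarify)
  fix y assume y: "y \<in> M"
  have "0 \<le> 0 + 2 * Re (t * cinner (x - m) y) + (cmod t)\<^sup>2 * (norm y)\<^sup>2" for t
  proof -
    have "norm (x - m) \<le> norm (x - (m - t *\<^sub>C y))"
      using min csubspace_simps(4)[OF assms(1,2) csubspace_simps(3)[OF assms(1) y]] by blast
    moreover have "x - (m - t *\<^sub>C y) = (x - m) + t *\<^sub>C y" by simp
    ultimately have "(norm (x - m))\<^sup>2 \<le> (norm ((x - m) + t *\<^sub>C y))\<^sup>2"
      by (metis norm_ge_zero power_mono)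
    also have "\<dots> = (norm (x - m))\<^sup>2 + 2 * Re (t * cinner (x - m) y) + (cmod t)\<^sup>2 * (norm y)\<^sup>2"
    proof -
      have "(norm ((x - m) + t *\<^sub>C y))\<^sup>2 = (x - m) \<bullet> (x - m) + 2 * ((x - m) \<bullet> (t *\<^sub>C y))
          + (norm (t *\<^sub>C y))\<^sup>2"
        unfolding power2_norm_eq_inner inner_add_left inner_add_right
          inner_commute[of "t *\<^sub>C y" "x - m"] by simp
      moreover have "(x - m) \<bullet> (t *\<^sub>C y) = Re (t * cinner (x - m) y)"
        by (simp only: inner_eq_Re_cinner cinner_scaleC_right)
      moreover have "(norm (t *\<^sub>C y))\<^sup>2 = (cmod t)\<^sup>2 * (norm y)\<^sup>2"
        by (simp only: norm_scaleC power_mult_distrib)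
      ultimately show ?thesis by (simp only: power2_norm_eq_inner)
    qed
    finally show ?thesis by simp
  qed
  then have "(cmod (cinner (x - m) y))\<^sup>2 \<le> 0 * (norm y)\<^sup>2" by (rule quadratic_form_nonneg[rotated]) simp
  then have "cinner (x - m) y = 0" by simp
  then show "cinner y (x - m) = 0" by (rule cinner_zero_commute)
qed

lemma orthogonal_decomposition:
  fixes x :: "'a::chilbert_space"
  assumes "closed M" "csubspace M"
  shows "\<exists>m\<in>M. x - m \<in> orth M"
  using closest_point_exists[OF assms] closest_point_orth[OF assms(2)] by blast

lemma orth_eq_0_imp_UNIV:
  assumes "closed M" "csubspace M" "orth M \<subseteq> {0}"
  shows "M = UNIV"
  using orthogonal_decomposition[OF assms(1,2)] assms(3)
  by (metis UNIV_eq_I eq_iff_diff_eq_0 singletonD subsetD)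

section \<open>Bounded operators and adjoints\<close>

lemma bounded_clinearD:
  assumes "bounded_clinear T"
  shows "bounded_linear T" "linear T" "T (c *\<^sub>C x) = c *\<^sub>C T x" "T (x + y) = T x + T y"
    "T (x - y) = T x - T y" "T 0 = 0" "T (- x) = - T x"
proof -
  show "bounded_linear T" "T (c *\<^sub>C x) = c *\<^sub>C T x"
    using assms by (auto simp: bounded_clinear_def)
  then show "linear T" by (simp add: bounded_linear.linear)
  then show "T (x + y) = T x + T y" "T (x - y) = T x - T y" "T 0 = 0" "T (- x) = - T x"
    by (simp_all add: linear_add linear_diff linear_0 linear_neg)
qed

lemma bounded_clinear_sum: "bounded_clinear T \<Longrightarrow> T (\<Sum>i\<in>F. x i) = (\<Sum>i\<in>F. T (x i))"
  by (metis bounded_clinearD(2) linear_sum)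

lemma bounded_clinearI:
  assumes "\<And>x y. T (x + y) = T x + T y" "\<And>c x. T (c *\<^sub>C x) = c *\<^sub>C T x"
    "\<And>x. norm (T x) \<le> norm x * K"
  shows "bounded_clinear T"
proof -
  have "bounded_linear T"
    by (rule bounded_linear_intro[where K = K]) (use assms in \<open>auto simp: scaleC_of_real[symmetric]\<close>)
  then show ?thesis using assms(2) by (simp add: bounded_clinear_def)
qed

lemma bounded_clinear_bound:
  assumes "bounded_clinear T"
  obtains K where "K \<ge> 0" "\<And>x. norm (T x) \<le> K * norm x"
  using bounded_linear.nonneg_bounded[OF bounded_clinearD(1)[OF assms]]
  by (metis mult.commute)

lemma bounded_clinear_id [simp]: "bounded_clinear (\<lambda>x. x)" "bounded_clinear id"
  by (rule bounded_clinearI[of _ 1]; simp)+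

lemma bounded_clinear_zero [simp]: "bounded_clinear (\<lambda>x. 0)"
  by (rule bounded_clinearI[of _ 1]; simp)

lemma bounded_clinear_comp:
  assumes "bounded_clinear S" "bounded_clinear T"
  shows "bounded_clinear (\<lambda>x. S (T x))"
  using assms bounded_linear_compose unfolding bounded_clinear_def by auto

lemma bounded_clinear_comp' [simp]:
  "bounded_clinear S \<Longrightarrow> bounded_clinear T \<Longrightarrow> bounded_clinear (S \<circ> T)"
  unfolding comp_def by (rule bounded_clinear_comp)

lemma bounded_clinear_add:
  assumes "bounded_clinear S" "bounded_clinear T"
  shows "bounded_clinear (\<lambda>x. S x + T x)"
  using assms bounded_linear_add unfolding bounded_clinear_def by (auto simp: scaleC_add_right)

lemma bounded_clinear_scaleC:
  assumes "bounded_clinear S"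
  shows "bounded_clinear (\<lambda>x. c *\<^sub>C S x)"
  using assms bounded_linear_compose[OF scaleC.bounded_linear_right[of c]]
  unfolding bounded_clinear_def by (auto simp: scaleC_scaleC mult.commute)

lemma bounded_clinear_diff:
  assumes "bounded_clinear S" "bounded_clinear T"
  shows "bounded_clinear (\<lambda>x. S x - T x)"
  using assms bounded_linear_sub unfolding bounded_clinear_def by (auto simp: scaleC.diff_right)

lemma bounded_clinear_finite_sum:
  assumes "\<And>i. i \<in> F \<Longrightarrow> bounded_clinear (T i)"
  shows "bounded_clinear (\<lambda>x. \<Sum>i\<in>F. T i x)"
  using assms by (induction F rule: infinite_finite_induct) (auto intro!: bounded_clinear_add)

text \<open>The kernel of a nonzero functional has a nonzero orthogonal vector \<open>v\<close>. As
  \<open>\<phi> v *\<^sub>C x - \<phi> x *\<^sub>C v\<close> lies in the kernel, pairing it with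
  \<open>v\<close> expresses \<open>\<phi> x\<close> through \<open>cinner v x\<close>.\<close>

lemma riesz:
  fixes \<phi> :: "'a::chilbert_space \<Rightarrow> complex"
  assumes add: "\<And>x y. \<phi> (x + y) = \<phi> x + \<phi> y" and sc: "\<And>c x. \<phi> (c *\<^sub>C x) = c * \<phi> x"
    and bd: "\<And>x. cmod (\<phi> x) \<le> C * norm x"
  shows "\<exists>w. \<forall>x. \<phi> x = cinner w x"
proof -
  have bl: "bounded_linear \<phi>"
    by (rule bounded_linear_intro[where K = C])
      (use assms in \<open>auto simp: scaleC_of_real[symmetric] scaleR_conv_of_real mult.commute\<close>)
  define M where "M = {x. \<phi> x = 0}"
  have z: "\<phi> 0 = 0" using sc[of 0 0] by simp
  have M: "csubspace M" by (auto simp: csubspace_def M_def add sc z)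
  have "closed M" unfolding M_def
    by (intro closed_Collect_eq continuous_intros linear_continuous_on bl)
  show ?thesis
  proof (cases "orth M \<subseteq> {0}")
    case True
    then have "M = UNIV" using orth_eq_0_imp_UNIV[OF \<open>closed M\<close> M] by blast
    then show ?thesis by (intro exI[of _ 0]) (auto simp: M_def)
  next
    case False
    then obtain v where v: "v \<in> orth M" "v \<noteq> 0" by auto
    have "\<phi> x * cinner v v = \<phi> v * cinner v x" for x
    proof -
      have "\<phi> (\<phi> v *\<^sub>C x - \<phi> x *\<^sub>C v) = 0"
        using bounded_linear.linear[OF bl] by (simp add: linear_diff sc)
      then have "cinner (\<phi> v *\<^sub>C x - \<phi> x *\<^sub>C v) v = 0"
        using v(1) by (auto simp: orth_def M_def)
      then have "cinner v (\<phi> v *\<^sub>C x - \<phi> x *\<^sub>C v) = 0" by (rule cinner_zero_commute)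
      then show ?thesis by (simp add: cinner_simps)
    qed
    then have "\<phi> x = cinner ((cnj (\<phi> v) / cinner v v) *\<^sub>C v) x" for x
      using v(2) by (simp add: cinner_simps field_simps cinner_self)
    then show ?thesis by blast
  qed
qed

text \<open>Riesz for each fixed second argument. This is the source of all operators below that are
  given only by their matrix elements: adjoints, duals of channels, and the operator behind
  \<open>bicommutant_shift\<close>. No sign of \<open>C\<close> is assumed, hence the absolute value
  in the bound.\<close>

lemma sesquilinear_operator:
  fixes B :: "'b::chilbert_space \<Rightarrow> 'a::chilbert_space \<Rightarrow> complex"
  assumes "\<And>x y z. B (x + y) z = B x z + B y z" "\<And>c x z. B (c *\<^sub>C x) z = cnj c * B x z"
    and "\<And>x y z. B z (x + y) = B z x + B z y" "\<And>c x z. B z (c *\<^sub>C x) = c * B z x"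
    and bd: "\<And>x y. cmod (B y x) \<le> C * norm x * norm y"
  shows "\<exists>T. bounded_clinear T \<and> (\<forall>x y. cinner y (T x) = B y x)"
proof -
  have "\<exists>w. \<forall>y. cnj (B y x) = cinner w y" for x
    by (rule riesz[of _ "C * norm x"]) (simp_all add: assms)
  then obtain T where T: "\<And>x y. cnj (B y x) = cinner (T x) y" by metis
  have T': "cinner y (T x) = B y x" for x y
    by (metis T cinner_commute complex_cnj_cnj)
  have "bounded_clinear T"
  proof (rule bounded_clinearI[of _ "\<bar>C\<bar>"])
    show "T (x + y) = T x + T y" for x y by (rule cinner_eqI) (simp add: cinner_simps T' assms)
    show "T (c *\<^sub>C x) = c *\<^sub>C T x" for c x by (rule cinner_eqI) (simp add: cinner_simps T' assms)
    fix x
    have "norm (T x) * norm (T x) = cmod (cinner (T x) (T x))"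
      by (simp add: cinner_self power2_eq_square norm_mult)
    also have "\<dots> \<le> C * norm x * norm (T x)" unfolding T' by (rule bd)
    also have "\<dots> \<le> \<bar>C\<bar> * norm x * norm (T x)" by (intro mult_right_mono) auto
    finally show "norm (T x) \<le> norm x * \<bar>C\<bar>"
      by (cases "T x = 0") (simp_all add: mult.commute)
  qed
  with T' show ?thesis by blast
qed

text \<open>Discharges the definite description in \<open>cadjoint\<close>.\<close>

lemma cadjoint_ex1:
  assumes T: "bounded_clinear T"
  shows "\<exists>!S. bounded_clinear S \<and> (\<forall>x y. cinner (S y) x = cinner y (T x))"
proof -
  obtain K where K: "K \<ge> 0" "\<And>x. norm (T x) \<le> K * norm x"
    using bounded_clinear_bound[OF T] by blast
  have "\<exists>S. bounded_clinear S \<and> (\<forall>x y. cinner y (S x) = cinner (T y) x)"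
  proof (rule sesquilinear_operator[where C = K])
    fix x y
    have "cmod (cinner (T y) x) \<le> norm (T y) * norm x" by (rule norm_cinner_le)
    also have "\<dots> \<le> (K * norm y) * norm x" by (intro mult_right_mono K) simp
    finally show "cmod (cinner (T y) x) \<le> K * norm x * norm y" by (simp add: mult_ac)
  qed (simp_all add: bounded_clinearD[OF T] cinner_simps)
  then obtain S where S: "bounded_clinear S" "\<And>x y. cinner y (S x) = cinner (T y) x" by blast
  then have "cinner (S y) x = cinner y (T x)" for x y by (metis cinner_commute)
  moreover have "S' = S" if "\<forall>x y. cinner (S' y) x = cinner y (T x)" for S'
    by (rule ext, rule cinner_eqI_left) (simp add: that calculation)
  ultimately show ?thesis using S(1) by (intro ex1I[of _ S]) simp_all
qed

lemma
  assumes "bounded_clinear T"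
  shows bounded_clinear_cadjoint: "bounded_clinear (cadjoint T)"
    and cinner_cadjoint_left: "cinner (cadjoint T y) x = cinner y (T x)"
  using theI'[OF cadjoint_ex1[OF assms]] unfolding cadjoint_def by auto

lemma cinner_cadjoint_right: "bounded_clinear T \<Longrightarrow> cinner x (cadjoint T y) = cinner (T x) y"
  by (metis cinner_cadjoint_left cinner_commute)

lemma cadjoint_eqI:
  assumes "bounded_clinear T" "bounded_clinear S" "\<And>x y. cinner (S y) x = cinner y (T x)"
  shows "cadjoint T = S"
  by (rule ext, rule cinner_eqI_left) (simp add: assms cinner_cadjoint_left)

lemma cadjoint_cadjoint: "bounded_clinear T \<Longrightarrow> cadjoint (cadjoint T) = T"
  by (intro cadjoint_eqI bounded_clinear_cadjoint) (simp_all add: cinner_cadjoint_right)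

lemma positive_opD:
  assumes "positive_op T"
  shows "bounded_clinear T" "Re (cinner x (T x)) \<ge> 0" "cinner x (T x) = of_real (Re (cinner x (T x)))"
  using assms by (auto simp: positive_op_def complex_nonneg_Reals_iff complex_eq_iff)

text \<open>A complex quadratic form with real values is hermitian: evaluating it at
  \<open>x + y\<close> and at \<open>x + \<i> *\<^sub>C y\<close> determines imaginary and real
  parts of the off-diagonal values.\<close>

lemma positive_op_selfadj:
  assumes "positive_op T"
  shows "cinner (T x) y = cinner x (T y)"
proof -
  have im: "Im (cinner x (T x)) = 0" for x
    using positive_opD(3)[OF assms, of x] by (metis Im_complex_of_real)
  note lin = bounded_clinearD[OF positive_opD(1)[OF assms]]
  have "Im (cinner x (T y)) + Im (cinner y (T x)) = 0"
    using im[of "x + y"] im[of x] im[of y] by (simp add: cinner_simps lin)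
  moreover have "Re (cinner x (T y)) = Re (cinner y (T x))"
    using im[of "x + \<i> *\<^sub>C y"] im[of x] im[of y] by (simp add: cinner_simps lin)
  ultimately have "cinner x (T y) = cnj (cinner y (T x))" by (simp add: complex_eq_iff)
  then show ?thesis by (metis cinner_commute)
qed

lemma positive_op_cauchy_schwarz:
  assumes "positive_op T"
  shows "(cmod (cinner x (T y)))\<^sup>2 \<le> Re (cinner x (T x)) * Re (cinner y (T y))"
proof (rule quadratic_form_nonneg)
  show "0 \<le> Re (cinner y (T y))" by (rule positive_opD(2)[OF assms])
  fix t
  note lin = bounded_clinearD[OF positive_opD(1)[OF assms]]
  have sym: "cinner y (T x) = cnj (cinner x (T y))"
    by (metis cinner_commute positive_op_selfadj[OF assms])
  have "cinner (x + t *\<^sub>C y) (T (x + t *\<^sub>C y)) = cinner x (T x) + (t * cinner x (T y) +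
      cnj (t * cinner x (T y))) + (t * cnj t) * cinner y (T y)"
    by (simp add: cinner_simps lin sym algebra_simps)
  also have "t * cinner x (T y) + cnj (t * cinner x (T y)) = of_real (2 * Re (t * cinner x (T y)))"
    by (rule complex_add_cnj)
  also have "t * cnj t = of_real ((cmod t)\<^sup>2)" by (metis complex_norm_square of_real_power)
  finally have "Re (cinner (x + t *\<^sub>C y) (T (x + t *\<^sub>C y))) =
     Re (cinner x (T x)) + 2 * Re (t * cinner x (T y)) + (cmod t)\<^sup>2 * Re (cinner y (T y))"
    by simp
  then show "0 \<le> Re (cinner x (T x)) + 2 * Re (t * cinner x (T y)) + (cmod t)\<^sup>2 * Re (cinner y (T y))"
    using positive_opD(2)[OF assms, of "x + t *\<^sub>C y"] by linarith
qed

lemma positive_op_eq_0: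
  assumes "positive_op T" "cinner x (T x) = 0"
  shows "T x = 0"
proof -
  have "(cmod (cinner (T x) (T x)))\<^sup>2 \<le> Re (cinner (T x) (T (T x))) * Re (cinner x (T x))"
    by (rule positive_op_cauchy_schwarz[OF assms(1)])
  then show ?thesis using assms(2) by simp
qed

text \<open>The Cauchy-Schwarz inequality of the form, applied to \<open>T x\<close> and
  \<open>x\<close>, upgrades a bound on the quadratic form to a norm bound with the same constant.
  The square root construction needs this sharp constant.\<close>

lemma positive_op_norm_le:
  assumes "positive_op T" "\<And>x. Re (cinner x (T x)) \<le> K * (norm x)\<^sup>2"
  shows "norm (T x) \<le> K * norm x"
proof (cases "T x = 0")
  case True
  have "0 \<le> K * (norm x)\<^sup>2" using order_trans[OF positive_opD(2)[OF assms(1)] assms(2)] .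
  then have "0 \<le> K * norm x" by (cases "x = 0") (simp_all add: zero_le_mult_iff)
  then show ?thesis using True by simp
next
  case False
  have x: "x \<noteq> 0" using False bounded_clinearD(6)[OF positive_opD(1)[OF assms(1)]] by auto
  have "0 \<le> K * (norm x)\<^sup>2" using order_trans[OF positive_opD(2)[OF assms(1)] assms(2)] .
  then have K: "K \<ge> 0" using x by (simp add: zero_le_mult_iff)
  have "(norm (T x))\<^sup>2 * (norm (T x))\<^sup>2 = (cmod (cinner (T x) (T x)))\<^sup>2"
    by (simp add: cinner_self norm_power power2_eq_square norm_mult)
  also have "\<dots> \<le> Re (cinner (T x) (T (T x))) * Re (cinner x (T x))"
    by (rule positive_op_cauchy_schwarz[OF assms(1)])
  also have "\<dots> \<le> (K * (norm (T x))\<^sup>2) * (K * (norm x)\<^sup>2)"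
    by (intro mult_mono assms positive_opD(2) mult_nonneg_nonneg K) simp
  finally have "(norm (T x))\<^sup>2 * (norm (T x))\<^sup>2 \<le> (norm (T x))\<^sup>2 * (K * norm x)\<^sup>2"
    by (simp add: power2_eq_square mult_ac)
  then have "(norm (T x))\<^sup>2 \<le> (K * norm x)\<^sup>2"
    by (rule mult_left_le_imp_le) (use False in simp)
  then show ?thesis by (rule power2_le_imp_le) (simp add: K)
qed

section \<open>Projectors and orthonormal bases\<close>

lemma projectorD:
  assumes "projector P"
  shows "bounded_clinear P" "P (P x) = P x" "cinner (P x) y = cinner x (P y)"
    "x \<in> range P \<longleftrightarrow> P x = x"
proof -
  show 1: "bounded_clinear P" and 2: "P (P x) = P x" for x
    using assms by (auto simp: projector_def fun_eq_iff)
  show "cinner (P x) y = cinner x (P y)"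
    using cinner_cadjoint_left[OF 1] assms by (metis projector_def)
  show "x \<in> range P \<longleftrightarrow> P x = x" using 2 by (metis imageE rangeI)
qed

lemma projectorI:
  assumes "bounded_clinear P" "\<And>x. P (P x) = P x" "\<And>x y. cinner (P x) y = cinner x (P y)"
  shows "projector P"
proof -
  have "cadjoint P = P" by (rule cadjoint_eqI) (simp_all add: assms)
  then show ?thesis using assms(1,2) by (simp add: projector_def fun_eq_iff)
qed

lemma projector_cinner_self: "projector P \<Longrightarrow> cinner x (P x) = of_real ((norm (P x))\<^sup>2)"
  by (metis cinner_self projectorD(2,3))

lemma projector_norm_le: "projector P \<Longrightarrow> norm (P x) \<le> norm x"
proof -
  assume P: "projector P"
  have "norm (P x) * norm (P x) = cmod (cinner x (P x))"
    by (simp add: projector_cinner_self[OF P] norm_power power2_eq_square norm_mult)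
  also have "\<dots> \<le> norm x * norm (P x)" by (rule norm_cinner_le)
  finally show ?thesis by (cases "P x = 0") simp_all
qed

lemma projector_range:
  assumes "projector P"
  shows "closed (range P)" "csubspace (range P)"
proof -
  note lin = bounded_clinearD[OF projectorD(1)[OF assms]]
  have eq: "range P = {x. P x = x}" using projectorD(4)[OF assms] by blast
  show "closed (range P)" unfolding eq
    by (intro closed_Collect_eq linear_continuous_on lin continuous_intros)
  show "csubspace (range P)" unfolding eq by (simp add: csubspace_def lin)
qed

text \<open>Each projector fixes the range of the other, and symmetry turns this into equality. It
  identifies the projector that \<open>trace_class_on\<close> quantifies existentially.\<close>

lemma projector_eqI:
  assumes "projector P" "projector P'" "range P = range P'"
  shows "P = P'"
proof
  fix x
  have 1: "P (P' y) = P' y" "P' (P y) = P y" for y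
    using projectorD(4)[OF assms(1)] projectorD(4)[OF assms(2)] assms(3) by blast+
  show "P x = P' x"
    by (rule cinner_eqI) (metis 1 projectorD(3)[OF assms(1)] projectorD(3)[OF assms(2)])
qed

section \<open>Orthogonal projections onto closed subspaces\<close>

definition proj :: "'a::chilbert_space set \<Rightarrow> 'a \<Rightarrow> 'a" where
  "proj M x = (SOME m. m \<in> M \<and> x - m \<in> orth M)"

lemma
  assumes "closed M" "csubspace M"
  shows proj_in: "proj M x \<in> M" and proj_orth: "x - proj M x \<in> orth M"
  using someI_ex[of "\<lambda>m. m \<in> M \<and> x - m \<in> orth M"] orthogonal_decomposition[OF assms, of x]
  unfolding proj_def by blast+

lemma proj_eqI:
  assumes "closed M" "csubspace M" "m \<in> M" "x - m \<in> orth M"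
  shows "proj M x = m"
proof -
  have "m - proj M x \<in> M" using proj_in[OF assms(1,2)] assms csubspace_simps by blast
  moreover have "(x - proj M x) - (x - m) \<in> orth M"
    using proj_orth[OF assms(1,2)] assms(4) csubspace_simps(4)[OF csubspace_orth] by blast
  then have "m - proj M x \<in> orth M" by simp
  ultimately have "cinner (m - proj M x) (m - proj M x) = 0" by (auto simp: orth_def)
  then show ?thesis by simp
qed

lemma
  assumes "closed M" "csubspace M"
  shows projector_proj: "projector (proj M)" and range_proj: "range (proj M) = M"
    and proj_fix: "x \<in> M \<Longrightarrow> proj M x = x" and proj_null: "x \<in> orth M \<Longrightarrow> proj M x = 0"
proof -
  note M = csubspace_simps[OF assms(2)] and O = csubspace_simps[OF csubspace_orth[of M]]
  note pin = proj_in[OF assms] and por = proj_orth[OF assms] and eqI = proj_eqI[OF assms]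
  show fixed: "proj M x = x" if "x \<in> M" for x using that by (intro eqI) (simp_all add: O)
  show "proj M x = 0" if "x \<in> orth M" using that by (intro eqI) (simp_all add: M)
  have perp: "cinner (proj M x) (y - proj M y) = 0" for x y
    using pin[of x] por[of y] by (auto simp: orth_def)
  have "cinner (proj M x) y = cinner (proj M x) (proj M y)" for x y
    using perp[of x y] by (simp add: cinner_simps)
  then have sym: "cinner (proj M x) y = cinner x (proj M y)" for x y by (metis cinner_commute)
  \<comment> \<open>Linearity of the chosen values comes for free from symmetry, since the
    projection can be moved to the other argument.\<close>
  have add: "proj M (x + y) = proj M x + proj M y" for x y
    by (rule cinner_eqI) (simp add: sym[symmetric] cinner_simps)
  have sc: "proj M (c *\<^sub>C x) = c *\<^sub>C proj M x" for c x
    by (rule cinner_eqI) (simp add: sym[symmetric] cinner_simps)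
  have "norm (proj M x) \<le> norm x * 1" for x
  proof -
    have "norm (proj M x) * norm (proj M x) = cmod (cinner (proj M x) x)"
      unfolding \<open>cinner (proj M x) x = cinner (proj M x) (proj M x)\<close>
      by (simp add: cinner_self power2_eq_square norm_mult)
    also have "\<dots> \<le> norm (proj M x) * norm x" by (rule norm_cinner_le)
    finally show ?thesis by (cases "proj M x = 0") simp_all
  qed
  with add sc have bl: "bounded_clinear (proj M)" by (rule bounded_clinearI)
  show "projector (proj M)" by (rule projectorI[OF bl]) (simp_all add: fixed pin sym)
  show "range (proj M) = M" using pin fixed by (metis image_subset_iff rangeI subsetI subset_antisym)
qed

lemma projector_finite_sum:
  assumes "finite F" "\<And>k. k \<in> F \<Longrightarrow> projector (Q k)"
    and "\<And>j k x. j \<in> F \<Longrightarrow> k \<in> F \<Longrightarrow> j \<noteq> k \<Longrightarrow> Q j (Q k x) = 0"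
  shows "projector (\<lambda>x. \<Sum>k\<in>F. Q k x)"
proof (rule projectorI)
  show "bounded_clinear (\<lambda>x. \<Sum>k\<in>F. Q k x)"
    by (rule bounded_clinear_finite_sum) (simp add: assms projectorD)
  show "cinner (\<Sum>k\<in>F. Q k x) y = cinner x (\<Sum>k\<in>F. Q k y)" for x y
    by (simp add: cinner.sum_left cinner.sum_right projectorD(3)[OF assms(2)])
  fix x
  have "(\<Sum>k\<in>F. Q k (\<Sum>j\<in>F. Q j x)) = (\<Sum>k\<in>F. \<Sum>j\<in>F. Q k (Q j x))"
    using bounded_clinear_sum[OF projectorD(1)[OF assms(2)]] by (intro sum.cong) auto
  also have "\<dots> = (\<Sum>k\<in>F. \<Sum>j\<in>F. if j = k then Q k x else 0)"
    by (intro sum.cong refl) (auto simp: assms projectorD)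
  finally show "(\<Sum>k\<in>F. Q k (\<Sum>j\<in>F. Q j x)) = (\<Sum>k\<in>F. Q k x)" using assms(1) by simp
qed

lemma has_sum_metric:
  fixes f :: "'i \<Rightarrow> 'a::{comm_monoid_add, metric_space}"
  shows "(f has_sum x) A \<longleftrightarrow> (\<forall>e>0. \<exists>X. finite X \<and> X \<subseteq> A \<and>
     (\<forall>Y. finite Y \<and> X \<subseteq> Y \<and> Y \<subseteq> A \<longrightarrow> dist (sum f Y) x < e))"
  by (simp add: has_sum_def tendsto_iff eventually_finite_subsets_at_top)

lemma has_sum_single:
  assumes "k \<in> I" "\<And>j. j \<in> I \<Longrightarrow> j \<noteq> k \<Longrightarrow> f j = 0"
  shows "(f has_sum f k) I"
proof -
  have "(f has_sum f k) {k}" by (simp add: has_sum_finiteI)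
  then show ?thesis by (subst has_sum_cong_neutral[of "{k}" I f f]) (use assms in auto)
qed

text \<open>The vectors on which the family sums to the identity form a closed subspace, because the finite
  partial sums are projectors and hence contractions.\<close>

lemma total_projectors_has_sum:
  fixes Q :: "'i \<Rightarrow> 'a::chilbert_space \<Rightarrow> 'a"
  assumes proj: "\<And>k. k \<in> I \<Longrightarrow> projector (Q k)"
    and orth: "\<And>j k x. j \<in> I \<Longrightarrow> k \<in> I \<Longrightarrow> j \<noteq> k \<Longrightarrow> Q j (Q k x) = 0"
    and total: "\<And>x. (\<And>k. k \<in> I \<Longrightarrow> Q k x = 0) \<Longrightarrow> x = 0"
  shows "((\<lambda>k. Q k x) has_sum x) I"
proof -
  define S where "S = {x. ((\<lambda>k. Q k x) has_sum x) I}"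
  note lin = bounded_clinearD[OF projectorD(1)[OF proj]]
  have cs: "csubspace S" unfolding csubspace_def
  proof (intro conjI ballI allI)
    show "0 \<in> S" unfolding S_def
      by (simp, subst has_sum_cong[of I _ "\<lambda>_. 0"]) (simp_all add: lin)
    show "x + y \<in> S" if "x \<in> S" "y \<in> S" for x y
      using has_sum_add[of "\<lambda>k. Q k x" I x "\<lambda>k. Q k y" y] that unfolding S_def mem_Collect_eq
      by (subst has_sum_cong) (simp_all add: lin)
    show "c *\<^sub>C x \<in> S" if "x \<in> S" for c x
      using has_sum_bounded_linear[OF scaleC.bounded_linear_right, of "\<lambda>k. Q k x" I x c] that
      unfolding S_def mem_Collect_eq comp_def
      by (subst has_sum_cong) (simp_all add: lin)
  qed
  have cl: "closed S"
    unfolding closed_sequential_limits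
  proof (intro allI impI, elim conjE)
    fix u x assume u: "\<forall>n. u n \<in> S" "u \<longlonglongrightarrow> x"
    show "x \<in> S" unfolding S_def mem_Collect_eq has_sum_metric
    proof (intro allI impI)
      fix e :: real assume "e > 0"
      then obtain n where n: "dist (u n) x < e / 3"
        using u(2) unfolding lim_sequentially by (meson divide_pos_pos order_refl zero_less_numeral)
      have "((\<lambda>k. Q k (u n)) has_sum u n) I" using u(1) by (simp add: S_def)
      then obtain X where X: "finite X" "X \<subseteq> I"
        "\<And>Y. finite Y \<Longrightarrow> X \<subseteq> Y \<Longrightarrow> Y \<subseteq> I \<Longrightarrow> dist (\<Sum>k\<in>Y. Q k (u n)) (u n) < e / 3"
        unfolding has_sum_metric using \<open>e > 0\<close> by (auto dest!: spec[of _ "e / 3"])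
      have "dist (\<Sum>k\<in>Y. Q k x) x < e" if Y: "finite Y" "X \<subseteq> Y" "Y \<subseteq> I" for Y
      proof -
        have "projector (\<lambda>x. \<Sum>k\<in>Y. Q k x)"
        proof (rule projector_finite_sum[OF Y(1)])
          show "projector (Q k)" if "k \<in> Y" for k using proj that Y(3) by blast
          show "Q j (Q k x) = 0" if "j \<in> Y" "k \<in> Y" "j \<noteq> k" for j k x
            using orth[of j k x] that Y(3) by blast
        qed
        from projector_norm_le[OF this, of "x - u n"]
        have "norm (\<Sum>k\<in>Y. Q k (x - u n)) \<le> norm (x - u n)" .
        moreover have "(\<Sum>k\<in>Y. Q k (x - u n)) = (\<Sum>k\<in>Y. Q k x) - (\<Sum>k\<in>Y. Q k (u n))"
          using Y(3) by (simp add: sum_subtractf[symmetric] subset_iff lin cong: sum.cong)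
        ultimately have "dist (\<Sum>k\<in>Y. Q k x) (\<Sum>k\<in>Y. Q k (u n)) \<le> dist (u n) x"
          by (simp add: dist_norm norm_minus_commute)
        then show ?thesis
          using X(3)[OF Y] n
            dist_triangle[of "\<Sum>k\<in>Y. Q k x" x "u n"]
            dist_triangle[of "\<Sum>k\<in>Y. Q k x" "u n" "\<Sum>k\<in>Y. Q k (u n)"]
          by linarith
      qed
      then show "\<exists>X. finite X \<and> X \<subseteq> I \<and>
          (\<forall>Y. finite Y \<and> X \<subseteq> Y \<and> Y \<subseteq> I \<longrightarrow> dist (\<Sum>k\<in>Y. Q k x) x < e)"
        using X(1,2) by (intro exI[of _ X]) simp
    qed
  qed
  have rg: "Q k y \<in> S" if "k \<in> I" for k y
    using has_sum_single[OF that, of "\<lambda>j. Q j (Q k y)"] orth[OF _ that] projectorD(2)[OF proj[OF that]]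
    by (simp add: S_def)
  \<comment> \<open>All ranges lie in \<open>S\<close>, so a vector orthogonal to \<open>S\<close>
    is annihilated by every \<open>Q k\<close>, and totality applies.\<close>
  have "orth S \<subseteq> {0}"
  proof
    fix z assume "z \<in> orth S"
    then have "cinner (Q k z) (Q k z) = 0" if "k \<in> I" for k
      using rg[OF that, of z] projectorD(2,3)[OF proj[OF that]] unfolding orth_def
      by (metis (mono_tags, lifting) mem_Collect_eq)
    then have "z = 0" by (metis total cinner_self_eq_0)
    then show "z \<in> {0}" by simp
  qed
  then have "S = UNIV" by (rule orth_eq_0_imp_UNIV[OF cl cs])
  then show ?thesis by (auto simp: S_def)
qed

text \<open>The rank one operator |x><y|. It is antilinear in \<open>y\<close>, which is the origin
  of the conjugates in \<open>img_sesquilinear\<close>.\<close>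

definition outer :: "'a::chilbert_space \<Rightarrow> 'b::chilbert_space \<Rightarrow> 'b \<Rightarrow> 'a" where
  "outer x y v = cinner y v *\<^sub>C x"

lemma bounded_clinear_outer [simp]: "bounded_clinear (outer x y)"
proof (rule bounded_clinearI)
  show "norm (outer x y v) \<le> norm v * (norm x * norm y)" for v
    using mult_right_mono[OF norm_cinner_le[of y v], of "norm x"]
    by (simp add: outer_def norm_scaleC mult_ac)
qed (simp_all add: outer_def cinner_simps scaleC_add_left scaleC_scaleC)

lemma onbD:
  assumes "is_onb E"
  shows "x \<in> E \<Longrightarrow> cinner x x = 1" "x \<in> E \<Longrightarrow> y \<in> E \<Longrightarrow> x \<noteq> y \<Longrightarrow> cinner x y = 0"
    "(\<And>e. e \<in> E \<Longrightarrow> cinner e x = 0) \<Longrightarrow> x = 0"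
  using assms unfolding is_onb_def by auto

lemma projector_outer: "cinner e e = 1 \<Longrightarrow> projector (outer e e)"
  by (rule projectorI) (auto simp: outer_def cinner_simps cinner_commute[symmetric])

text \<open>The rank one operators \<open>outer e e\<close> are mutually orthogonal projectors and
  maximality of the basis is their totality, so the Fourier expansion is an instance of
  \<open>total_projectors_has_sum\<close>.\<close>

lemma onb_has_sum:
  assumes "is_onb E"
  shows "((\<lambda>e. cinner e x *\<^sub>C e) has_sum x) E"
proof -
  have "((\<lambda>e. outer e e x) has_sum x) E"
  proof (rule total_projectors_has_sum)
    show "projector (outer k k)" if "k \<in> E" for k using onbD(1)[OF assms that] by (rule projector_outer)
    show "outer j j (outer k k x) = 0" if "j \<in> E" "k \<in> E" "j \<noteq> k" for j k x
      using onbD(2)[OF assms that] by (simp add: outer_def cinner_simps)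
    show "x = 0" if "\<And>k. k \<in> E \<Longrightarrow> outer k k x = 0" for x
    proof (rule onbD(3)[OF assms])
      fix e assume e: "e \<in> E"
      have "cinner e (outer e e x) = cinner e x"
        using onbD(1)[OF assms e] by (simp add: outer_def cinner_simps)
      then show "cinner e x = 0" using that[OF e] by simp
    qed
  qed
  then show ?thesis by (simp add: outer_def)
qed

lemma onb_cinner_has_sum:
  assumes "is_onb E"
  shows "((\<lambda>e. cinner x e * cinner e y) has_sum cinner x y) E"
  using has_sum_bounded_linear[OF cinner.bounded_linear_right onb_has_sum[OF assms, of y], of x]
  by (simp add: comp_def cinner_simps mult.commute)

lemma onb_norm_has_sum:
  assumes "is_onb E"
  shows "((\<lambda>e. (cmod (cinner e x))\<^sup>2) has_sum (norm x)\<^sup>2) E"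
proof -
  have "cinner x e * cinner e x = of_real ((cmod (cinner e x))\<^sup>2)" for e
    by (metis cinner_commute complex_norm_square mult.commute of_real_power)
  then have "((\<lambda>e. complex_of_real ((cmod (cinner e x))\<^sup>2)) has_sum complex_of_real ((norm x)\<^sup>2)) E"
    using onb_cinner_has_sum[OF assms, of x x] by (simp only: cinner_self)
  from has_sum_Re[OF this] show ?thesis by simp
qed

text \<open>Zorn's lemma on orthonormal sets; a vector orthogonal to a maximal one could be
  normalised and added. This gives meaning to the choice of basis in
  \<open>trace_op\<close>.\<close>

lemma onb_exists: "\<exists>E :: 'a::chilbert_space set. is_onb E"
proof -
  define \<O> :: "'a set set"
    where "\<O> = {E. \<forall>x\<in>E. \<forall>y\<in>E. cinner x y = (if x = y then 1 else 0)}"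
  have "\<exists>M\<in>\<O>. \<forall>X\<in>\<O>. M \<subseteq> X \<longrightarrow> X = M"
  proof (rule subset_Zorn_nonempty)
    show "\<O> \<noteq> {}" unfolding \<O>_def by blast
    fix C assume C: "C \<noteq> {}" "subset.chain \<O> C"
    show "\<Union>C \<in> \<O>" unfolding \<O>_def
    proof (clarify)
      fix x y X Y assume "x \<in> X" "X \<in> C" "y \<in> Y" "Y \<in> C"
      then obtain Z where "Z \<in> C" "x \<in> Z" "y \<in> Z"
        using C(2) unfolding subset.chain_def by blast
      moreover have "Z \<in> \<O>" using C(2) \<open>Z \<in> C\<close> unfolding subset.chain_def by blast
      ultimately show "cinner x y = (if x = y then 1 else 0)" unfolding \<O>_def by blast
    qed
  qed
  then obtain E where E: "E \<in> \<O>" and max: "\<And>X. X \<in> \<O> \<Longrightarrow> E \<subseteq> X \<Longrightarrow> X = E" by blast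
  have "x = 0" if x: "\<And>e. e \<in> E \<Longrightarrow> cinner e x = 0" for x
  proof (rule ccontr)
    assume "x \<noteq> 0"
    define v where "v = inverse (norm x) *\<^sub>R x"
    then have "norm v = 1" using \<open>x \<noteq> 0\<close> by simp
    then have v1: "cinner v v = 1"
      by (simp add: cinner_self)
    have v0: "cinner e v = 0" "cinner v e = 0" if "e \<in> E" for e
      using x[OF that] cinner_zero_commute[OF x[OF that]] by (simp_all add: v_def cinner.scaleR_left cinner.scaleR_right)
    have "insert v E \<in> \<O>" using E v0 v1 unfolding \<O>_def by auto
    then have "v \<in> E" using max by blast
    then show False using v0 v1 by auto
  qed
  then show ?thesis using E by (intro exI[of _ E]) (auto simp: is_onb_def \<O>_def)
qed

section \<open>Square roots and the absolute value\<close>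

text \<open>The steps of \<open>y\<close> telescope against those of \<open>a\<close>, so
  \<open>y\<close> inherits the Cauchy property from a bounded monotone real sequence.\<close>

lemma increasing_bounded_Cauchy_majorant:
  fixes y :: "nat \<Rightarrow> 'a::banach" and a :: "nat \<Rightarrow> real"
  assumes step: "\<And>n. norm (y (Suc n) - y n) \<le> a (Suc n) - a n" and bd: "\<And>n. a n \<le> C"
  shows "convergent y"
proof -
  have mono: "norm (y (n + k) - y n) \<le> a (n + k) - a n" for n k
  proof (induction k)
    case (Suc k)
    have "y (n + Suc k) - y n = (y (Suc (n + k)) - y (n + k)) + (y (n + k) - y n)" by simp
    then have "norm (y (n + Suc k) - y n) \<le> norm (y (Suc (n + k)) - y (n + k)) + norm (y (n + k) - y n)"
      by (metis norm_triangle_ineq)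
    then show ?case using step[of "n + k"] Suc.IH by simp
  qed simp
  have inc: "incseq a"
    by (rule incseq_SucI) (use step norm_ge_zero in \<open>smt (verit, best)\<close>)
  then obtain l where l: "a \<longlonglongrightarrow> l" using incseq_convergent[of a C] bd by blast
  have "Cauchy y"
  proof (rule metric_CauchyI)
    fix e :: real assume "e > 0"
    then obtain N where N: "\<And>m n. m \<ge> N \<Longrightarrow> n \<ge> N \<Longrightarrow> dist (a m) (a n) < e"
      using metric_CauchyD[OF LIMSEQ_imp_Cauchy[OF l]] by metis
    have "dist (y m) (y n) < e" if "N \<le> n" "n \<le> m" for m n
      using mono[of n "m - n"] N[of m n] that by (simp add: dist_norm dist_real_def)
    then have "dist (y m) (y n) < e" if "N \<le> n" "N \<le> m" for m n
      using that by (metis dist_commute nle_le)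
    then show "\<exists>N. \<forall>m\<ge>N. \<forall>n\<ge>N. dist (y m) (y n) < e" by blast
  qed
  then show ?thesis by (rule Cauchy_convergent)
qed

text \<open>The iteration lives on the type \<open>\<Rightarrow>\<^sub>L\<close>, unlike the
  operators elsewhere, because it is a Banach space in which convergence in operator norm can be
  stated directly.\<close>

primrec sqrt_iter :: "('a::real_normed_vector \<Rightarrow>\<^sub>L 'a) \<Rightarrow> nat \<Rightarrow> 'a \<Rightarrow>\<^sub>L 'a" where
  "sqrt_iter b 0 = 0"
| "sqrt_iter b (Suc n) = (1/2) *\<^sub>R (b + (sqrt_iter b n o\<^sub>L sqrt_iter b n))"

primrec sqrt_majorant :: "nat \<Rightarrow> real" where
  "sqrt_majorant 0 = 0"
| "sqrt_majorant (Suc n) = (1 + (sqrt_majorant n)\<^sup>2) / 2"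

lemma sqrt_majorant_bounds: "0 \<le> sqrt_majorant n \<and> sqrt_majorant n \<le> 1"
proof (induction n)
  case (Suc n)
  then have "(sqrt_majorant n)\<^sup>2 \<le> 1" by (simp add: power_le_one)
  then show ?case by simp
qed simp

lemma norm_sqrt_iter_le:
  assumes "norm b \<le> 1"
  shows "norm (sqrt_iter b n) \<le> sqrt_majorant n"
proof (induction n)
  case (Suc n)
  have "norm (sqrt_iter b n o\<^sub>L sqrt_iter b n) \<le> norm (sqrt_iter b n) * norm (sqrt_iter b n)"
    by (rule norm_blinfun_compose)
  also have "\<dots> \<le> (sqrt_majorant n)\<^sup>2"
    unfolding power2_eq_square by (intro mult_mono Suc) (auto simp: sqrt_majorant_bounds)
  finally have "norm (b + (sqrt_iter b n o\<^sub>L sqrt_iter b n)) \<le> 1 + (sqrt_majorant n)\<^sup>2"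
    using assms norm_triangle_ineq[of b "sqrt_iter b n o\<^sub>L sqrt_iter b n"] by linarith
  then show ?case by simp
qed simp

text \<open>The difference of squares z z - y y is split as z (z - y) + (z - y) y. Its bound q (q -
  p) + (q - p) p equals the difference of squares of the scalar majorants, which drives the
  induction.\<close>

lemma norm_sqrt_iter_step:
  assumes "norm b \<le> 1"
  shows "norm (sqrt_iter b (Suc n) - sqrt_iter b n) \<le> sqrt_majorant (Suc n) - sqrt_majorant n"
proof (induction n)
  case 0
  then show ?case using assms by simp
next
  case (Suc n)
  let ?y = "sqrt_iter b n" and ?z = "sqrt_iter b (Suc n)"
  let ?p = "sqrt_majorant n" and ?q = "sqrt_majorant (Suc n)"
  have "(?z o\<^sub>L ?z) - (?y o\<^sub>L ?y) = (?z o\<^sub>L (?z - ?y)) + ((?z - ?y) o\<^sub>L ?y)"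
    by (rule blinfun_eqI) (simp add: blinfun.bilinear_simps del: sqrt_iter.simps)
  then have eq: "sqrt_iter b (Suc (Suc n)) - ?z = (1/2) *\<^sub>R ((?z o\<^sub>L (?z - ?y)) + ((?z - ?y) o\<^sub>L ?y))"
    by (simp only: sqrt_iter.simps(2)[of b "Suc n"] scaleR_diff_right[symmetric] add_diff_cancel_left
        sqrt_iter.simps(2)[of b n, THEN arg_cong[of _ _ "\<lambda>v. u - v" for u]])
  have "norm ((?z o\<^sub>L (?z - ?y)) + ((?z - ?y) o\<^sub>L ?y))
      \<le> norm ?z * norm (?z - ?y) + norm (?z - ?y) * norm ?y"
    by (intro order_trans[OF norm_triangle_ineq] add_mono norm_blinfun_compose)
  also have "\<dots> \<le> ?q * (?q - ?p) + (?q - ?p) * ?p"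
    by (intro add_mono mult_mono norm_sqrt_iter_le[OF assms] Suc.IH norm_ge_zero
        order_trans[OF norm_ge_zero Suc.IH] sqrt_majorant_bounds[THEN conjunct1])
  also have "\<dots> = ?q\<^sup>2 - ?p\<^sup>2" by (simp add: algebra_simps power2_eq_square)
  finally have "norm (sqrt_iter b (Suc (Suc n)) - ?z) \<le> (?q\<^sup>2 - ?p\<^sup>2) / 2" unfolding eq by simp
  also have "\<dots> = sqrt_majorant (Suc (Suc n)) - sqrt_majorant (Suc n)"
    by (simp add: diff_divide_distrib add_divide_distrib)
  finally show ?case .
qed

text \<open>The fixed point \<open>Y\<close> of \<open>Y = (B + Y\<^sup>2) / 2\<close> satisfies \<open>(1 - Y)\<^sup>2 = 1 - B\<close>. The scalar iteration
  with \<open>B = 1\<close> majorises the operator iteration.\<close>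

lemma sqrt_contraction:
  fixes B :: "'a::chilbert_space \<Rightarrow> 'a"
  assumes B: "positive_op B" and le: "\<And>x. norm (B x) \<le> norm x"
  shows "\<exists>Y. bounded_clinear Y \<and> (\<forall>x. norm (Y x) \<le> norm x) \<and> (\<forall>x y. cinner (Y x) y = cinner x (Y y)) \<and>
    (\<forall>x. 2 *\<^sub>R Y x = B x + Y (Y x)) \<and> (\<forall>S. bounded_clinear S \<longrightarrow> S \<circ> B = B \<circ> S \<longrightarrow> S \<circ> Y = Y \<circ> S)"
proof -
  define b where "b = Blinfun B"
  have Bl: "bounded_clinear B" by (rule positive_opD[OF B])
  have b: "blinfun_apply b = B"
    unfolding b_def by (rule bounded_linear_Blinfun_apply) (rule bounded_clinearD[OF Bl])
  have b1: "norm b \<le> 1" by (rule norm_blinfun_bound) (simp_all add: b le)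
  let ?y = "sqrt_iter b"
  have "convergent ?y"
    by (rule increasing_bounded_Cauchy_majorant[of _ sqrt_majorant 1])
      (use norm_sqrt_iter_step[OF b1] sqrt_majorant_bounds in auto)
  then obtain Y where Y: "?y \<longlonglongrightarrow> Y" by (auto simp: convergent_def)
  have Yx: "(\<lambda>n. ?y n x) \<longlonglongrightarrow> Y x" for x
    by (intro blinfun.tendsto Y tendsto_const)
  have "(\<lambda>n. ?y (Suc n)) \<longlonglongrightarrow> (1/2) *\<^sub>R (b + (Y o\<^sub>L Y))"
    unfolding sqrt_iter.simps
    by (intro tendsto_intros Y bounded_bilinear.tendsto[OF bounded_bilinear_blinfun_compose])
  then have fp: "Y = (1/2) *\<^sub>R (b + (Y o\<^sub>L Y))"
    using LIMSEQ_Suc[OF Y] LIMSEQ_unique by blast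
  have "Y x = (1/2) *\<^sub>R (B x + Y (Y x))" for x
    using arg_cong[OF fp, of "\<lambda>Z. blinfun_apply Z x"] by (simp add: blinfun.bilinear_simps b)
  then have fpx: "2 *\<^sub>R Y x = B x + Y (Y x)" for x
    by (metis scaleR_half_double scaleR_right_distrib scaleR_left_commute scaleR_2)
  have "norm (?y n) \<le> 1" for n
    using norm_sqrt_iter_le[OF b1, of n] sqrt_majorant_bounds[of n] by linarith
  then have "norm Y \<le> 1" by (intro LIMSEQ_le_const2[OF tendsto_norm[OF Y]]) auto
  then have Y1: "norm (Y x) \<le> norm x" for x
    using norm_blinfun[of Y x] mult_right_mono[of "norm Y" 1 "norm x"] by simp
  have sc: "?y n (c *\<^sub>C x) = c *\<^sub>C ?y n x" for n c x
    by (induction n arbitrary: x)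
      (simp_all add: blinfun.bilinear_simps b bounded_clinearD[OF Bl] scaleC.scaleR_right scaleC_add_right)
  have "Y (c *\<^sub>C x) = c *\<^sub>C Y x" for c x
    using LIMSEQ_unique[OF Yx[of "c *\<^sub>C x"]] scaleC.tendsto[OF tendsto_const Yx[of x], of c]
    unfolding sc by blast
  then have cl: "bounded_clinear (blinfun_apply Y)"
    by (simp add: bounded_clinear_def blinfun.bounded_linear_right)
  have sa: "cinner (?y n u) v = cinner u (?y n v)" for n u v
    by (induction n arbitrary: u v)
      (simp_all add: blinfun.bilinear_simps b cinner.scaleR_left cinner.scaleR_right cinner_simps
        positive_op_selfadj[OF B])
  have Ysa: "cinner (Y u) v = cinner u (Y v)" for u v
    using LIMSEQ_unique[OF cinner.tendsto[OF Yx[of u] tendsto_const, of v]]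
      cinner.tendsto[OF tendsto_const Yx[of v], of u] unfolding sa by blast
  \<comment> \<open>The iterates are polynomials in \<open>B\<close>, so whatever commutes with
    \<open>B\<close> commutes with them and, by continuity, with the limit.\<close>
  have "S (Y x) = Y (S x)" if S: "bounded_clinear S" "S \<circ> B = B \<circ> S" for S x
  proof -
    have SB: "S (B x) = B (S x)" for x using S(2) by (metis comp_apply)
    have comm: "S (?y n x) = ?y n (S x)" for n x
      by (induction n arbitrary: x)
        (simp_all add: blinfun.bilinear_simps b SB bounded_clinearD[OF S(1)]
          linear_scale[OF bounded_clinearD(2)[OF S(1)]])
    show ?thesis
      using LIMSEQ_unique[OF bounded_linear.tendsto[OF bounded_clinearD(1)[OF S(1)] Yx[of x]]]
        Yx[of "S x"] unfolding comm by blast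
  qed
  then have "\<forall>S. bounded_clinear S \<longrightarrow> S \<circ> B = B \<circ> S \<longrightarrow> S \<circ> Y = Y \<circ> S" by (auto simp: fun_eq_iff)
  with cl Y1 Ysa fpx show ?thesis by (intro exI[of _ "blinfun_apply Y"]) simp
qed

text \<open>Rescale to the contraction B = 1 - A/K; its fixed point \<open>Y\<close> satisfies (1 -
  Y)(1 - Y) = A/K, whence R is 1 - Y times the root of K. The commutation clause is recorded because
  uniqueness rests on it.\<close>

lemma positive_sqrt_exists:
  fixes A :: "'a::chilbert_space \<Rightarrow> 'a"
  assumes A: "positive_op A"
  shows "\<exists>R. positive_op R \<and> R \<circ> R = A \<and>
    (\<forall>S. bounded_clinear S \<longrightarrow> S \<circ> A = A \<circ> S \<longrightarrow> S \<circ> R = R \<circ> S)"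
proof -
  have Al: "bounded_clinear A" by (rule positive_opD[OF A])
  obtain K0 where K0: "K0 \<ge> 0" "\<And>x. norm (A x) \<le> K0 * norm x" using bounded_clinear_bound[OF Al] by blast
  \<comment> \<open>The bound \<open>K0\<close> may be 0, and \<open>K\<close> is used as a
    divisor.\<close>
  define K where "K = K0 + 1"
  have K: "K > 0" "\<And>x. norm (A x) \<le> K * norm x"
    using K0(1) order_trans[OF K0(2) mult_right_mono[of K0 "K0 + 1"]] unfolding K_def by auto
  define B where "B x = x - (1/K) *\<^sub>R A x" for x
  have Bl: "bounded_clinear B" unfolding B_def scaleC_of_real[symmetric]
    by (intro bounded_clinear_diff bounded_clinear_scaleC Al bounded_clinear_id)
  have BI: "cinner x (B x) = of_real ((norm x)\<^sup>2 - Re (cinner x (A x)) / K)" for x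
  proof -
    have "cinner x (B x) = of_real ((norm x)\<^sup>2) - of_real (1/K) * cinner x (A x)"
      by (simp add: B_def cinner.diff_right cinner.scaleR_right cinner_self scaleR_conv_of_real)
    also have "\<dots> = of_real ((norm x)\<^sup>2) - of_real (1/K) * of_real (Re (cinner x (A x)))"
      by (simp only: positive_opD(3)[OF A, of x, symmetric])
    finally show ?thesis by simp
  qed
  have "Re (cinner x (A x)) \<le> K * (norm x)\<^sup>2" for x
  proof -
    have "Re (cinner x (A x)) \<le> norm x * norm (A x)"
      using complex_Re_le_cmod norm_cinner_le order_trans by blast
    also have "\<dots> \<le> norm x * (K * norm x)" by (intro mult_left_mono K) simp
    finally show ?thesis by (simp add: power2_eq_square mult_ac)
  qed
  then have "Re (cinner x (A x)) / K \<le> (norm x)\<^sup>2" for x using K(1) by (simp add: field_simps)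
  then have B: "positive_op B" unfolding positive_op_def using Bl by (simp add: BI complex_nonneg_Reals_iff)
  have "norm (B x) \<le> norm x" for x
  proof -
    have "norm (B x) \<le> 1 * norm x"
    proof (rule positive_op_norm_le[OF B])
      fix x show "Re (cinner x (B x)) \<le> 1 * (norm x)\<^sup>2"
        using positive_opD(2)[OF A, of x] K(1) by (simp add: BI)
    qed
    then show ?thesis by simp
  qed
  from sqrt_contraction[OF B this] obtain Y where Y: "bounded_clinear Y" "\<And>x. norm (Y x) \<le> norm x"
    "\<And>x y. cinner (Y x) y = cinner x (Y y)" "\<And>x. 2 *\<^sub>R Y x = B x + Y (Y x)"
    and comm: "\<And>S. bounded_clinear S \<Longrightarrow> S \<circ> B = B \<circ> S \<Longrightarrow> S \<circ> Y = Y \<circ> S"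
    by blast
  define R where "R x = sqrt K *\<^sub>R (x - Y x)" for x
  have Rl: "bounded_clinear R" unfolding R_def scaleC_of_real[symmetric]
    by (intro bounded_clinear_diff bounded_clinear_scaleC Y bounded_clinear_id)
  have "positive_op R" unfolding positive_op_def
  proof (intro conjI allI Rl)
    fix x
    have "cinner x (Y x) = cnj (cinner x (Y x))" by (metis Y(3) cinner_commute)
    then have im: "Im (cinner x (Y x)) = 0" by (simp add: complex_eq_iff)
    have "Re (cinner x (Y x)) \<le> norm x * norm (Y x)"
      using complex_Re_le_cmod norm_cinner_le order_trans by blast
    also have "\<dots> \<le> norm x * norm x" by (intro mult_left_mono Y) simp
    finally have "Re (cinner x (Y x)) \<le> (norm x)\<^sup>2" by (simp add: power2_eq_square)
    then show "cinner x (R x) \<in> \<real>\<^sub>\<ge>\<^sub>0"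
      using im K(1) by (simp add: R_def cinner.scaleR_right cinner_simps cinner_self complex_nonneg_Reals_iff)
  qed
  moreover have "R \<circ> R = A"
  proof
    fix x
    have "(R \<circ> R) x = (sqrt K * sqrt K) *\<^sub>R (x - 2 *\<^sub>R Y x + Y (Y x))"
      unfolding R_def comp_def
      by (simp add: bounded_clinearD[OF Y(1)] linear_scale[OF bounded_clinearD(2)[OF Y(1)]]
          algebra_simps scaleR_2)
    also have "\<dots> = K *\<^sub>R (x - B x)" using K(1) unfolding Y(4) by simp
    also have "\<dots> = A x" using K(1) by (simp add: B_def)
    finally show "(R \<circ> R) x = A x" .
  qed
  moreover have "S \<circ> R = R \<circ> S" if S: "bounded_clinear S" "S \<circ> A = A \<circ> S" for S
  proof -
    note lin = bounded_clinearD[OF S(1)] linear_scale[OF bounded_clinearD(2)[OF S(1)]]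
    have "S (A x) = A (S x)" for x using S(2) by (metis comp_apply)
    then have "S \<circ> B = B \<circ> S" by (auto simp: fun_eq_iff B_def lin)
    then have "S \<circ> Y = Y \<circ> S" by (rule comm[OF S(1)])
    then have "S (Y x) = Y (S x)" for x by (metis comp_apply)
    then show ?thesis by (auto simp: fun_eq_iff R_def lin)
  qed
  ultimately show ?thesis by blast
qed

text \<open>Any root \<open>S\<close> commutes with \<open>A\<close>, hence with the constructed
  root \<open>R\<close>. For u = S x - R x this gives (R + S) u = 0; both forms at \<open>u\<close>
  are nonnegative and so vanish, thus R u = S u = 0, and symmetry gives u = 0.\<close>

lemma positive_sqrt_unique:
  assumes A: "positive_op A" and S: "positive_op S" "S \<circ> S = A" and T: "positive_op T" "T \<circ> T = A"
  shows "S = T"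
proof -
  obtain R where R: "positive_op R" "R \<circ> R = A"
    and comm: "\<And>S. bounded_clinear S \<Longrightarrow> S \<circ> A = A \<circ> S \<Longrightarrow> S \<circ> R = R \<circ> S"
    using positive_sqrt_exists[OF A] by blast
  have "S = R" if S: "positive_op S" "S \<circ> S = A" for S
  proof
    fix x
    note lR = bounded_clinearD[OF positive_opD(1)[OF R(1)]]
    note lS = bounded_clinearD[OF positive_opD(1)[OF S(1)]]
    have "S \<circ> A = A \<circ> S" using S(2) by (metis comp_assoc)
    then have "S (R y) = R (S y)" for y using comm[OF positive_opD(1)[OF S(1)]] by (metis comp_apply)
    moreover have "S (S y) = R (R y)" for y using S(2) R(2) by (metis comp_apply)
    define u where "u = S x - R x"
    have "R u + S u = 0"
      unfolding u_def by (simp add: lR lS \<open>S (R x) = R (S x)\<close> \<open>S (S x) = R (R x)\<close>)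
    then have "cinner u (R u) + cinner u (S u) = 0" by (metis cinner_add_right cinner.zero_right)
    then have "Re (cinner u (R u)) + Re (cinner u (S u)) = 0" by (metis plus_complex.sel(1) zero_complex.sel(1))
    then have "Re (cinner u (R u)) = 0" "Re (cinner u (S u)) = 0"
      using positive_opD(2)[OF R(1), of u] positive_opD(2)[OF S(1), of u] by linarith+
    then have "cinner u (R u) = 0" "cinner u (S u) = 0"
      using positive_opD(3)[OF R(1), of u] positive_opD(3)[OF S(1), of u] by simp_all
    then have "R u = 0" "S u = 0" using positive_op_eq_0 R(1) S(1) by blast+
    then have "cinner (S x) u - cinner (R x) u = 0"
      by (simp add: positive_op_selfadj[OF S(1)] positive_op_selfadj[OF R(1)])
    then have "cinner u u = 0" unfolding cinner.diff_left[symmetric] u_def[symmetric] .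
    then show "S x = R x" by (simp add: u_def)
  qed
  from this[OF S] this[OF T] show ?thesis by simp
qed

lemma positive_cadjoint_comp:
  assumes "bounded_clinear T"
  shows "positive_op (cadjoint T \<circ> T)"
  unfolding positive_op_def
proof (intro conjI allI)
  show "bounded_clinear (cadjoint T \<circ> T)" by (simp add: assms bounded_clinear_cadjoint)
  show "cinner x ((cadjoint T \<circ> T) x) \<in> \<real>\<^sub>\<ge>\<^sub>0" for x
    by (simp add: cinner_cadjoint_right[OF assms] cinner_self complex_nonneg_Reals_iff)
qed

lemma abs_op_ex1:
  assumes "bounded_clinear T"
  shows "\<exists>!S. positive_op S \<and> S \<circ> S = cadjoint T \<circ> T"
proof -
  obtain R where R: "positive_op R" "R \<circ> R = cadjoint T \<circ> T"
    using positive_sqrt_exists[OF positive_cadjoint_comp[OF assms]] by metis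
  show ?thesis
  proof (rule ex1I[of _ R])
    show "S = R" if "positive_op S \<and> S \<circ> S = cadjoint T \<circ> T" for S
      by (rule positive_sqrt_unique[OF positive_cadjoint_comp[OF assms]]) (simp_all add: that R)
  qed (simp add: R)
qed

lemma
  assumes "bounded_clinear T"
  shows positive_abs_op: "positive_op (abs_op T)"
    and abs_op_square: "abs_op T \<circ> abs_op T = cadjoint T \<circ> T"
  using theI'[OF abs_op_ex1[OF assms]] unfolding abs_op_def by auto

lemma cadjoint_positive:
  assumes "positive_op S"
  shows "cadjoint S = S"
  using positive_op_selfadj[OF assms] positive_opD(1)[OF assms] by (intro cadjoint_eqI) auto

text \<open>With equal norms, \<open>T\<close> and \<open>abs_op T\<close> factor through each other
  by \<open>douglas_factorization\<close>, in either direction as needed.\<close>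

lemma norm_abs_op:
  assumes "bounded_clinear T"
  shows "norm (abs_op T x) = norm (T x)"
proof -
  have "cinner (abs_op T x) (abs_op T x) = cinner x ((abs_op T \<circ> abs_op T) x)"
    by (simp add: positive_op_selfadj[OF positive_abs_op[OF assms]])
  also have "\<dots> = cinner (T x) (T x)"
    unfolding abs_op_square[OF assms] by (simp add: cinner_cadjoint_right[OF assms])
  finally have "(norm (abs_op T x))\<^sup>2 = (norm (T x))\<^sup>2" by (simp add: norm_eq_cinner)
  then show ?thesis by (simp add: power2_eq_iff_nonneg)
qed

text \<open>Douglas' factorisation, which replaces the polar decomposition below.\<close>

lemma douglas_factorization:
  fixes A :: "'a::chilbert_space \<Rightarrow> 'b::chilbert_space" and B :: "'a \<Rightarrow> 'c::chilbert_space"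
  assumes A: "bounded_clinear A" and B: "bounded_clinear B"
    and le: "\<And>x. norm (A x) \<le> C * norm (B x)" and C: "C \<ge> 0"
  shows "\<exists>W. bounded_clinear W \<and> A = W \<circ> B"
proof -
  note lA = bounded_clinearD[OF A] and lB = bounded_clinearD[OF B]
  define g where "g y = A (SOME x. B x = y)" for y
  have gB: "g (B x) = A x" for x
  proof -
    have "B (SOME x'. B x' = B x) = B x" by (rule someI[of _ x]) simp
    then have "norm (A ((SOME x'. B x' = B x) - x)) \<le> C * 0" by (metis le lB(5) norm_zero right_minus_eq)
    then show ?thesis by (simp add: g_def lA(5))
  qed
  define D where "D = range B"
  have D: "csubspace D" unfolding D_def csubspace_def
    by (auto simp: lB(3,4,6)[symmetric] intro: image_eqI[of _ B 0])
  have g_add: "g (x + y) = g x + g y" if "x \<in> D" "y \<in> D" for x y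
    using that unfolding D_def by (auto simp: gB lB(4)[symmetric] lA(4))
  have g_sc: "g (c *\<^sub>C x) = c *\<^sub>C g x" if "x \<in> D" for x c
    using that unfolding D_def by (auto simp: gB lB(3)[symmetric] lA(3))
  have g_bd: "norm (g x) \<le> C * norm x" if "x \<in> D" for x
    using that le unfolding D_def by (auto simp: gB)
  have "uniformly_continuous_on D g"
  proof -
    have "dist (g x) (g y) \<le> C * dist x y" if "x \<in> D" "y \<in> D" for x y
      using that le unfolding D_def by (auto simp: gB dist_norm lA(5)[symmetric] lB(5)[symmetric])
    then have "C-lipschitz_on D g" using C by (intro lipschitz_onI)
    then show ?thesis by (rule lipschitz_on_uniformly_continuous)
  qed
  then obtain h where h: "uniformly_continuous_on (closure D) h" "\<And>x. x \<in> D \<Longrightarrow> g x = h x"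
    using uniformly_continuous_on_extension_on_closure by metis
  have lim: "(\<lambda>n. g (u n)) \<longlonglongrightarrow> h x" if "\<And>n. u n \<in> D" "u \<longlonglongrightarrow> x" for u x
  proof -
    have "x \<in> closure D" using that closure_sequential by blast
    then have "(\<lambda>n. h (u n)) \<longlonglongrightarrow> h x"
      by (rule continuous_on_tendsto_compose[OF uniformly_continuous_imp_continuous[OF h(1)] that(2)])
        (use that(1) closure_subset in \<open>auto intro!: always_eventually\<close>)
    then show ?thesis using h(2) that(1) by simp
  qed
  have h_add: "h (x + y) = h x + h y" if xy: "x \<in> closure D" "y \<in> closure D" for x y
  proof -
    obtain u where u: "\<And>n. u n \<in> D" "u \<longlonglongrightarrow> x" using xy(1) by (auto simp: closure_sequential)
    obtain v where v: "\<And>n. v n \<in> D" "v \<longlonglongrightarrow> y" using xy(2) by (auto simp: closure_sequential)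
    have "(\<lambda>n. g (u n + v n)) \<longlonglongrightarrow> h (x + y)"
      by (intro lim tendsto_add u v csubspace_simps[OF D])
    then show ?thesis
      using LIMSEQ_unique tendsto_add[OF lim[OF u] lim[OF v]] by (simp add: g_add u v) blast
  qed
  have h_sc: "h (c *\<^sub>C x) = c *\<^sub>C h x" if x: "x \<in> closure D" for c x
  proof -
    obtain u where u: "\<And>n. u n \<in> D" "u \<longlonglongrightarrow> x" using x by (auto simp: closure_sequential)
    have "(\<lambda>n. g (c *\<^sub>C u n)) \<longlonglongrightarrow> h (c *\<^sub>C x)"
      by (intro lim scaleC.tendsto tendsto_const u csubspace_simps[OF D])
    then show ?thesis
      using LIMSEQ_unique scaleC.tendsto[OF tendsto_const lim[OF u], of c] by (simp add: g_sc u) blast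
  qed
  have h_bd: "norm (h x) \<le> C * norm x" if x: "x \<in> closure D" for x
  proof -
    obtain u where u: "\<And>n. u n \<in> D" "u \<longlonglongrightarrow> x" using x by (auto simp: closure_sequential)
    show ?thesis
      by (rule LIMSEQ_le[OF tendsto_norm[OF lim[OF u]] tendsto_mult[OF tendsto_const tendsto_norm[OF u(2)]]])
        (use g_bd u in auto)
  qed
  \<comment> \<open>Composing with the projection extends \<open>h\<close> by zero on the complement
    of the closure and keeps the bound \<open>C\<close>.\<close>
  let ?p = "proj (closure D)"
  note pc = closed_closure[of D] csubspace_closure[OF D]
  have p: "projector ?p" "\<And>x. ?p x \<in> closure D"
    using projector_proj[OF pc] proj_in[OF pc] by auto
  note lp = bounded_clinearD[OF projectorD(1)[OF p(1)]]
  have "bounded_clinear (\<lambda>x. h (?p x))"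
  proof (rule bounded_clinearI[of _ C])
    fix x
    have "norm (h (?p x)) \<le> C * norm (?p x)" by (rule h_bd[OF p(2)])
    also have "\<dots> \<le> C * norm x" by (intro mult_left_mono projector_norm_le p C)
    finally show "norm (h (?p x)) \<le> norm x * C" by (simp add: mult.commute)
  qed (simp_all add: lp h_add h_sc p)
  moreover have "A x = h (?p (B x))" for x
  proof -
    have "B x \<in> D" by (simp add: D_def)
    then have "?p (B x) = B x" using proj_fix[OF pc] closure_subset by blast
    then show ?thesis using h(2)[OF \<open>B x \<in> D\<close>] gB by simp
  qed
  ultimately show ?thesis by (intro exI[of _ "\<lambda>x. h (?p x)"]) (auto simp: fun_eq_iff)
qed

section \<open>Hilbert-Schmidt and trace class operators\<close>

lemma cmod_cinner_commute: "cmod (cinner x y) = cmod (cinner y x)"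
  by (metis cinner_commute complex_mod_cnj)

lemma mult_le_sum_squares: "a * b \<le> a\<^sup>2 + (b::real)\<^sup>2"
  using sum_squares_bound[of a b] zero_le_power2[of a] zero_le_power2[of b] by linarith

text \<open>The nonnegative double series of squared matrix elements has row sums given by
  \<open>T\<close> and column sums given by its adjoint. Interchanging the summations shows both to
  have the same total, for any pair of bases.\<close>

lemma parseval_double_sum:
  fixes T :: "'a::chilbert_space \<Rightarrow> 'b::chilbert_space"
  assumes T: "bounded_clinear T" and E: "is_onb E" and F: "is_onb F"
    and s: "((\<lambda>e. (norm (T e))\<^sup>2) has_sum s) E"
  shows "((\<lambda>(e, f). (cmod (cinner f (T e)))\<^sup>2) has_sum s) (E \<times> F)"
    and "((\<lambda>f. (norm (cadjoint T f))\<^sup>2) has_sum s) F"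
proof -
  let ?g = "\<lambda>(e, f). (cmod (cinner f (T e)))\<^sup>2"
  have row: "((\<lambda>f. (cmod (cinner f (T e)))\<^sup>2) has_sum (norm (T e))\<^sup>2) F" for e
    by (rule onb_norm_has_sum[OF F])
  have "(\<lambda>x. norm (?g x)) summable_on Sigma E (\<lambda>_. F)"
    unfolding Infinite_Sum.abs_summable_on_Sigma_iff
    using row[THEN has_sum_imp_summable] row[THEN infsumI] has_sum_imp_summable[OF s] by simp
  then have "?g summable_on E \<times> F" by (rule summable_on_iff_abs_summable_on_real[THEN iffD2])
  then show *: "(?g has_sum s) (E \<times> F)"
    by (intro has_sum_SigmaI[OF _ s]) (simp_all add: row)
  have col: "((\<lambda>e. (cmod (cinner f (T e)))\<^sup>2) has_sum (norm (cadjoint T f))\<^sup>2) E" for f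
    using onb_norm_has_sum[OF E, of "cadjoint T f"]
    by (simp add: cinner_cadjoint_right[OF T] cmod_cinner_commute[of "T _" f])
  show "((\<lambda>f. (norm (cadjoint T f))\<^sup>2) has_sum s) F"
    using *[THEN has_sum_swap[THEN iffD1]] by (rule has_sum_SigmaD) (simp add: col)
qed

definition hilbert_schmidt :: "('a::chilbert_space \<Rightarrow> 'a) \<Rightarrow> bool" where
  "hilbert_schmidt T \<longleftrightarrow>
     bounded_clinear T \<and> (\<exists>E. is_onb E \<and> (\<lambda>e. (norm (T e))\<^sup>2) summable_on E)"

text \<open>Names the very choice made inside \<open>trace_op\<close>, so that traces unfold to sums
  over this fixed basis.\<close>

definition some_onb :: "'a::chilbert_space set" where
  "some_onb = (SOME E. is_onb E)"

lemma is_onb_some_onb [simp]: "is_onb some_onb"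
  unfolding some_onb_def using onb_exists by (rule someI_ex)

lemma trace_op_some_onb: "trace_op T = (\<Sum>\<^sub>\<infinity>e\<in>some_onb. cinner e (T e))"
  by (simp add: trace_op_def some_onb_def)

lemma hilbert_schmidt_bounded: "hilbert_schmidt T \<Longrightarrow> bounded_clinear T"
  by (simp add: hilbert_schmidt_def)

text \<open>Basis independence by two passages to the adjoint: from \<open>T\<close> on
  \<open>E\<close> to \<open>cadjoint T\<close> on \<open>F\<close>, then back to \<open>T\<close>
  on \<open>F\<close>.\<close>

lemma hilbert_schmidt_summable:
  assumes "hilbert_schmidt T" "is_onb F"
  shows "(\<lambda>f. (norm (T f))\<^sup>2) summable_on F"
proof -
  have T: "bounded_clinear T" by (rule hilbert_schmidt_bounded[OF assms(1)])
  obtain E s where E: "is_onb E" and s: "((\<lambda>e. (norm (T e))\<^sup>2) has_sum s) E"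
    using assms(1) unfolding hilbert_schmidt_def summable_on_def by blast
  have "((\<lambda>f. (norm (cadjoint T f))\<^sup>2) has_sum s) F"
    by (rule parseval_double_sum(2)[OF T E assms(2) s])
  from parseval_double_sum(2)[OF bounded_clinear_cadjoint[OF T] assms(2,2) this]
  show ?thesis unfolding cadjoint_cadjoint[OF T] by (rule has_sum_imp_summable)
qed

lemma hilbert_schmidtI:
  "bounded_clinear T \<Longrightarrow> (\<lambda>e. (norm (T e))\<^sup>2) summable_on some_onb \<Longrightarrow> hilbert_schmidt T"
  unfolding hilbert_schmidt_def using is_onb_some_onb by blast

lemma hilbert_schmidt_has_sum:
  "hilbert_schmidt T \<Longrightarrow> ((\<lambda>e. (norm (T e))\<^sup>2) has_sum (\<Sum>\<^sub>\<infinity>e\<in>some_onb. (norm (T e))\<^sup>2)) some_onb"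
  by (intro has_sum_infsum hilbert_schmidt_summable is_onb_some_onb)

lemma cadjoint_has_sum:
  "hilbert_schmidt T \<Longrightarrow>
    ((\<lambda>e. (norm (cadjoint T e))\<^sup>2) has_sum (\<Sum>\<^sub>\<infinity>e\<in>some_onb. (norm (T e))\<^sup>2)) some_onb"
  using parseval_double_sum(2)[OF hilbert_schmidt_bounded is_onb_some_onb is_onb_some_onb
      hilbert_schmidt_has_sum] .

lemma hilbert_schmidt_cadjoint: "hilbert_schmidt T \<Longrightarrow> hilbert_schmidt (cadjoint T)"
  using hilbert_schmidtI[OF bounded_clinear_cadjoint[OF hilbert_schmidt_bounded]
      has_sum_imp_summable[OF cadjoint_has_sum]] .

lemma hilbert_schmidt_comp_left:
  assumes S: "bounded_clinear S" and T: "hilbert_schmidt T"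
  shows "hilbert_schmidt (S \<circ> T)"
proof (rule hilbert_schmidtI)
  show "bounded_clinear (S \<circ> T)" by (simp add: S hilbert_schmidt_bounded[OF T])
  obtain K where K: "K \<ge> 0" "\<And>x. norm (S x) \<le> K * norm x" using bounded_clinear_bound[OF S] by blast
  have "(\<lambda>e. K\<^sup>2 * (norm (T e))\<^sup>2) summable_on some_onb"
    by (intro summable_on_cmult_right hilbert_schmidt_summable T is_onb_some_onb)
  then show "(\<lambda>e. (norm ((S \<circ> T) e))\<^sup>2) summable_on some_onb"
  proof (rule summable_on_comparison_test)
    show "(norm ((S \<circ> T) e))\<^sup>2 \<le> K\<^sup>2 * (norm (T e))\<^sup>2" for e
      using power_mono[OF K(2)[of "T e"], of 2] by (simp add: power_mult_distrib)
  qed simp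
qed

lemma cadjoint_comp:
  assumes "bounded_clinear S" "bounded_clinear T"
  shows "cadjoint (S \<circ> T) = cadjoint T \<circ> cadjoint S"
  by (rule cadjoint_eqI)
    (simp_all add: assms bounded_clinear_cadjoint cinner_cadjoint_left)

text \<open>A factor on the right cannot be estimated basis vector by basis vector; taking adjoints
  moves it to the left.\<close>

lemma hilbert_schmidt_comp_right:
  assumes S: "bounded_clinear S" and T: "hilbert_schmidt T"
  shows "hilbert_schmidt (T \<circ> S)"
proof -
  have "hilbert_schmidt (cadjoint (cadjoint S \<circ> cadjoint T))"
    by (intro hilbert_schmidt_cadjoint hilbert_schmidt_comp_left bounded_clinear_cadjoint S T)
  then show ?thesis
    by (simp add: cadjoint_comp cadjoint_cadjoint bounded_clinear_cadjoint S hilbert_schmidt_bounded[OF T])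
qed

lemma norm_sum_square_le: "(norm (x + y))\<^sup>2 \<le> 2 * (norm x)\<^sup>2 + 2 * (norm (y::'a::real_inner))\<^sup>2"
  using parallelogram[of x y] zero_le_power2[of "norm (x - y)"] by linarith

lemma hilbert_schmidt_add:
  assumes S: "hilbert_schmidt S" and T: "hilbert_schmidt T"
  shows "hilbert_schmidt (\<lambda>x. S x + T x)"
proof (rule hilbert_schmidtI)
  show "bounded_clinear (\<lambda>x. S x + T x)" by (intro bounded_clinear_add hilbert_schmidt_bounded S T)
  have "(\<lambda>e. 2 * (norm (S e))\<^sup>2 + 2 * (norm (T e))\<^sup>2) summable_on some_onb"
    by (intro summable_on_add summable_on_cmult_right hilbert_schmidt_summable S T is_onb_some_onb)
  then show "(\<lambda>e. (norm (S e + T e))\<^sup>2) summable_on some_onb"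
    by (rule summable_on_comparison_test) (simp_all add: norm_sum_square_le)
qed

lemma hilbert_schmidt_scaleC: "hilbert_schmidt T \<Longrightarrow> hilbert_schmidt (\<lambda>x. c *\<^sub>C T x)"
  using hilbert_schmidt_comp_left[OF bounded_clinear_scaleC[OF bounded_clinear_id(1)], of T c]
  by (simp add: comp_def)

lemma hilbert_schmidt_product_summable:
  assumes S: "hilbert_schmidt S" and T: "hilbert_schmidt T"
  shows "(\<lambda>e. norm (cinner (S e) (T e))) summable_on some_onb"
proof (rule Infinite_Sum.abs_summable_on_comparison_test')
  show "(\<lambda>e. (norm (S e))\<^sup>2 + (norm (T e))\<^sup>2) summable_on some_onb"
    by (intro summable_on_add hilbert_schmidt_summable S T is_onb_some_onb)
  show "cmod (cinner (S e) (T e)) \<le> (norm (S e))\<^sup>2 + (norm (T e))\<^sup>2" for e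
    by (rule order_trans[OF norm_cinner_le mult_le_sum_squares])
qed

text \<open>Both traces are iterated sums of one double series \<open>h\<close>, by rows and by
  columns. Its absolute summability, from \<open>mult_le_sum_squares\<close>, permits the
  interchange.\<close>

lemma hilbert_schmidt_trace_comm:
  assumes A: "hilbert_schmidt A" and B: "hilbert_schmidt B"
  shows "trace_op (A \<circ> B) = trace_op (B \<circ> A)"
proof -
  note A' = hilbert_schmidt_bounded[OF A] and B' = hilbert_schmidt_bounded[OF B]
  note A'' = bounded_clinear_cadjoint[OF A']
  let ?E = "some_onb :: 'a set"
  define h where "h = (\<lambda>(e, f). cinner (cadjoint A e) f * cinner f (B e))"
  have "(\<lambda>x. (\<lambda>(e, f). (cmod (cinner f (cadjoint A e)))\<^sup>2) x + (\<lambda>(e, f). (cmod (cinner f (B e)))\<^sup>2) x)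
      summable_on ?E \<times> ?E"
    using parseval_double_sum(1)[OF A'' is_onb_some_onb is_onb_some_onb cadjoint_has_sum[OF A]]
      parseval_double_sum(1)[OF B' is_onb_some_onb is_onb_some_onb hilbert_schmidt_has_sum[OF B]]
    by (intro summable_on_add) (auto intro: has_sum_imp_summable)
  then have "(\<lambda>x. norm (h x)) summable_on ?E \<times> ?E"
  proof (rule Infinite_Sum.abs_summable_on_comparison_test')
    fix x :: "'a \<times> 'a"
    obtain e f where x: "x = (e, f)" by fastforce
    show "cmod (h x) \<le> (\<lambda>(e, f). (cmod (cinner f (cadjoint A e)))\<^sup>2) x +
        (\<lambda>(e, f). (cmod (cinner f (B e)))\<^sup>2) x"
      unfolding h_def x
      by (simp add: norm_mult cmod_cinner_commute[of "cadjoint A e" f] mult_le_sum_squares)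
  qed
  then obtain s where s: "(h has_sum s) (?E \<times> ?E)"
    using abs_summable_summable summable_on_def by blast
  have row: "((\<lambda>f. h (e, f)) has_sum cinner e ((A \<circ> B) e)) ?E" for e
    using onb_cinner_has_sum[OF is_onb_some_onb, of "cadjoint A e" "B e"]
    by (simp add: h_def cinner_cadjoint_left[OF A'])
  have 1: "trace_op (A \<circ> B) = s"
    unfolding trace_op_some_onb by (rule infsumI) (rule has_sum_SigmaD[OF s row])
  have col: "((\<lambda>e. h (e, f)) has_sum cinner f ((B \<circ> A) f)) ?E" for f
    using onb_cinner_has_sum[OF is_onb_some_onb, of "cadjoint B f" "A f"]
    by (simp add: h_def cinner_cadjoint_left[OF A'] cinner_cadjoint_left[OF B'] mult.commute)
  have "((\<lambda>(f, e). h (e, f)) has_sum s) (?E \<times> ?E)" using s has_sum_swap by blast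
  then have "((\<lambda>f. cinner f ((B \<circ> A) f)) has_sum s) ?E"
    by (rule has_sum_SigmaD) (simp only: prod.case col)
  then have "trace_op (B \<circ> A) = s" unfolding trace_op_some_onb by (rule infsumI)
  with 1 show ?thesis by simp
qed

section \<open>Trace class operators and the trace\<close>

lemma trace_class_bounded: "T \<in> trace_class \<Longrightarrow> bounded_clinear T"
  by (simp add: trace_class_def)

text \<open>Since \<open>abs_op T\<close> is \<open>W \<circ> T\<close> for some bounded
  \<open>W\<close>, a test with all bounded left factors covers it. Membership can thus be checked
  without computing any absolute value.\<close>

lemma trace_classI:
  assumes T: "bounded_clinear T"
    and summable: "\<And>W. bounded_clinear W \<Longrightarrow> (\<lambda>e. cinner e (W (T e))) summable_on some_onb"
  shows "T \<in> trace_class"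
proof -
  obtain W where "bounded_clinear W" "abs_op T = W \<circ> T"
    using douglas_factorization[OF positive_opD(1)[OF positive_abs_op[OF T]] T, of 1] norm_abs_op[OF T]
    by auto
  then have "(\<lambda>e. cinner e (abs_op T e)) summable_on some_onb" using summable by simp
  then show ?thesis unfolding trace_class_def using T is_onb_some_onb by blast
qed

text \<open>With R the root of \<open>abs_op T\<close>, the diagonal elements of
  \<open>abs_op T\<close> are squared norms of R, so R is Hilbert-Schmidt. Then T = W (R R) = (W R)
  R.\<close>

lemma trace_class_factor:
  assumes "T \<in> trace_class"
  obtains A B where "hilbert_schmidt A" "hilbert_schmidt B" "T = A \<circ> B"
proof -
  have T: "bounded_clinear T" by (rule trace_class_bounded[OF assms])
  note S = positive_abs_op[OF T]
  obtain R where R: "positive_op R" "R \<circ> R = abs_op T" using positive_sqrt_exists[OF S] by metis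
  obtain E where E: "is_onb E" "(\<lambda>e. cinner e (abs_op T e)) summable_on E"
    using assms unfolding trace_class_def by blast
  have "cinner e (abs_op T e) = of_real ((norm (R e))\<^sup>2)" for e
    unfolding R(2)[symmetric] by (simp add: positive_op_selfadj[OF R(1), symmetric] cinner_self)
  then have "(\<lambda>e. Re (complex_of_real ((norm (R e))\<^sup>2))) summable_on E"
    using summable_on_Re[OF E(2)] by simp
  then have hs: "hilbert_schmidt R"
    unfolding hilbert_schmidt_def using E(1) positive_opD(1)[OF R(1)] by auto
  obtain W where W: "bounded_clinear W" "T = W \<circ> abs_op T"
    using douglas_factorization[OF T positive_opD(1)[OF S], of 1] norm_abs_op[OF T] by auto
  show ?thesis
    by (rule that[of "W \<circ> R" R])
      (use W R hs in \<open>auto intro: hilbert_schmidt_comp_left simp: comp_assoc\<close>)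
qed

lemma trace_class_summable:
  fixes T U V :: "'a::chilbert_space \<Rightarrow> 'a"
  assumes T: "T \<in> trace_class" and U: "bounded_clinear U" and V: "bounded_clinear V"
  shows "(\<lambda>e. cinner e (U (T (V e)))) summable_on some_onb"
proof -
  obtain A B where A: "hilbert_schmidt A" and B: "hilbert_schmidt B" and AB: "T = A \<circ> B"
    using trace_class_factor[OF T] .
  have UA: "hilbert_schmidt (U \<circ> A)" and BV: "hilbert_schmidt (B \<circ> V)"
    by (rule hilbert_schmidt_comp_left[OF U A] hilbert_schmidt_comp_right[OF V B])+
  have "cinner (cadjoint (U \<circ> A) e) ((B \<circ> V) e) = cinner e (U (T (V e)))" for e
    by (subst cinner_cadjoint_left[OF hilbert_schmidt_bounded[OF UA]]) (simp add: AB)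
  then show ?thesis
    using abs_summable_summable[OF
        hilbert_schmidt_product_summable[OF hilbert_schmidt_cadjoint[OF UA] BV]] by simp
qed

lemma trace_class_comp_left:
  assumes T: "T \<in> trace_class" and U: "bounded_clinear U"
  shows "U \<circ> T \<in> trace_class"
proof (rule trace_classI)
  show "bounded_clinear (U \<circ> T)" by (simp add: U trace_class_bounded[OF T])
  show "(\<lambda>e. cinner e (W ((U \<circ> T) e))) summable_on some_onb" if "bounded_clinear W" for W
    using trace_class_summable[OF T bounded_clinear_comp[OF that U] bounded_clinear_id(1)] by simp
qed

lemma trace_class_comp_right:
  assumes T: "T \<in> trace_class" and U: "bounded_clinear U"
  shows "T \<circ> U \<in> trace_class"
proof (rule trace_classI)
  show "bounded_clinear (T \<circ> U)" by (simp add: U trace_class_bounded[OF T])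
  show "(\<lambda>e. cinner e (W ((T \<circ> U) e))) summable_on some_onb" if "bounded_clinear W" for W
    using trace_class_summable[OF T that U] by simp
qed

lemma trace_class_add:
  assumes S: "S \<in> trace_class" and T: "T \<in> trace_class"
  shows "(\<lambda>x. S x + T x) \<in> trace_class"
proof (rule trace_classI)
  show "bounded_clinear (\<lambda>x. S x + T x)" by (intro bounded_clinear_add trace_class_bounded S T)
  show "(\<lambda>e. cinner e (W (S e + T e))) summable_on some_onb" if W: "bounded_clinear W" for W
    using summable_on_add[OF trace_class_summable[OF S W bounded_clinear_id(1)]
        trace_class_summable[OF T W bounded_clinear_id(1)]]
    by (simp add: bounded_clinearD[OF W] cinner_simps)
qed

lemma trace_class_scaleC: "T \<in> trace_class \<Longrightarrow> (\<lambda>x. c *\<^sub>C T x) \<in> trace_class"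
  using trace_class_comp_left[OF _ bounded_clinear_scaleC[OF bounded_clinear_id(1)], of T c]
  by (simp add: comp_def)

lemma trace_op_add:
  assumes S: "S \<in> trace_class" and T: "T \<in> trace_class"
  shows "trace_op (\<lambda>x. S x + T x) = trace_op S + trace_op T"
  using infsum_add[OF trace_class_summable[OF S bounded_clinear_id(1) bounded_clinear_id(1)]
      trace_class_summable[OF T bounded_clinear_id(1) bounded_clinear_id(1)]]
  by (simp add: trace_op_some_onb cinner_simps)

lemma trace_op_scaleC: "trace_op (\<lambda>x. c *\<^sub>C T x) = c * trace_op T"
  by (simp add: trace_op_some_onb cinner_simps infsum_cmult_right')

lemma hilbert_schmidt_comp_trace_class:
  assumes A: "hilbert_schmidt A" and B: "hilbert_schmidt B"
  shows "A \<circ> B \<in> trace_class"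
proof (rule trace_classI)
  show "bounded_clinear (A \<circ> B)" by (simp add: hilbert_schmidt_bounded A B)
  fix W :: "'a \<Rightarrow> 'a" assume W: "bounded_clinear W"
  have WA: "hilbert_schmidt (W \<circ> A)" by (rule hilbert_schmidt_comp_left[OF W A])
  have "cinner (cadjoint (W \<circ> A) e) (B e) = cinner e (W ((A \<circ> B) e))" for e
    by (subst cinner_cadjoint_left[OF hilbert_schmidt_bounded[OF WA]]) simp
  then show "(\<lambda>e. cinner e (W ((A \<circ> B) e))) summable_on some_onb"
    using abs_summable_summable[OF
        hilbert_schmidt_product_summable[OF hilbert_schmidt_cadjoint[OF WA] B]] by simp
qed

text \<open>The operator \<open>V\<close> is merely bounded, so it is attached to a Hilbert-Schmidt
  factor of T = A B each time: A (B V) becomes (B V) A = B (V A), which becomes (V A) B.\<close>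

lemma trace_op_cyclic:
  assumes T: "T \<in> trace_class" and V: "bounded_clinear V"
  shows "trace_op (T \<circ> V) = trace_op (V \<circ> T)"
proof -
  obtain A B where A: "hilbert_schmidt A" and B: "hilbert_schmidt B" and AB: "T = A \<circ> B"
    using trace_class_factor[OF T] .
  have "trace_op (A \<circ> (B \<circ> V)) = trace_op ((B \<circ> V) \<circ> A)"
    by (intro hilbert_schmidt_trace_comm A hilbert_schmidt_comp_right V B)
  also have "\<dots> = trace_op (B \<circ> (V \<circ> A))" by (simp add: comp_assoc)
  also have "\<dots> = trace_op ((V \<circ> A) \<circ> B)"
    by (intro hilbert_schmidt_trace_comm B hilbert_schmidt_comp_left V A)
  finally show ?thesis by (simp add: AB comp_assoc)
qed

lemma outer_trace_class [simp]: "outer x y \<in> trace_class"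
proof (rule trace_classI)
  show "(\<lambda>e. cinner e (W (outer x y e))) summable_on some_onb" if W: "bounded_clinear W" for W
    using has_sum_imp_summable[OF onb_cinner_has_sum[OF is_onb_some_onb, of y "W x"]]
    by (simp add: outer_def bounded_clinearD[OF W] cinner_simps)
qed simp

lemma trace_outer_comp:
  assumes X: "bounded_clinear X"
  shows "trace_op (outer x y \<circ> X) = cinner y (X x)"
proof -
  have "cinner e ((outer x y \<circ> X) e) = cinner (cadjoint X y) e * cinner e x" for e
    by (simp add: outer_def cinner_simps cinner_cadjoint_left[OF X])
  then show ?thesis
    unfolding trace_op_some_onb
    using infsumI[OF onb_cinner_has_sum[OF is_onb_some_onb, of "cadjoint X y" x]]
    by (simp add: cinner_cadjoint_left[OF X])
qed

lemma trace_outer: "trace_op (outer x y) = cinner y x"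
  using trace_outer_comp[OF bounded_clinear_id(1), of x y] by (simp add: comp_def)

section \<open>Inequalities for positive trace class operators\<close>

lemma positive_trace_class_sqrt:
  assumes S: "positive_op S" "S \<in> trace_class"
  obtains R where "positive_op R" "R \<circ> R = S" "hilbert_schmidt R"
    "trace_op S = of_real (\<Sum>\<^sub>\<infinity>e\<in>some_onb. (norm (R e))\<^sup>2)"
proof -
  obtain R where R: "positive_op R" "R \<circ> R = S" using positive_sqrt_exists[OF S(1)] by metis
  have eq: "cinner e (S e) = of_real ((norm (R e))\<^sup>2)" for e
    unfolding R(2)[symmetric] by (simp add: positive_op_selfadj[OF R(1), symmetric] cinner_self)
  have summable: "(\<lambda>e. cinner e (S e)) summable_on some_onb"
    using trace_class_summable[OF S(2) bounded_clinear_id(1) bounded_clinear_id(1)] .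
  then have "(\<lambda>e. Re (cinner e (S e))) summable_on some_onb" by (rule summable_on_Re)
  then have s: "(\<lambda>e. (norm (R e))\<^sup>2) summable_on some_onb" by (simp add: eq)
  then have "hilbert_schmidt R" by (rule hilbert_schmidtI[OF positive_opD(1)[OF R(1)]])
  moreover have "trace_op S = of_real (\<Sum>\<^sub>\<infinity>e\<in>some_onb. (norm (R e))\<^sup>2)"
    unfolding trace_op_some_onb eq
    by (rule infsumI) (use has_sum_bounded_linear[OF bounded_linear_of_real has_sum_infsum[OF s]] in simp)
  ultimately show ?thesis using that R by blast
qed

lemma norm_cadjoint_le:
  assumes Y: "bounded_clinear Y" and K: "\<And>x. norm (Y x) \<le> K * norm x" "K \<ge> 0"
  shows "norm (cadjoint Y x) \<le> K * norm x"
proof -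
  have "norm (cadjoint Y x) * norm (cadjoint Y x) = cmod (cinner x (Y (cadjoint Y x)))"
    by (simp add: cinner_cadjoint_left[OF Y, symmetric] cinner_self power2_eq_square norm_mult)
  also have "\<dots> \<le> norm x * norm (Y (cadjoint Y x))" by (rule norm_cinner_le)
  also have "\<dots> \<le> norm x * (K * norm (cadjoint Y x))" by (intro mult_left_mono K) simp
  finally show ?thesis
    using K(2) by (cases "cadjoint Y x = 0") (simp_all add: mult_ac)
qed

text \<open>A substitute for trace norm duality: writing S = R R turns the trace into a
  Hilbert-Schmidt pairing of \<open>R\<close> with \<open>R \<circ> Y\<close>.\<close>

lemma positive_trace_comp_bound:
  assumes S: "positive_op S" "S \<in> trace_class" and Y: "bounded_clinear Y"
    and K: "K > 0" "\<And>x. norm (Y x) \<le> K * norm x"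
  shows "cmod (trace_op (S \<circ> Y)) \<le> K * Re (trace_op S)"
proof -
  obtain R where R: "positive_op R" "R \<circ> R = S" "hilbert_schmidt R"
    and tr: "trace_op S = of_real (\<Sum>\<^sub>\<infinity>e\<in>some_onb. (norm (R e))\<^sup>2)"
    using positive_trace_class_sqrt[OF S] .
  let ?s = "\<Sum>\<^sub>\<infinity>e\<in>some_onb. (norm (R e))\<^sup>2"
  have RY: "hilbert_schmidt (R \<circ> Y)" by (rule hilbert_schmidt_comp_right[OF Y R(3)])
  let ?t = "\<Sum>\<^sub>\<infinity>e\<in>some_onb. (norm ((R \<circ> Y) e))\<^sup>2"
  have eq: "cinner e ((S \<circ> Y) e) = cinner (R e) ((R \<circ> Y) e)" for e
    unfolding R(2)[symmetric] by (simp add: positive_op_selfadj[OF R(1)])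
  have ab: "(\<lambda>e. norm (cinner (R e) ((R \<circ> Y) e))) summable_on some_onb"
    by (rule hilbert_schmidt_product_summable[OF R(3) RY])
  \<comment> \<open>The sum is evaluated on the adjoint, where \<open>cadjoint Y\<close> stands on
    the left and can be bounded pointwise.\<close>
  have t: "?t \<le> K\<^sup>2 * ?s"
  proof (rule has_sum_mono[OF cadjoint_has_sum[OF RY] has_sum_cmult_right[OF hilbert_schmidt_has_sum[OF R(3)]]])
    fix e
    have "norm (cadjoint (R \<circ> Y) e) \<le> K * norm (R e)"
      using norm_cadjoint_le[OF Y K(2), of "R e"] K(1)
      by (simp add: cadjoint_comp Y positive_opD(1)[OF R(1)] cadjoint_positive[OF R(1)])
    then have "(norm (cadjoint (R \<circ> Y) e))\<^sup>2 \<le> (K * norm (R e))\<^sup>2" by (simp add: power_mono)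
    then show "(norm (cadjoint (R \<circ> Y) e))\<^sup>2 \<le> K\<^sup>2 * (norm (R e))\<^sup>2" by (simp add: power_mult_distrib)
  qed
  have "cmod (trace_op (S \<circ> Y)) \<le> (\<Sum>\<^sub>\<infinity>e\<in>some_onb. cmod (cinner (R e) ((R \<circ> Y) e)))"
    unfolding trace_op_some_onb eq by (rule norm_infsum_bound[OF ab])
  \<comment> \<open>The weights in this arithmetic-geometric mean inequality are balanced against
    \<open>t\<close>: both halves then contribute K/2 times \<open>?s\<close>.\<close>
  also have "\<dots> \<le> (K / 2) * ?s + (1 / (2 * K)) * ?t"
  proof (rule has_sum_mono[OF has_sum_infsum[OF ab]
        has_sum_add[OF has_sum_cmult_right[OF hilbert_schmidt_has_sum[OF R(3)]]
          has_sum_cmult_right[OF hilbert_schmidt_has_sum[OF RY]]]])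
    fix e
    have "cmod (cinner (R e) ((R \<circ> Y) e)) \<le> norm (R e) * norm ((R \<circ> Y) e)" by (rule norm_cinner_le)
    also have "\<dots> \<le> (K / 2) * (norm (R e))\<^sup>2 + (1 / (2 * K)) * (norm ((R \<circ> Y) e))\<^sup>2"
      using zero_le_power2[of "K * norm (R e) - norm ((R \<circ> Y) e)"] K(1)
      by (simp add: field_simps power2_eq_square)
    finally show "cmod (cinner (R e) ((R \<circ> Y) e)) \<le>
        (K / 2) * (norm (R e))\<^sup>2 + (1 / (2 * K)) * (norm ((R \<circ> Y) e))\<^sup>2" .
  qed
  also have "\<dots> \<le> (K / 2) * ?s + (1 / (2 * K)) * (K\<^sup>2 * ?s)"
    by (intro add_left_mono mult_left_mono t) (use K(1) in simp)
  also have "\<dots> = K * Re (trace_op S)"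
    using K(1) unfolding tr by (simp add: power2_eq_square)
  finally show ?thesis .
qed

text \<open>Expand \<open>R x\<close> in the basis, R being the root of \<open>S\<close>; symmetry
  moves R onto the basis vectors, whose squared norms sum to the trace.\<close>

lemma positive_le_trace:
  assumes S: "positive_op S" "S \<in> trace_class"
  shows "Re (cinner x (S x)) \<le> Re (trace_op S) * (norm x)\<^sup>2"
proof -
  obtain R where R: "positive_op R" "R \<circ> R = S" "hilbert_schmidt R"
    and tr: "trace_op S = of_real (\<Sum>\<^sub>\<infinity>e\<in>some_onb. (norm (R e))\<^sup>2)"
    using positive_trace_class_sqrt[OF S] .
  have "Re (cinner x (S x)) = (norm (R x))\<^sup>2"
    unfolding R(2)[symmetric] by (simp add: positive_op_selfadj[OF R(1), symmetric] cinner_self)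
  also have "\<dots> \<le> (\<Sum>\<^sub>\<infinity>e\<in>some_onb. (norm (R e))\<^sup>2) * (norm x)\<^sup>2"
  proof (rule has_sum_mono[OF onb_norm_has_sum[OF is_onb_some_onb]
        has_sum_cmult_left[OF hilbert_schmidt_has_sum[OF R(3)]]])
    fix e
    have "cmod (cinner e (R x)) \<le> norm (R e) * norm x"
      unfolding positive_op_selfadj[OF R(1), symmetric] by (rule norm_cinner_le)
    then have "(cmod (cinner e (R x)))\<^sup>2 \<le> (norm (R e) * norm x)\<^sup>2" by (simp add: power_mono)
    then show "(cmod (cinner e (R x)))\<^sup>2 \<le> (norm (R e))\<^sup>2 * (norm x)\<^sup>2" by (simp add: power_mult_distrib)
  qed
  finally show ?thesis by (simp add: tr)
qed

lemma positive_trace_0: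
  assumes S: "positive_op S" "S \<in> trace_class" and "trace_op S = 0"
  shows "S x = 0"
proof -
  have "Re (cinner x (S x)) = 0"
    using positive_le_trace[OF S, of x] positive_opD(2)[OF S(1), of x] assms(3) by simp
  then have "cinner x (S x) = 0" using positive_opD(3)[OF S(1), of x] by simp
  then show ?thesis by (rule positive_op_eq_0[OF S(1)])
qed

lemma hilbert_schmidt_square:
  assumes N: "hilbert_schmidt N"
  shows "positive_op (cadjoint N \<circ> N)" "cadjoint N \<circ> N \<in> trace_class"
    "trace_op (cadjoint N \<circ> N) = of_real (\<Sum>\<^sub>\<infinity>e\<in>some_onb. (norm (N e))\<^sup>2)"
proof -
  note N' = hilbert_schmidt_bounded[OF N]
  show "positive_op (cadjoint N \<circ> N)" by (rule positive_cadjoint_comp[OF N'])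
  show "cadjoint N \<circ> N \<in> trace_class"
    by (rule hilbert_schmidt_comp_trace_class[OF hilbert_schmidt_cadjoint[OF N] N])
  have "cinner e ((cadjoint N \<circ> N) e) = of_real ((norm (N e))\<^sup>2)" for e
    by (simp add: cinner_cadjoint_right[OF N'] cinner_self)
  then show "trace_op (cadjoint N \<circ> N) = of_real (\<Sum>\<^sub>\<infinity>e\<in>some_onb. (norm (N e))\<^sup>2)"
    unfolding trace_op_some_onb
    by (intro infsumI)
      (use has_sum_bounded_linear[OF bounded_linear_of_real hilbert_schmidt_has_sum[OF N]] in simp)
qed

section \<open>Functionals determined by their values on rank one operators\<close>

lemma outer_zero_left: "outer 0 y = (\<lambda>x. 0)"
  by (simp add: outer_def fun_eq_iff)

lemma trace_class_sum:
  fixes T :: "'i \<Rightarrow> 'a::chilbert_space \<Rightarrow> 'a"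
  assumes "finite F" "\<And>i. i \<in> F \<Longrightarrow> T i \<in> trace_class"
  shows "(\<lambda>x. \<Sum>i\<in>F. T i x) \<in> trace_class"
  using assms
proof (induction F rule: finite_induct)
  case empty
  show ?case using outer_trace_class[of "0::'a" "0::'a"] by (simp add: outer_zero_left)
next
  case (insert i F)
  then show ?case by (simp add: trace_class_add)
qed

text \<open>A positive operator \<open>B\<^sup>* B\<close> is approximated in trace norm by the finite rank operators
  \<open>B\<^sup>* P\<^sub>F B\<close>, where \<open>P\<^sub>F\<close> projects onto finitely many vectors of an orthonormal basis.\<close>

lemma linear_functional_0_positive:
  fixes L :: "('a::chilbert_space \<Rightarrow> 'a) \<Rightarrow> complex"
  assumes add: "\<And>S T. S \<in> trace_class \<Longrightarrow> T \<in> trace_class \<Longrightarrow> L (\<lambda>x. S x + T x) = L S + L T"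
    and outer: "\<And>x y. L (outer x y) = 0"
    and bound: "\<And>S. positive_op S \<Longrightarrow> S \<in> trace_class \<Longrightarrow> cmod (L S) \<le> C * Re (trace_op S)"
    and B: "hilbert_schmidt B"
  shows "L (cadjoint B \<circ> B) = 0"
proof -
  let ?E = "some_onb :: 'a set"
  note B' = hilbert_schmidt_bounded[OF B]
  note lB = bounded_clinearD[OF bounded_clinear_cadjoint[OF B']]
  let ?s = "\<Sum>\<^sub>\<infinity>e\<in>some_onb. (norm (B e))\<^sup>2"
  have finite_rank: "L (\<lambda>x. \<Sum>i\<in>F. outer (u i) (u i) x) = 0" if "finite F" for F and u :: "'a \<Rightarrow> 'a"
    using that
  proof (induction F rule: finite_induct)
    case empty
    show ?case using outer[of 0 0] by (simp add: outer_zero_left)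
  next
    case (insert i F)
    then show ?case by (simp add: add trace_class_sum outer)
  qed
  have small: "cmod (L (cadjoint B \<circ> B)) \<le> \<bar>C\<bar> * e" if e: "e > 0" for e
  proof -
    obtain F where F: "finite F" "F \<subseteq> ?E" "dist (\<Sum>f\<in>F. (norm (cadjoint B f))\<^sup>2) ?s \<le> e"
      using has_sum_finite_approximation[OF cadjoint_has_sum[OF B] e] by blast
    define P where "P x = x - (\<Sum>f\<in>F. outer f f x)" for x
    have P: "bounded_clinear P" unfolding P_def
      by (intro bounded_clinear_diff bounded_clinear_finite_sum bounded_clinear_id bounded_clinear_outer)
    have Pe: "P f = (if f \<in> F then 0 else f)" if f: "f \<in> ?E" for f
    proof -
      have "(\<Sum>g\<in>F. outer g g f) = (\<Sum>g\<in>F. if g = f then f else 0)"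
      proof (intro sum.cong refl)
        fix g assume "g \<in> F"
        then have g: "g \<in> ?E" using F(2) by blast
        show "outer g g f = (if g = f then f else 0)"
          using onbD(1)[OF is_onb_some_onb f] onbD(2)[OF is_onb_some_onb g f] by (simp add: outer_def)
      qed
      then show ?thesis by (simp add: P_def F(1))
    qed
    have Psym: "cinner (P x) y = cinner x (P y)" for x y
      by (simp add: P_def cinner_simps cinner.sum_left cinner.sum_right outer_def
          cinner_commute[symmetric] mult.commute)
    have proj: "projector (\<lambda>x. \<Sum>f\<in>F. outer f f x)"
    proof (rule projector_finite_sum[OF F(1)])
      show "projector (outer k k)" if "k \<in> F" for k
        using projector_outer onbD(1)[OF is_onb_some_onb] F(2) that by blast
      show "outer j j (outer k k x) = 0" if "j \<in> F" "k \<in> F" "j \<noteq> k" for j k x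
        using onbD(2)[OF is_onb_some_onb, of j k] F(2) that by (simp add: outer_def cinner_simps subset_iff)
    qed
    have PP: "P (P x) = P x" for x
      using projectorD(2)[OF proj, of x] bounded_clinearD(5)[OF projectorD(1)[OF proj]]
      unfolding P_def by simp
    \<comment> \<open>As \<open>P\<close> is the complement of the finite projector,
      \<open>cadjoint N \<circ> N\<close> is the error of the finite rank approximation. It is
      positive, so \<open>bound\<close> applies to it.\<close>
    define N where "N = P \<circ> B"
    have N: "hilbert_schmidt N" unfolding N_def by (rule hilbert_schmidt_comp_left[OF P B])
    have adjN: "cadjoint N = cadjoint B \<circ> P"
    proof (rule cadjoint_eqI)
      show "bounded_clinear N" by (rule hilbert_schmidt_bounded[OF N])
      show "bounded_clinear (cadjoint B \<circ> P)" by (simp add: P B' bounded_clinear_cadjoint)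
      show "cinner ((cadjoint B \<circ> P) y) x = cinner y (N x)" for x y
        by (simp add: N_def cinner_cadjoint_left[OF B'] Psym)
    qed
    let ?G = "\<lambda>x. \<Sum>f\<in>F. outer (cadjoint B f) (cadjoint B f) x"
    have split: "cadjoint B \<circ> B = (\<lambda>x. (cadjoint N \<circ> N) x + ?G x)"
    proof
      fix x
      have "?G x = cadjoint B (\<Sum>f\<in>F. outer f f (B x))"
        by (simp add: bounded_clinear_sum[OF bounded_clinear_cadjoint[OF B']] outer_def lB
            cinner_cadjoint_left[OF B'])
      moreover have "(cadjoint N \<circ> N) x = cadjoint B (P (B x))" by (simp add: adjN, simp add: N_def PP)
      ultimately show "(cadjoint B \<circ> B) x = (cadjoint N \<circ> N) x + ?G x"
        by (simp add: P_def lB)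
    qed
    have "L (cadjoint B \<circ> B) = L (cadjoint N \<circ> N) + L ?G"
      by (subst split) (intro add hilbert_schmidt_square N trace_class_sum F outer_trace_class)
    then have "cmod (L (cadjoint B \<circ> B)) = cmod (L (cadjoint N \<circ> N))"
      using finite_rank[OF F(1)] by simp
    also have "\<dots> \<le> C * Re (trace_op (cadjoint N \<circ> N))"
      by (intro bound hilbert_schmidt_square N)
    also have "\<dots> = C * (\<Sum>\<^sub>\<infinity>e\<in>some_onb. (norm (N e))\<^sup>2)" by (simp add: hilbert_schmidt_square N)
    \<comment> \<open>The adjoint of \<open>N\<close> agrees with that of \<open>B\<close> on basis
      vectors outside \<open>F\<close> and kills those in \<open>F\<close>, so the trace of the
      error is the tail of a convergent series.\<close>
    also have "(\<Sum>\<^sub>\<infinity>e\<in>some_onb. (norm (N e))\<^sup>2) = ?s - (\<Sum>f\<in>F. (norm (cadjoint B f))\<^sup>2)"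
    proof -
      have 1: "((\<lambda>f. if f \<in> F then 0 else (norm (cadjoint B f))\<^sup>2) has_sum
          (\<Sum>\<^sub>\<infinity>e\<in>some_onb. (norm (N e))\<^sup>2)) ?E"
        using cadjoint_has_sum[OF N]
        by (rule has_sum_cong[THEN iffD1, rotated]) (simp add: adjN Pe lB)
      have 2: "((\<lambda>f. if f \<in> F then (norm (cadjoint B f))\<^sup>2 else 0) has_sum
          (\<Sum>f\<in>F. (norm (cadjoint B f))\<^sup>2)) ?E"
        using has_sum_finiteI[OF F(1) refl, of "\<lambda>f. (norm (cadjoint B f))\<^sup>2"]
        by (rule has_sum_cong_neutral[THEN iffD1, rotated -1]) (use F(2) in auto)
      have "((\<lambda>f. (norm (cadjoint B f))\<^sup>2) has_sum
          (\<Sum>\<^sub>\<infinity>e\<in>some_onb. (norm (N e))\<^sup>2) + (\<Sum>f\<in>F. (norm (cadjoint B f))\<^sup>2)) ?E"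
        using has_sum_add[OF 1 2] by (rule has_sum_cong[THEN iffD1, rotated]) simp
      then show ?thesis using has_sum_unique[OF cadjoint_has_sum[OF B]] by simp
    qed
    also have "C * (?s - (\<Sum>f\<in>F. (norm (cadjoint B f))\<^sup>2)) \<le>
        \<bar>C\<bar> * \<bar>?s - (\<Sum>f\<in>F. (norm (cadjoint B f))\<^sup>2)\<bar>"
      by (metis abs_ge_self abs_mult)
    also have "\<dots> \<le> \<bar>C\<bar> * e" using F(3) by (intro mult_left_mono) (simp_all add: dist_real_def)
    finally show ?thesis .
  qed
  have "cmod (L (cadjoint B \<circ> B)) \<le> 0"
  proof (rule field_le_epsilon)
    fix e :: real assume "e > 0"
    then have "cmod (L (cadjoint B \<circ> B)) \<le> \<bar>C\<bar> * (e / (\<bar>C\<bar> + 1))" by (intro small) (simp add: add_pos_nonneg)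
    also have "\<dots> \<le> e" using \<open>e > 0\<close> by (simp add: field_simps)
    finally show "cmod (L (cadjoint B \<circ> B)) \<le> 0 + e" by simp
  qed
  then show ?thesis by simp
qed

text \<open>Weighting by the fourth roots of unity sums to 4 on the term with \<open>cnj u\<close>
  and to 0 on the other three, so only the mixed term survives.\<close>

lemma polarization:
  fixes B C :: "'a::chilbert_space \<Rightarrow> 'a"
  assumes B: "bounded_clinear B" and C: "bounded_clinear C"
  defines "N \<equiv> \<lambda>u x. B x + u *\<^sub>C C x"
  shows "(\<Sum>u\<in>{1, \<i>, -1, -\<i>}. (u / 4) *\<^sub>C (cadjoint (N u) \<circ> N u) x) = (cadjoint C \<circ> B) x"
proof (rule cinner_eqI)
  fix y
  have N: "bounded_clinear (N u)" for u unfolding N_def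
    by (intro bounded_clinear_add bounded_clinear_scaleC B C)
  have eq: "cinner y ((cadjoint (N u) \<circ> N u) x) = cinner (B y) (B x) + u * cinner (B y) (C x)
      + cnj u * cinner (C y) (B x) + cnj u * u * cinner (C y) (C x)" for u
    by (simp add: cinner_cadjoint_right[OF N]) (simp add: N_def cinner_simps algebra_simps)
  have "cinner y (\<Sum>u\<in>{1, \<i>, -1, -\<i>}. (u / 4) *\<^sub>C (cadjoint (N u) \<circ> N u) x) =
      (\<Sum>u\<in>{1, \<i>, -1, -\<i>}. (u / 4) * (cinner (B y) (B x) + u * cinner (B y) (C x)
      + cnj u * cinner (C y) (B x) + cnj u * u * cinner (C y) (C x)))"
    by (simp only: cinner.sum_right cinner_scaleC_right eq)
  also have "\<dots> = cinner (C y) (B x)" by (simp add: complex_eq_iff field_simps)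
  finally show "cinner y (\<Sum>u\<in>{1, \<i>, -1, -\<i>}. (u / 4) *\<^sub>C (cadjoint (N u) \<circ> N u) x) =
      cinner y ((cadjoint C \<circ> B) x)"
    by (simp only: cinner_cadjoint_right[OF C] comp_apply)
qed

text \<open>Density of finite rank operators in trace norm, phrased without that norm: continuity is
  demanded on positive operators only, where the trace measures size. A general \<open>T\<close> is
  a product of Hilbert-Schmidt operators and splits by \<open>polarization\<close> into four
  operators of the form \<open>cadjoint N \<circ> N\<close>.\<close>

lemma linear_functional_0:
  fixes L :: "('a::chilbert_space \<Rightarrow> 'a) \<Rightarrow> complex"
  assumes add: "\<And>S T. S \<in> trace_class \<Longrightarrow> T \<in> trace_class \<Longrightarrow> L (\<lambda>x. S x + T x) = L S + L T"
    and scale: "\<And>c T. T \<in> trace_class \<Longrightarrow> L (\<lambda>x. c *\<^sub>C T x) = c * L T"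
    and outer: "\<And>x y. L (outer x y) = 0"
    and bound: "\<And>S. positive_op S \<Longrightarrow> S \<in> trace_class \<Longrightarrow> cmod (L S) \<le> C * Re (trace_op S)"
    and T: "T \<in> trace_class"
  shows "L T = 0"
proof -
  obtain A B where A: "hilbert_schmidt A" and B: "hilbert_schmidt B" and AB: "T = A \<circ> B"
    using trace_class_factor[OF T] .
  define D where "D = cadjoint A"
  have D: "hilbert_schmidt D" "cadjoint D = A"
    unfolding D_def by (simp_all add: hilbert_schmidt_cadjoint A cadjoint_cadjoint hilbert_schmidt_bounded)
  define N where "N u x = B x + u *\<^sub>C D x" for u x
  have N: "hilbert_schmidt (N u)" for u unfolding N_def
    by (intro hilbert_schmidt_add hilbert_schmidt_scaleC B D)
  define S where "S u = cadjoint (N u) \<circ> N u" for u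
  have S: "S u \<in> trace_class" "L (S u) = 0" for u
    unfolding S_def
    by (rule hilbert_schmidt_square(2)[OF N], rule linear_functional_0_positive[OF add outer bound N])
  have sum0: "L (\<lambda>x. \<Sum>u\<in>F. (u / 4) *\<^sub>C S u x) = 0" if "finite F" for F
    using that
  proof (induction F rule: finite_induct)
    case empty
    show ?case using outer[of 0 0] by (simp add: outer_zero_left)
  next
    case (insert u F)
    then show ?case by (simp add: add scale trace_class_sum trace_class_scaleC S)
  qed
  have "T = (\<lambda>x. \<Sum>u\<in>{1, \<i>, -1, -\<i>}. (u / 4) *\<^sub>C S u x)"
    using polarization[OF hilbert_schmidt_bounded[OF B] hilbert_schmidt_bounded[OF D(1)]]
    unfolding S_def N_def[abs_def] D(2) AB by (intro ext) (rule sym)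
  then show ?thesis using sum0[of "{1, \<i>, -1, -\<i>}"] by simp
qed

section \<open>Quantum channels on rank one operators\<close>

lemma trace_op_cadjoint:
  assumes "bounded_clinear T"
  shows "trace_op (cadjoint T) = cnj (trace_op T)"
proof -
  have "cinner e (cadjoint T e) = cnj (cinner e (T e))" for e
    by (metis assms cinner_cadjoint_right cinner_commute)
  then show ?thesis by (simp add: trace_op_some_onb)
qed

lemma outer_add_left: "outer (x + x') y = (\<lambda>v. outer x y v + outer x' y v)"
  and outer_add_right: "outer x (y + y') = (\<lambda>v. outer x y v + outer x y' v)"
  and outer_scaleC_left: "outer (c *\<^sub>C x) y = (\<lambda>v. c *\<^sub>C outer x y v)"
  and outer_scaleC_right: "outer x (c *\<^sub>C y) = (\<lambda>v. cnj c *\<^sub>C outer x y v)"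
  by (simp_all add: outer_def fun_eq_iff scaleC_add_right scaleC_add_left cinner_simps
      scaleC_scaleC mult.commute)

locale channel =
  fixes \<Phi> :: "('a::chilbert_space \<Rightarrow> 'a) \<Rightarrow> ('b::chilbert_space \<Rightarrow> 'b)"
  assumes quantum_channel: "quantum_channel \<Phi>"
begin

lemma channel_simps:
  assumes "\<rho> \<in> trace_class"
  shows "\<Phi> \<rho> \<in> trace_class" "\<sigma> \<in> trace_class \<Longrightarrow> \<Phi> (\<lambda>x. \<rho> x + \<sigma> x) = (\<lambda>y. \<Phi> \<rho> y + \<Phi> \<sigma> y)"
    "\<Phi> (\<lambda>x. c *\<^sub>C \<rho> x) = (\<lambda>y. c *\<^sub>C \<Phi> \<rho> y)" "trace_op (\<Phi> \<rho>) = trace_op \<rho>"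
  using quantum_channel assms unfolding quantum_channel_def by blast+

abbreviation img :: "'a \<Rightarrow> 'a \<Rightarrow> 'b \<Rightarrow> 'b" where
  "img x y \<equiv> \<Phi> (outer x y)"

lemma channel_positive_block:
  assumes "\<And>i j. T i j \<in> trace_class" "positive_block n T"
  shows "positive_block n (\<lambda>i j. \<Phi> (T i j))"
proof -
  have "completely_positive \<Phi>" using quantum_channel by (simp add: quantum_channel_def)
  then show ?thesis
    using assms unfolding completely_positive_def by (elim allE[of _ n] allE[of _ T]) simp
qed

lemma channel_positive:
  assumes "positive_op S" "S \<in> trace_class"
  shows "positive_op (\<Phi> S)"
proof -
  have "positive_block 1 (\<lambda>i j. S)"
    using assms(1) by (simp add: positive_block_def positive_op_def)
  then have "positive_block 1 (\<lambda>i j. \<Phi> S)"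
    using channel_positive_block[of "\<lambda>i j. S" 1] assms(2) by simp
  then have "cinner v (\<Phi> S v) \<in> \<real>\<^sub>\<ge>\<^sub>0" for v
    unfolding positive_block_def by (elim allE[of _ "\<lambda>i. v"]) simp
  then show ?thesis
    by (simp add: positive_op_def trace_class_bounded[OF channel_simps(1)[OF assms(2)]])
qed

text \<open>The input matrix of operators \<open>outer (x i) (x j)\<close> is a single positive rank
  one operator on the tensor product, its form being the squared modulus of \<open>s\<close>.
  Complete positivity is used in this form in all inequalities for \<open>img\<close>.\<close>

lemma img_block:
  fixes x :: "nat \<Rightarrow> 'a" and v :: "nat \<Rightarrow> 'b"
  shows "(\<Sum>i<n. \<Sum>j<n. cinner (v i) (img (x i) (x j) (v j))) \<in> \<real>\<^sub>\<ge>\<^sub>0"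
proof -
  have "positive_block n (\<lambda>i j. outer (x i) (x j))"
    unfolding positive_block_def
  proof
    fix w :: "nat \<Rightarrow> 'a"
    define s where "s = (\<Sum>j<n. cinner (x j) (w j))"
    have "(\<Sum>i<n. \<Sum>j<n. cinner (w i) (outer (x i) (x j) (w j))) = (\<Sum>i<n. cinner (w i) (x i)) * s"
      by (simp add: outer_def cinner_simps s_def sum_product mult.commute)
    also have "(\<Sum>i<n. cinner (w i) (x i)) = cnj s"
      unfolding s_def by (simp add: cnj_sum cinner_commute[symmetric])
    also have "cnj s * s = of_real ((cmod s)\<^sup>2)"
      by (metis complex_norm_square mult.commute of_real_power)
    finally show "(\<Sum>i<n. \<Sum>j<n. cinner (w i) (outer (x i) (x j) (w j))) \<in> \<real>\<^sub>\<ge>\<^sub>0"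
      by (simp add: complex_nonneg_Reals_iff)
  qed
  then have "positive_block n (\<lambda>i j. img (x i) (x j))"
    by (rule channel_positive_block[rotated]) simp
  then show ?thesis unfolding positive_block_def by blast
qed

lemma img_block2:
  "cinner c (img x x c) + cinner c (img x y d) + cinner d (img y x c) + cinner d (img y y d) \<in> \<real>\<^sub>\<ge>\<^sub>0"
  using img_block[where n = 2 and v = "\<lambda>i. if i = 0 then c else d" and x = "\<lambda>i. if i = 0 then x else y"]
  by (simp add: numeral_2_eq_2 add.assoc)

lemma img_block3:
  "cinner c (img x x c) + cinner c (img x y d) + cinner c (img x z e) +
   cinner d (img y x c) + cinner d (img y y d) + cinner d (img y z e) +
   cinner e (img z x c) + cinner e (img z y d) + cinner e (img z z e) \<in> \<real>\<^sub>\<ge>\<^sub>0"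
  using img_block[where n = 3 and v = "\<lambda>i. if i = 0 then c else if i = 1 then d else e"
      and x = "\<lambda>i. if i = 0 then x else if i = 1 then y else z"]
  by (simp add: numeral_3_eq_3 add.assoc)

lemma bounded_clinear_img: "bounded_clinear (img x y)"
  by (intro trace_class_bounded channel_simps outer_trace_class)

lemmas img_simps = bounded_clinearD[OF bounded_clinear_img]

lemma img_trace_class [simp]: "img x y \<in> trace_class"
  by (intro channel_simps outer_trace_class)

lemma positive_img: "positive_op (img x x)"
proof (rule channel_positive)
  show "positive_op (outer x x)"
    unfolding positive_op_def
  proof (intro conjI allI)
    fix v
    have "cinner v (outer x x v) = of_real ((cmod (cinner x v))\<^sup>2)"
      by (metis cinner_commute cinner_scaleC_right complex_norm_square of_real_power outer_def)
    then show "cinner v (outer x x v) \<in> \<real>\<^sub>\<ge>\<^sub>0" by (simp add: complex_nonneg_Reals_iff)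
  qed simp
qed simp

lemma trace_img: "trace_op (img x y) = cinner y x"
  by (simp add: channel_simps trace_outer)

lemma img_sesquilinear:
  "img (x + x') y v = img x y v + img x' y v" "img x (y + y') v = img x y v + img x y' v"
  "img (c *\<^sub>C x) y v = c *\<^sub>C img x y v" "img x (c *\<^sub>C y) v = cnj c *\<^sub>C img x y v"
  by (simp_all add: outer_add_left outer_add_right outer_scaleC_left outer_scaleC_right channel_simps)

text \<open>Preservation of adjoints follows from positivity: the 2x2 block and its diagonal entries
  are real, so the off-diagonal entries have opposite imaginary parts. Replacing \<open>d\<close> by
  \<open>\<i> *\<^sub>C d\<close> compares the real parts.\<close>

lemma img_adjoint: "cinner (img y x c) d = cinner c (img x y d)"
proof -
  have im: "Im (cinner c (img x x c)) = 0" for c x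
    using positive_opD(3)[OF positive_img, of c x] by (metis Im_complex_of_real)
  have *: "Im (cinner c (img x y d)) + Im (cinner d (img y x c)) = 0" for d
    using img_block2[of c x y d] by (simp add: complex_nonneg_Reals_iff im)
  have "Re (cinner c (img x y d)) = Re (cinner d (img y x c))"
    using *[of "\<i> *\<^sub>C d"] by (simp add: img_simps cinner_simps)
  then have "cinner c (img x y d) = cnj (cinner d (img y x c))"
    using *[of d] by (simp add: complex_eq_iff)
  then show ?thesis by (metis cinner_commute)
qed

lemma cadjoint_img: "cadjoint (img x y) = img y x"
  by (rule cadjoint_eqI) (simp_all add: bounded_clinear_img img_adjoint)

lemma img_cauchy_schwarz:
  "(cmod (cinner c (img x y d)))\<^sup>2 \<le> Re (cinner c (img x x c)) * Re (cinner d (img y y d))"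
proof (rule quadratic_form_nonneg)
  show "0 \<le> Re (cinner d (img y y d))" by (rule positive_opD(2)[OF positive_img])
  fix t
  let ?p = "cinner c (img x y d)"
  have r: "cinner d (img y x c) = cnj ?p" by (metis cinner_commute img_adjoint)
  have "cinner c (img x x c) + cinner c (img x y (t *\<^sub>C d)) + cinner (t *\<^sub>C d) (img y x c) +
     cinner (t *\<^sub>C d) (img y y (t *\<^sub>C d)) = cinner c (img x x c) + (t * ?p + cnj (t * ?p)) +
     (t * cnj t) * cinner d (img y y d)"
    by (simp add: img_simps cinner_simps r)
  also have "t * ?p + cnj (t * ?p) = of_real (2 * Re (t * ?p))" by (rule complex_add_cnj)
  also have "t * cnj t = of_real ((cmod t)\<^sup>2)" by (metis complex_norm_square of_real_power)
  finally have "cinner c (img x x c) + of_real (2 * Re (t * ?p)) +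
      of_real ((cmod t)\<^sup>2) * cinner d (img y y d) \<in> \<real>\<^sub>\<ge>\<^sub>0"
    using img_block2[of c x y "t *\<^sub>C d"] by (simp only:)
  then have "0 \<le> Re (cinner c (img x x c) + of_real (2 * Re (t * ?p)) +
      of_real ((cmod t)\<^sup>2) * cinner d (img y y d))"
    by (simp only: complex_nonneg_Reals_iff)
  then show "0 \<le> Re (cinner c (img x x c)) + 2 * Re (t * ?p) + (cmod t)\<^sup>2 * Re (cinner d (img y y d))"
    by simp
qed

text \<open>The Cauchy-Schwarz inequality reduces to diagonal entries, where the operator is
  dominated by its trace, and the channel preserves the trace.\<close>

lemma cmod_img_le: "cmod (cinner c (img x y d)) \<le> (norm x * norm y) * (norm c * norm d)"
proof -
  have *: "Re (cinner c (img x x c)) \<le> (norm x)\<^sup>2 * (norm c)\<^sup>2" for x c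
    using positive_le_trace[OF positive_img img_trace_class, of c x]
    by (simp add: trace_img cinner_self)
  have "(cmod (cinner c (img x y d)))\<^sup>2 \<le> ((norm x)\<^sup>2 * (norm c)\<^sup>2) * ((norm y)\<^sup>2 * (norm d)\<^sup>2)"
    by (rule order_trans[OF img_cauchy_schwarz])
      (intro mult_mono * positive_opD(2)[OF positive_img] mult_nonneg_nonneg zero_le_power2)
  also have "\<dots> = ((norm x * norm y) * (norm c * norm d))\<^sup>2" by (simp add: power_mult_distrib mult_ac)
  finally show ?thesis by (rule power2_le_imp_le) simp
qed

lemma norm_img_le: "norm (img x y d) \<le> (norm x * norm y) * norm d"
proof -
  have "norm (img x y d) * norm (img x y d) = cmod (cinner (img x y d) (img x y d))"
    by (simp add: cinner_self power2_eq_square norm_mult)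
  also have "\<dots> \<le> (norm x * norm y) * (norm (img x y d) * norm d)" by (rule cmod_img_le)
  finally show ?thesis by (cases "img x y d = 0") (simp_all add: mult_ac)
qed

section \<open>The dual of a channel\<close>

text \<open>Positivity controls only the diagonal \<open>img x x\<close>; polarisation on unit
  vectors and homogeneity extend the bound. It is what \<open>sesquilinear_operator\<close> requires
  for the dual to exist.\<close>

lemma trace_img_comp_bound:
  assumes Y: "bounded_clinear Y"
  shows "\<exists>C\<ge>0. \<forall>x y. cmod (trace_op (img x y \<circ> Y)) \<le> C * norm x * norm y"
proof -
  obtain K0 where K0: "K0 \<ge> 0" "\<And>x. norm (Y x) \<le> K0 * norm x" using bounded_clinear_bound[OF Y] by blast
  define K where "K = K0 + 1"
  have K: "K > 0" "\<And>x. norm (Y x) \<le> K * norm x"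
    using K0(1) order_trans[OF K0(2) mult_right_mono[of K0 "K0 + 1"]] unfolding K_def by auto
  let ?B = "\<lambda>x y. trace_op (img x y \<circ> Y)"
  have tc: "img x y \<circ> Y \<in> trace_class" for x y by (intro trace_class_comp_right img_trace_class Y)
  have B_add: "?B (x + x') y = ?B x y + ?B x' y" "?B x (y + y') = ?B x y + ?B x y'" for x x' y y'
    using trace_op_add[OF tc tc] by (simp_all add: comp_def img_sesquilinear)
  have B_sc: "?B (c *\<^sub>C x) y = c * ?B x y" "?B x (c *\<^sub>C y) = cnj c * ?B x y" for c x y
    using trace_op_scaleC[of _ "img x y \<circ> Y"] by (simp_all add: comp_def img_sesquilinear)
  have diag: "cmod (?B x x) \<le> K * (norm x)\<^sup>2" for x
    using positive_trace_comp_bound[OF positive_img img_trace_class Y K]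
    by (simp add: trace_img cinner_self)
  have polar: "4 * ?B x y = ?B (x + y) (x + y) - ?B (x + (-1) *\<^sub>C y) (x + (-1) *\<^sub>C y)
      + \<i> * ?B (x + \<i> *\<^sub>C y) (x + \<i> *\<^sub>C y) - \<i> * ?B (x + (-\<i>) *\<^sub>C y) (x + (-\<i>) *\<^sub>C y)" for x y
    unfolding B_add B_sc by (simp add: algebra_simps)
  \<comment> \<open>The four polarisation vectors have norm at most 2, so each value is at most 4 K;
    their total 16 K is divided by 4.\<close>
  have unit: "cmod (?B x y) \<le> 4 * K" if "norm x = 1" "norm y = 1" for x y
  proof -
    have *: "cmod (?B (x + u *\<^sub>C y) (x + u *\<^sub>C y)) \<le> 4 * K" if u: "cmod u = 1" for u
    proof -
      have "norm (x + u *\<^sub>C y) \<le> 2"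
        using norm_triangle_ineq[of x "u *\<^sub>C y"] \<open>norm x = 1\<close> \<open>norm y = 1\<close> u by (simp add: norm_scaleC)
      then have "(norm (x + u *\<^sub>C y))\<^sup>2 \<le> 2\<^sup>2" by (rule power_mono) simp
      then have "K * (norm (x + u *\<^sub>C y))\<^sup>2 \<le> K * 2\<^sup>2" using K(1) by (intro mult_left_mono) auto
      then show ?thesis using diag[of "x + u *\<^sub>C y"] by simp
    qed
    have "cmod (4 * ?B x y) \<le> 4 * K + 4 * K + 4 * K + 4 * K"
      unfolding polar
      using *[of 1] *[of "-1"] *[of \<i>] *[of "-\<i>"]
      by (intro order_trans[OF norm_triangle_ineq4] add_mono order_trans[OF norm_triangle_ineq])
        (simp_all add: norm_mult)
    then show ?thesis by (simp add: norm_mult)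
  qed
  have "cmod (?B x y) \<le> (4 * K) * norm x * norm y" for x y
  proof (cases "x = 0 \<or> y = 0")
    case True
    have "?B 0 y = 0" "?B x 0 = 0" using B_sc(1)[of 0 0 y] B_sc(2)[of x 0 0] by simp_all
    then show ?thesis using True by auto
  next
    case False
    define x' y' where "x' = complex_of_real (1 / norm x) *\<^sub>C x" and "y' = complex_of_real (1 / norm y) *\<^sub>C y"
    have "norm x' = 1" "norm y' = 1" using False by (simp_all add: x'_def y'_def norm_scaleC norm_divide)
    moreover have "x = complex_of_real (norm x) *\<^sub>C x'" "y = complex_of_real (norm y) *\<^sub>C y'"
      using False by (simp_all add: x'_def y'_def scaleC_scaleC)
    then have "?B x y = of_real (norm x) * (of_real (norm y) * ?B x' y')"
      by (metis B_sc complex_cnj_complex_of_real)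
    ultimately show ?thesis
      using unit[of x' y'] mult_left_mono[of "cmod (?B x' y')" "4 * K" "norm x * norm y"]
      by (simp add: norm_mult mult_ac)
  qed
  then show ?thesis using K(1) by (intro exI[of _ "4 * K"]) auto
qed

text \<open>The difference of the two traces is a functional of \<rho> that vanishes on rank one
  operators, so \<open>linear_functional_0\<close> applies. Its constant 2 K adds the contributions
  of the two traces.\<close>

lemma dual_determined:
  assumes Y: "bounded_clinear Y" and X: "bounded_clinear X"
    and eq: "\<And>x y. trace_op (img x y \<circ> Y) = cinner y (X x)" and \<rho>: "\<rho> \<in> trace_class"
  shows "trace_op (\<Phi> \<rho> \<circ> Y) = trace_op (\<rho> \<circ> X)"
proof -
  obtain K0 where K0: "K0 \<ge> 0" "\<And>x. norm (Y x) \<le> K0 * norm x" using bounded_clinear_bound[OF Y] by blast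
  obtain K1 where K1: "K1 \<ge> 0" "\<And>x. norm (X x) \<le> K1 * norm x" using bounded_clinear_bound[OF X] by blast
  define K where "K = K0 + K1 + 1"
  have K: "K > 0" "\<And>x. norm (Y x) \<le> K * norm x" "\<And>x. norm (X x) \<le> K * norm x"
    using K0(1) K1(1) order_trans[OF K0(2) mult_right_mono[of K0 K]]
      order_trans[OF K1(2) mult_right_mono[of K1 K]] unfolding K_def by auto
  define L where "L \<rho> = trace_op (\<Phi> \<rho> \<circ> Y) - trace_op (\<rho> \<circ> X)" for \<rho>
  have tc: "\<Phi> \<rho> \<circ> Y \<in> trace_class" "\<rho> \<circ> X \<in> trace_class" if "\<rho> \<in> trace_class" for \<rho>
    using that by (intro trace_class_comp_right channel_simps X Y; simp)+
  have "L \<rho> = 0"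
  proof (rule linear_functional_0[of L, OF _ _ _ _ \<rho>])
    fix S T :: "'a \<Rightarrow> 'a" assume S: "S \<in> trace_class" and T: "T \<in> trace_class"
    show "L (\<lambda>x. S x + T x) = L S + L T"
      using trace_op_add[OF tc(1)[OF S] tc(1)[OF T]] trace_op_add[OF tc(2)[OF S] tc(2)[OF T]]
      by (simp add: L_def channel_simps S T comp_def)
  next
    fix c and T :: "'a \<Rightarrow> 'a" assume T: "T \<in> trace_class"
    show "L (\<lambda>x. c *\<^sub>C T x) = c * L T"
      using trace_op_scaleC[of c "\<Phi> T \<circ> Y"] trace_op_scaleC[of c "T \<circ> X"]
      by (simp add: L_def channel_simps T comp_def right_diff_distrib)
  next
    show "L (outer x y) = 0" for x y by (simp add: L_def eq trace_outer_comp X)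
  next
    fix S :: "'a \<Rightarrow> 'a" assume S: "positive_op S" "S \<in> trace_class"
    have "cmod (trace_op (\<Phi> S \<circ> Y)) \<le> K * Re (trace_op (\<Phi> S))"
      by (intro positive_trace_comp_bound channel_positive channel_simps S Y K)
    moreover have "cmod (trace_op (S \<circ> X)) \<le> K * Re (trace_op S)"
      by (intro positive_trace_comp_bound S X K)
    ultimately show "cmod (L S) \<le> (2 * K) * Re (trace_op S)"
      using norm_triangle_ineq4[of "trace_op (\<Phi> S \<circ> Y)" "trace_op (S \<circ> X)"]
      by (simp add: L_def channel_simps S)
  qed
  then show ?thesis by (simp add: L_def)
qed

lemma dual_channel_eqI:
  assumes Y: "bounded_clinear Y" and X: "bounded_clinear X"
    and eq: "\<And>x y. trace_op (img x y \<circ> Y) = cinner y (X x)"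
  shows "dual_channel \<Phi> Y = X"
  unfolding dual_channel_def
proof (rule the_equality)
  show "bounded_clinear X \<and> (\<forall>\<rho>\<in>trace_class. trace_op (\<Phi> \<rho> \<circ> Y) = trace_op (\<rho> \<circ> X))"
    using X dual_determined[OF Y X eq] by blast
  fix X' assume X': "bounded_clinear X' \<and> (\<forall>\<rho>\<in>trace_class. trace_op (\<Phi> \<rho> \<circ> Y) = trace_op (\<rho> \<circ> X'))"
  show "X' = X"
  proof
    fix x
    have "cinner y (X' x) = cinner y (X x)" for y
      using X' eq[of x y] trace_outer_comp[of X' x y] by simp
    then show "X' x = X x" by (rule cinner_eqI)
  qed
qed

lemma dual_channel:
  assumes Y: "bounded_clinear Y"
  shows bounded_clinear_dual: "bounded_clinear (dual_channel \<Phi> Y)"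
    and cinner_dual: "cinner y (dual_channel \<Phi> Y x) = trace_op (img x y \<circ> Y)"
    and trace_dual: "\<rho> \<in> trace_class \<Longrightarrow> trace_op (\<Phi> \<rho> \<circ> Y) = trace_op (\<rho> \<circ> dual_channel \<Phi> Y)"
proof -
  obtain C where C: "\<And>x y. cmod (trace_op (img x y \<circ> Y)) \<le> C * norm x * norm y"
    using trace_img_comp_bound[OF Y] by blast
  have tc: "img x y \<circ> Y \<in> trace_class" for x y by (intro trace_class_comp_right img_trace_class Y)
  have "\<exists>X. bounded_clinear X \<and> (\<forall>x y. cinner y (X x) = trace_op (img x y \<circ> Y))"
  proof (rule sesquilinear_operator[where C = C])
    fix x y z :: 'a and c :: complex
    show "trace_op (img z (x + y) \<circ> Y) = trace_op (img z x \<circ> Y) + trace_op (img z y \<circ> Y)"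
      "trace_op (img (x + y) z \<circ> Y) = trace_op (img x z \<circ> Y) + trace_op (img y z \<circ> Y)"
      using trace_op_add[OF tc tc] by (simp_all add: comp_def img_sesquilinear)
    show "trace_op (img z (c *\<^sub>C x) \<circ> Y) = cnj c * trace_op (img z x \<circ> Y)"
      "trace_op (img (c *\<^sub>C x) z \<circ> Y) = c * trace_op (img x z \<circ> Y)"
      using trace_op_scaleC[of "cnj c" "img z x \<circ> Y"] trace_op_scaleC[of c "img x z \<circ> Y"]
      by (simp_all add: comp_def img_sesquilinear)
  qed (rule C)
  then obtain X where X: "bounded_clinear X" "\<And>x y. cinner y (X x) = trace_op (img x y \<circ> Y)" by blast
  have eq: "dual_channel \<Phi> Y = X" by (rule dual_channel_eqI[OF Y X(1)]) (simp add: X(2))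
  show "bounded_clinear (dual_channel \<Phi> Y)" "cinner y (dual_channel \<Phi> Y x) = trace_op (img x y \<circ> Y)"
    unfolding eq by (simp_all add: X)
  show "trace_op (\<Phi> \<rho> \<circ> Y) = trace_op (\<rho> \<circ> dual_channel \<Phi> Y)" if "\<rho> \<in> trace_class"
    unfolding eq by (rule dual_determined[OF Y X(1) _ that]) (simp add: X(2))
qed

section \<open>The multiplicative domain\<close>

text \<open>If the dual maps the unitary \<open>V\<close> to the unitary \<open>U\<close>, the positive operator \<open>D\<close> below has trace
  zero. Its vanishing makes the quadratic form of a \<open>3 \<times> 3\<close> block degenerate in one direction, so the
  corresponding off-diagonal entries vanish too.\<close>

lemma multiplicative_domain:
  assumes U: "bounded_clinear U" "\<And>x. norm (U x) = norm x"
    and V: "bounded_clinear V" "\<And>x. cadjoint V (V x) = x"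
    and eq: "\<And>x y. trace_op (img x y \<circ> V) = cinner y (U x)"
  shows "img (U x) y w = V (img x y w)"
proof -
  let ?A = "cadjoint V"
  have A: "bounded_clinear ?A" by (rule bounded_clinear_cadjoint[OF V(1)])
  note lV = bounded_clinearD[OF V(1)] and lA = bounded_clinearD[OF A]
  note adj = cinner_cadjoint_left[OF V(1)]
  \<comment> \<open>The 2x2 block for \<open>x\<close> and \<open>U x\<close>, compressed along
    (\<open>- ?A v\<close>, \<open>v\<close>). With Kraus operators A_i it is the sum of |y_i><y_i|
    for y_i = A_i (U x) - V (A_i x), so its vanishing is covariance. The nesting of the sum follows
    the later applications of \<open>trace_op_add\<close>.\<close>
  define D where "D v = img (U x) (U x) v + ((-1) *\<^sub>C V (img x (U x) v) +
      ((-1) *\<^sub>C img (U x) x (?A v) + V (img x x (?A v))))" for v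
  have q: "cinner v (D v) = cinner (- ?A v) (img x x (- ?A v)) + cinner (- ?A v) (img x (U x) v) +
      cinner v (img (U x) x (- ?A v)) + cinner v (img (U x) (U x) v)" for v
    by (simp add: D_def cinner_simps img_simps adj)
  have comps: "V \<circ> img x (U x) \<in> trace_class" "img (U x) x \<circ> ?A \<in> trace_class"
    "V \<circ> (img x x \<circ> ?A) \<in> trace_class"
    by (intro trace_class_comp_left trace_class_comp_right img_trace_class V A)+
  note tcs = comps[unfolded comp_def]
  have tc2: "(\<lambda>v. (-1) *\<^sub>C V (img x (U x) v)) \<in> trace_class"
    and tc3: "(\<lambda>v. (-1) *\<^sub>C img (U x) x (?A v)) \<in> trace_class"
    by (intro trace_class_scaleC tcs)+
  have tc34: "(\<lambda>v. (-1) *\<^sub>C img (U x) x (?A v) + V (img x x (?A v))) \<in> trace_class"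
    by (intro trace_class_add tc3 tcs)
  have tc234: "(\<lambda>v. (-1) *\<^sub>C V (img x (U x) v) +
      ((-1) *\<^sub>C img (U x) x (?A v) + V (img x x (?A v)))) \<in> trace_class"
    by (intro trace_class_add tc2 tc34)
  have Dtc: "D \<in> trace_class" unfolding D_def[abs_def]
    by (intro trace_class_add[OF img_trace_class tc234])
  have Dpos: "positive_op D" unfolding positive_op_def
    by (intro conjI allI trace_class_bounded[OF Dtc], unfold q) (rule img_block2)
  \<comment> \<open>All four terms of \<open>D\<close> have the trace \<open>cinner x x\<close> up
    to sign: the outer ones by trace preservation, isometry and cyclicity, the mixed ones because
    \<open>U\<close> is dual to \<open>V\<close>. The signs make them cancel.\<close>
  have t2: "trace_op (\<lambda>v. V (img x (U x) v)) = of_real ((norm x)\<^sup>2)"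
    using trace_op_cyclic[OF img_trace_class V(1), of x "U x"] eq[of x "U x"]
    by (simp add: comp_def cinner_self U)
  have "cadjoint (V \<circ> img x (U x)) = img (U x) x \<circ> ?A"
    by (simp add: cadjoint_comp V bounded_clinear_img cadjoint_img)
  then have t3: "trace_op (\<lambda>v. img (U x) x (?A v)) = of_real ((norm x)\<^sup>2)"
    using trace_op_cadjoint[OF trace_class_bounded[OF comps(1)]] t2 by (simp add: comp_def)
  have "trace_op (V \<circ> (img x x \<circ> ?A)) = trace_op ((img x x \<circ> ?A) \<circ> V)"
    by (rule trace_op_cyclic[symmetric]) (intro trace_class_comp_right img_trace_class A V)+
  also have "(img x x \<circ> ?A) \<circ> V = img x x" by (simp add: comp_def V)
  finally have t4: "trace_op (\<lambda>v. V (img x x (?A v))) = of_real ((norm x)\<^sup>2)"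
    by (simp add: comp_def trace_img cinner_self)
  have "trace_op D = 0"
    unfolding D_def[abs_def]
    by (simp only: trace_op_add[OF img_trace_class tc234] trace_op_add[OF tc2 tc34]
        trace_op_add[OF tc3 tcs(3)] trace_op_scaleC t2 t3 t4 trace_img)
      (simp add: cinner_self U)
  then have D0: "cinner v (D v) = 0" for v using positive_trace_0[OF Dpos Dtc] by simp
  show ?thesis
  proof (rule cinner_eqI)
    fix v
    let ?p = "cinner (- ?A v) (img x y w) + cinner v (img (U x) y w)"
    have "(cmod ?p)\<^sup>2 \<le> 0 * Re (cinner w (img y y w))"
    proof (rule quadratic_form_nonneg)
      show "0 \<le> Re (cinner w (img y y w))" by (rule positive_opD(2)[OF positive_img])
      fix t
      have r: "cinner w (img y x (- ?A v)) = cnj (cinner (- ?A v) (img x y w))"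
        "cinner w (img y (U x) v) = cnj (cinner v (img (U x) y w))"
        by (metis cinner_commute img_adjoint)+
      have "cinner (- ?A v) (img x x (- ?A v)) + cinner (- ?A v) (img x (U x) v) +
          cinner (- ?A v) (img x y (t *\<^sub>C w)) +
          cinner v (img (U x) x (- ?A v)) + cinner v (img (U x) (U x) v) + cinner v (img (U x) y (t *\<^sub>C w)) +
          cinner (t *\<^sub>C w) (img y x (- ?A v)) + cinner (t *\<^sub>C w) (img y (U x) v) +
          cinner (t *\<^sub>C w) (img y y (t *\<^sub>C w))
        = cinner v (D v) + (t * ?p + cnj (t * ?p)) + (t * cnj t) * cinner w (img y y w)"
        unfolding q img_simps(3) cinner_scaleC_left cinner_scaleC_right r by (simp add: algebra_simps)
      also have "t * ?p + cnj (t * ?p) = of_real (2 * Re (t * ?p))" by (rule complex_add_cnj)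
      also have "t * cnj t = of_real ((cmod t)\<^sup>2)" by (metis complex_norm_square of_real_power)
      finally have "cinner v (D v) + of_real (2 * Re (t * ?p)) +
          of_real ((cmod t)\<^sup>2) * cinner w (img y y w) \<in> \<real>\<^sub>\<ge>\<^sub>0"
        using img_block3[of "- ?A v" x "U x" v y "t *\<^sub>C w"] by (simp only:)
      then have "0 \<le> Re (0 + of_real (2 * Re (t * ?p)) + of_real ((cmod t)\<^sup>2) * cinner w (img y y w))"
        by (simp only: complex_nonneg_Reals_iff D0)
      then show "0 \<le> 0 + 2 * Re (t * ?p) + (cmod t)\<^sup>2 * Re (cinner w (img y y w))" by simp
    qed
    then have "?p = 0" by simp
    then show "cinner v (img (U x) y w) = cinner v (V (img x y w))"
      by (simp add: cinner_simps adj)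
  qed
qed

end

section \<open>Lifting resolutions of the identity\<close>

lemma unitary_opD:
  assumes "unitary_op U"
  shows "bounded_clinear U" "U (cadjoint U x) = x" "cadjoint U (U x) = x" "norm (U x) = norm x"
proof -
  show U: "bounded_clinear U" and "U (cadjoint U x) = x" and UU: "cadjoint U (U x) = x"
    using assms by (simp_all add: unitary_op_def fun_eq_iff)
  have "cinner (U x) (U x) = cinner x x" by (metis U UU cinner_cadjoint_left)
  then have "(norm (U x))\<^sup>2 = (norm x)\<^sup>2" by (simp add: norm_eq_cinner)
  then show "norm (U x) = norm x" by (simp add: power2_eq_iff_nonneg)
qed

lemma commutantI:
  "bounded_clinear T \<Longrightarrow> (\<And>S x. S \<in> M \<Longrightarrow> T (S x) = S (T x)) \<Longrightarrow> T \<in> commutant M"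
  by (auto simp: commutant_def fun_eq_iff)

lemma commutantD:
  assumes "T \<in> commutant M"
  shows "bounded_clinear T" "S \<in> M \<Longrightarrow> T (S x) = S (T x)"
  using assms by (auto simp: commutant_def fun_eq_iff)

text \<open>For unitary \<open>S\<close>, commuting with \<open>T\<close> means that conjugation by
  \<open>S\<close> fixes \<open>T\<close>, a condition stable under adjoints. So \<open>M\<close>
  itself need not contain adjoints.\<close>

lemma commutant_cadjoint:
  assumes unitary: "\<And>S. S \<in> M \<Longrightarrow> unitary_op S" and T: "T \<in> commutant M"
  shows "cadjoint T \<in> commutant M"
proof (rule commutantI)
  note T' = commutantD(1)[OF T]
  show "bounded_clinear (cadjoint T)" by (rule bounded_clinear_cadjoint[OF T'])
  fix S x assume S: "S \<in> M"
  note U = unitary_opD[OF unitary[OF S]]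
  have "cadjoint S (cadjoint T (S x)) = cadjoint T x"
  proof (rule cinner_eqI)
    fix y
    have "cinner y (cadjoint S (cadjoint T (S x))) = cinner (S (T y)) (S x)"
      by (simp add: cinner_cadjoint_right[OF U(1)] cinner_cadjoint_right[OF T'] commutantD(2)[OF T S])
    also have "\<dots> = cinner (T y) x" by (metis U(1,3) cinner_cadjoint_right)
    finally show "cinner y (cadjoint S (cadjoint T (S x))) = cinner y (cadjoint T x)"
      by (simp add: cinner_cadjoint_right[OF T'])
  qed
  then show "cadjoint T (S x) = S (cadjoint T x)" by (metis U(2))
qed

lemma commutant_comp: "S \<in> commutant M \<Longrightarrow> T \<in> commutant M \<Longrightarrow> S \<circ> T \<in> commutant M"
  by (rule commutantI) (simp_all add: commutantD)

lemma orth_anti: "S \<subseteq> T \<Longrightarrow> orth T \<subseteq> orth S"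
  by (auto simp: orth_def)

lemma subset_orth_orth: "S \<subseteq> orth (orth S)"
  by (auto simp: orth_def intro: cinner_zero_commute)

lemma orth_invariant:
  assumes T: "bounded_clinear T" and "\<And>x. x \<in> S \<Longrightarrow> cadjoint T x \<in> S" and "x \<in> orth S"
  shows "T x \<in> orth S"
  unfolding orth_def
proof (clarify)
  fix y assume "y \<in> S"
  then have "cinner (cadjoint T y) x = 0" using assms(2,3) by (simp add: orth_def)
  then show "cinner y (T x) = 0" by (simp add: cinner_cadjoint_left[OF T])
qed

text \<open>A subspace invariant under \<open>T\<close> and its adjoint reduces \<open>T\<close>:
  the complement is invariant too, so applying \<open>T\<close> to the decomposition of
  \<open>x\<close> decomposes \<open>T x\<close>.\<close>

lemma proj_commutes:
  assumes M: "closed M" "csubspace M" and T: "bounded_clinear T"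
    and inv: "\<And>x. x \<in> M \<Longrightarrow> T x \<in> M" "\<And>x. x \<in> M \<Longrightarrow> cadjoint T x \<in> M"
  shows "proj M (T x) = T (proj M x)"
proof (rule proj_eqI[OF M])
  show "T (proj M x) \<in> M" by (intro inv proj_in[OF M])
  have "T (x - proj M x) \<in> orth M" by (rule orth_invariant[OF T inv(2) proj_orth[OF M]])
  then show "T x - T (proj M x) \<in> orth M" by (simp add: bounded_clinearD[OF T])
qed

lemma orthogonal_resolution_direct_sum:
  assumes "orthogonal_resolution I P"
  shows "orthogonal_direct_sum I (\<lambda>k. range (P k))"
  unfolding orthogonal_direct_sum_def
proof (intro conjI ballI allI impI)
  have P: "projector (P k)" if "k \<in> I" for k using assms that by (simp add: orthogonal_resolution_def)
  show "closed (range (P k))" "csubspace (range (P k))" if "k \<in> I" for k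
    using projector_range[OF P[OF that]] by auto
  show "cinner x y = 0" if "j \<in> I" "k \<in> I" "j \<noteq> k" "x \<in> range (P j)" "y \<in> range (P k)" for j k x y
  proof -
    obtain u v where "x = P j u" "y = P k v" using \<open>x \<in> _\<close> \<open>y \<in> _\<close> by blast
    moreover have "P j (P k v) = 0"
      using assms that unfolding orthogonal_resolution_def by (metis comp_apply)
    ultimately show ?thesis by (simp add: projectorD(3)[OF P[OF \<open>j \<in> I\<close>]])
  qed
  show "\<exists>y. (\<forall>k\<in>I. y k \<in> range (P k)) \<and> (y has_sum x) I" for x
    using assms unfolding orthogonal_resolution_def by (intro exI[of _ "\<lambda>k. P k x"]) auto
qed

locale unitary_covariant_channel = channel \<Phi>
  for \<Phi> :: "('a::chilbert_space \<Rightarrow> 'a) \<Rightarrow> ('b::chilbert_space \<Rightarrow> 'b)" +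
  fixes Z :: "'z set" and U :: "'z \<Rightarrow> 'a \<Rightarrow> 'a" and V :: "'z \<Rightarrow> 'b \<Rightarrow> 'b"
  assumes unitary_U: "z \<in> Z \<Longrightarrow> unitary_op (U z)" and unitary_V: "z \<in> Z \<Longrightarrow> unitary_op (V z)"
    and dual_V: "z \<in> Z \<Longrightarrow> dual_channel \<Phi> (V z) = U z"
begin

lemma img_covariant:
  assumes z: "z \<in> Z"
  shows "img (U z x) y w = V z (img x y w)"
proof (rule multiplicative_domain)
  show "trace_op (img x y \<circ> V z) = cinner y (U z x)" for x y
    using cinner_dual[OF unitary_opD(1)[OF unitary_V[OF z]], of y x] by (simp add: dual_V[OF z])
qed (simp_all add: unitary_opD[OF unitary_U[OF z]] unitary_opD[OF unitary_V[OF z]])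

text \<open>The sesquilinear form below defines an operator in the commutant of \<open>U ` Z\<close>, so \<open>P\<close> can be
  moved from one of its arguments to the other.\<close>

lemma bicommutant_shift:
  assumes b: "b \<in> commutant (V ` Z)" and P: "P \<in> bicommutant (U ` Z)"
    and sym: "\<And>x y. cinner (P x) y = cinner x (P y)"
  shows "cinner c (img p (P \<psi>) (b (img \<phi> q d))) = cinner c (img p \<psi> (b (img (P \<phi>) q d)))"
proof -
  note bl = bounded_clinearD[OF commutantD(1)[OF b]]
  obtain k where k: "k \<ge> 0" "\<And>x. norm (b x) \<le> k * norm x"
    using bounded_clinear_bound[OF commutantD(1)[OF b]] by blast
  let ?G = "\<lambda>\<psi> \<phi>. cinner c (img p \<psi> (b (img \<phi> q d)))"
  have "\<exists>T. bounded_clinear T \<and> (\<forall>x y. cinner y (T x) = ?G y x)"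
  proof (rule sesquilinear_operator[where C = "norm p * norm c * k * norm q * norm d"])
    fix x y
    have "cmod (?G y x) \<le> (norm p * norm y) * (norm c * norm (b (img x q d)))" by (rule cmod_img_le)
    also have "\<dots> \<le> (norm p * norm y) * (norm c * (k * ((norm x * norm q) * norm d)))"
      by (intro mult_left_mono order_trans[OF k(2)] norm_img_le mult_nonneg_nonneg k norm_ge_zero)
    finally show "cmod (?G y x) \<le> norm p * norm c * k * norm q * norm d * norm x * norm y"
      by (simp add: mult_ac)
  qed (simp_all add: img_sesquilinear img_simps cinner_simps bl)
  then obtain T where T: "bounded_clinear T" "\<And>x y. cinner y (T x) = ?G y x" by blast
  have "T \<in> commutant (U ` Z)"
  proof (rule commutantI[OF T(1)])
    fix S x assume "S \<in> U ` Z"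
    then obtain z where z: "z \<in> Z" and S: "S = U z" by blast
    note Uz = unitary_opD[OF unitary_U[OF z]] and Vz = unitary_opD[OF unitary_V[OF z]]
    \<comment> \<open>Covariance for the second argument of \<open>img\<close>, obtained by
      adjoints: there \<open>U z\<close> emerges as \<open>cadjoint (V z)\<close> on the
      right.\<close>
    have move: "cinner c (img p (U z \<psi>) w) = cinner c (img p \<psi> (cadjoint (V z) w))" for \<psi> w
      by (simp add: img_adjoint[symmetric] img_covariant[OF z] cinner_cadjoint_right[OF Vz(1)])
    \<comment> \<open>The two arguments contribute \<open>V z\<close> and its adjoint on either side
      of \<open>b\<close>, which cancel because \<open>b\<close> commutes with \<open>V z\<close>.
      Invariance of the form is commutation of \<open>T\<close> with the unitary
      \<open>U z\<close>.\<close>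
    have "?G (U z y) (U z x) = ?G y x" for y
      by (simp add: move img_covariant[OF z] commutantD(2)[OF b] z Vz)
    then have "cinner (U z y) (T (U z x)) = cinner (U z y) (U z (T x))" for y
      by (metis T(2) Uz(1,3) cinner_cadjoint_right)
    then have "cinner y (T (U z x)) = cinner y (U z (T x))" for y by (metis Uz(2))
    then show "T (S x) = S (T x)" unfolding S by (rule cinner_eqI)
  qed
  then have "P (T x) = T (P x)" for x
    using P unfolding bicommutant_def by (rule commutantD(2)[rotated])
  then show ?thesis by (metis T(2) sym)
qed

end

section \<open>Construction of the lifted resolution\<close>

locale channel_resolution = unitary_covariant_channel \<Phi> Z U V
  for \<Phi> :: "('a::chilbert_space \<Rightarrow> 'a) \<Rightarrow> ('b::chilbert_space \<Rightarrow> 'b)" and Z :: "'z set" and U V +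
  fixes I :: "'i set" and P :: "'i \<Rightarrow> 'a \<Rightarrow> 'a" and k\<^sub>0 :: 'i
  assumes resolution: "orthogonal_resolution I P"
    and P_bicommutant: "k \<in> I \<Longrightarrow> P k \<in> bicommutant (U ` Z)" and k0: "k\<^sub>0 \<in> I"
begin

lemma P_simps:
  assumes "k \<in> I"
  shows "projector (P k)" "j \<in> I \<Longrightarrow> j \<noteq> k \<Longrightarrow> P j (P k x) = 0" "((\<lambda>k. P k x) has_sum x) I"
  using resolution assms unfolding orthogonal_resolution_def by (auto simp: fun_eq_iff)

text \<open>Made invariant under the commutant by construction, so that the projectors built from
  these sets commute with it. No span is taken, since only orthogonal complements are formed from
  them.\<close>

definition generators :: "'i \<Rightarrow> 'b set" where
  "generators k = {b (img (P k \<phi>) q d) | b \<phi> q d. b \<in> commutant (V ` Z)}"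

text \<open>The orthogonal complement of all generators has to be absorbed into one of the subspaces, here
  the one with index \<open>k\<^sub>0\<close>.\<close>

definition range_space :: "'i \<Rightarrow> 'b set" where
  "range_space k = (if k = k\<^sub>0 then orth (\<Union>l\<in>I - {k\<^sub>0}. generators l) else orth (orth (generators k)))"

definition lift :: "'i \<Rightarrow> 'b \<Rightarrow> 'b" where
  "lift k = proj (range_space k)"

lemma V_unitary: "S \<in> V ` Z \<Longrightarrow> unitary_op S"
  using unitary_V by blast

text \<open>After \<open>b'\<close> is moved across as an adjoint, \<open>bicommutant_shift\<close>
  carries \<open>P k\<close> from one rank one argument to the other, where it meets
  \<open>P l\<close> and gives zero.\<close>

lemma generators_orth:
  assumes k: "k \<in> I" and l: "l \<in> I" and "k \<noteq> l"
  shows "generators l \<subseteq> orth (generators k)"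
  unfolding orth_def generators_def
proof clarify
  fix b \<phi> q d b' \<psi> q' d'
  assume b: "b \<in> commutant (V ` Z)" and b': "b' \<in> commutant (V ` Z)"
  have "cadjoint b' \<circ> b \<in> commutant (V ` Z)"
    by (intro commutant_comp commutant_cadjoint V_unitary b b')
  note shift = bicommutant_shift[OF this P_bicommutant[OF k] projectorD(3)[OF P_simps(1)[OF k]]]
  have "cinner (b' (img (P k \<psi>) q' d')) (b (img (P l \<phi>) q d)) =
      cinner d' (img q' (P k \<psi>) ((cadjoint b' \<circ> b) (img (P l \<phi>) q d)))"
    by (simp add: cinner_cadjoint_right[OF commutantD(1)[OF b']] img_adjoint[symmetric])
  also have "\<dots> = cinner d' (img q' \<psi> ((cadjoint b' \<circ> b) (img (P k (P l \<phi>)) q d)))" by (rule shift)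
  also have "\<dots> = 0"
    using commutantD(1)[OF \<open>cadjoint b' \<circ> b \<in> _\<close>] \<open>k \<noteq> l\<close> img_sesquilinear(3)[of 0 0 q d]
    by (simp add: P_simps(2)[OF l k] bounded_clinearD img_simps del: comp_apply)
  finally show "cinner (b' (img (P k \<psi>) q' d')) (b (img (P l \<phi>) q d)) = 0" .
qed

lemma generators_invariant:
  assumes "b \<in> commutant (V ` Z)" "x \<in> generators k"
  shows "b x \<in> generators k"
proof -
  obtain b' \<phi> q d where "b' \<in> commutant (V ` Z)" "x = b' (img (P k \<phi>) q d)"
    using assms(2) unfolding generators_def by blast
  moreover from this have "b \<circ> b' \<in> commutant (V ` Z)" by (intro commutant_comp assms)
  ultimately show ?thesis unfolding generators_def mem_Collect_eq
    by (intro exI[of _ "b \<circ> b'"] exI conjI) simp_all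
qed

lemma range_space_closed: "closed (range_space k)" "csubspace (range_space k)"
  unfolding range_space_def by (simp_all add: closed_orth csubspace_orth)

lemma range_space_orth:
  assumes "k \<in> I" "l \<in> I" "k \<noteq> l" "x \<in> range_space k" "y \<in> range_space l"
  shows "cinner x y = 0"
proof -
  \<comment> \<open>By symmetry one index can be taken different from \<open>k\<^sub>0\<close>; its
    space is then a double complement, and only the other space needs a case distinction.\<close>
  have *: "cinner x y = 0"
    if "k \<in> I" "l \<in> I" "k \<noteq> l" "k \<noteq> k\<^sub>0" "x \<in> range_space k" "y \<in> range_space l" for k l x y
  proof -
    have "range_space l \<subseteq> orth (generators k)"
    proof (cases "l = k\<^sub>0")
      case True
      have "generators k \<subseteq> (\<Union>l\<in>I - {k\<^sub>0}. generators l)" using that by blast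
      then show ?thesis using True by (simp add: range_space_def orth_anti)
    next
      case False
      have "orth (orth (generators l)) \<subseteq> orth (orth (orth (generators k)))"
        by (intro orth_anti generators_orth that)
      also have "\<dots> \<subseteq> orth (generators k)" by (intro orth_anti subset_orth_orth)
      finally show ?thesis using False by (simp add: range_space_def)
    qed
    then have "y \<in> orth (generators k)" using that by blast
    moreover have "x \<in> orth (orth (generators k))" using that by (simp add: range_space_def)
    ultimately show ?thesis using cinner_zero_commute by (auto simp: orth_def)
  qed
  show ?thesis
  proof (cases "k = k\<^sub>0")
    case True
    then show ?thesis using *[of l k y x] assms cinner_zero_commute by auto
  qed (use * assms in blast)
qed

text \<open>Automatic for a double complement; for \<open>k\<^sub>0\<close>, whose space is the
  complement of all the others, it rests on \<open>generators_orth\<close>.\<close>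

lemma generators_subset:
  assumes "k \<in> I"
  shows "generators k \<subseteq> range_space k"
proof (cases "k = k\<^sub>0")
  case True
  have "generators k \<subseteq> orth (generators l)" if "l \<in> I - {k\<^sub>0}" for l
    using generators_orth[of l k] that True assms by blast
  then show ?thesis using True unfolding range_space_def orth_def by fastforce
qed (simp add: range_space_def subset_orth_orth)

text \<open>The commutant contains adjoints, so invariance of the generators passes to their
  complement, and a second time to the double complement.\<close>

lemma range_space_invariant:
  assumes b: "b \<in> commutant (V ` Z)" and x: "x \<in> range_space k"
  shows "b x \<in> range_space k"
proof -
  have adj: "cadjoint b \<in> commutant (V ` Z)" by (intro commutant_cadjoint V_unitary b)
  note b' = commutantD(1)[OF b]
  show ?thesis
  proof (cases "k = k\<^sub>0")
    case True
    show ?thesis using x True unfolding range_space_def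
      by simp (rule orth_invariant[OF b'], auto intro: generators_invariant[OF adj])
  next
    case False
    have "cadjoint b y \<in> orth (generators k)" if "y \<in> orth (generators k)" for y
      by (rule orth_invariant[OF commutantD(1)[OF adj] _ that])
        (simp add: cadjoint_cadjoint[OF b'] generators_invariant[OF b])
    then show ?thesis using x False unfolding range_space_def
      by simp (rule orth_invariant[OF b'])
  qed
qed

lemma projector_lift: "projector (lift k)"
  unfolding lift_def by (rule projector_proj[OF range_space_closed])

lemma lift_fix: "x \<in> range_space k \<Longrightarrow> lift k x = x"
  unfolding lift_def by (rule proj_fix[OF range_space_closed])

lemma lift_eq_0:
  assumes "k \<in> I" "l \<in> I" "k \<noteq> l" "x \<in> range_space l"
  shows "lift k x = 0"
  unfolding lift_def
proof (rule proj_null[OF range_space_closed])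
  show "x \<in> orth (range_space k)"
    using range_space_orth[OF assms(1,2,3) _ assms(4)] by (simp add: orth_def)
qed

lemma lift_resolution: "orthogonal_resolution I lift"
proof -
  have orth: "lift j (lift k x) = 0" if "j \<in> I" "k \<in> I" "j \<noteq> k" for j k x
    using proj_in[OF range_space_closed, of k x] lift_eq_0[OF that] by (simp add: lift_def)
  have "((\<lambda>k. lift k x) has_sum x) I" for x
  proof (rule total_projectors_has_sum[OF projector_lift orth])
    fix x assume 0: "\<And>k. k \<in> I \<Longrightarrow> lift k x = 0"
    \<comment> \<open>Orthogonality to the generators of the indices other than
      \<open>k\<^sub>0\<close> puts \<open>x\<close> into \<open>range_space k\<^sub>0\<close>, to
      which it is also orthogonal. Here the absorbed complement yields totality.\<close>
    have perp: "x \<in> orth (range_space k)" if "k \<in> I" for k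
      using proj_orth[OF range_space_closed, of x k] 0[OF that] by (simp add: lift_def)
    have "x \<in> range_space k\<^sub>0"
      unfolding range_space_def orth_def using perp generators_subset by (fastforce simp: orth_def)
    then have "cinner x x = 0" using perp[OF k0] by (auto simp: orth_def)
    then show "x = 0" by simp
  qed
  then show ?thesis
    unfolding orthogonal_resolution_def using projector_lift orth by (auto simp: fun_eq_iff)
qed

lemma lift_bicommutant: "lift k \<in> bicommutant (V ` Z)"
  unfolding bicommutant_def
proof (rule commutantI)
  show "bounded_clinear (lift k)" by (rule projectorD(1)[OF projector_lift])
  fix b x assume b: "b \<in> commutant (V ` Z)"
  have adj: "cadjoint b \<in> commutant (V ` Z)" by (intro commutant_cadjoint V_unitary b)
  show "lift k (b x) = b (lift k x)"
    unfolding lift_def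
    by (rule proj_commutes[OF range_space_closed commutantD(1)[OF b]
          range_space_invariant[OF b] range_space_invariant[OF adj]])
qed

text \<open>Expand \<phi> by the resolution \<open>P\<close>: \<open>lift k\<close> fixes the image
  of the component with index \<open>k\<close> and kills the others. Continuity of
  \<open>img\<close> in its first argument allows this termwise.\<close>

lemma lift_img:
  assumes k: "k \<in> I"
  shows "lift k (img \<phi> q d) = img (P k \<phi>) q d"
proof -
  have mem: "img (P j \<phi>) q d \<in> range_space j" if "j \<in> I" for j
  proof -
    have "(\<lambda>x. x) \<in> commutant (V ` Z)" by (rule commutantI) simp_all
    then have "img (P j \<phi>) q d \<in> generators j" unfolding generators_def mem_Collect_eq
      by (intro exI[of _ "\<lambda>x. x"] exI conjI) simp_all
    then show ?thesis using generators_subset[OF that] by blast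
  qed
  have "bounded_clinear (\<lambda>\<phi>. img \<phi> q d)"
  proof (rule bounded_clinearI)
    show "norm (img \<phi> q d) \<le> norm \<phi> * (norm q * norm d)" for \<phi>
      using norm_img_le[of \<phi> q d] by (simp add: mult_ac)
  qed (simp_all add: img_sesquilinear)
  then have "bounded_linear (\<lambda>\<phi>. lift k (img \<phi> q d))"
    using bounded_clinear_comp[OF projectorD(1)[OF projector_lift]] bounded_clinearD(1) by blast
  from has_sum_bounded_linear[OF this P_simps(3)[OF k]]
  have "((\<lambda>j. lift k (img (P j \<phi>) q d)) has_sum lift k (img \<phi> q d)) I" .
  moreover have "((\<lambda>j. lift k (img (P j \<phi>) q d)) has_sum lift k (img (P k \<phi>) q d)) I"
    by (rule has_sum_single[OF k]) (use lift_eq_0[OF k] mem in blast)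
  ultimately have "lift k (img \<phi> q d) = lift k (img (P k \<phi>) q d)" by (rule has_sum_unique)
  then show ?thesis by (simp add: lift_fix mem k)
qed

text \<open>Cyclicity brings \<open>lift k\<close> to the left of \<open>img x y\<close>, where
  \<open>lift_img\<close> turns it into \<open>P k\<close> on the input; trace preservation
  finishes.\<close>

lemma dual_lift:
  assumes k: "k \<in> I"
  shows "dual_channel \<Phi> (lift k) = P k"
proof (rule dual_channel_eqI)
  show Q: "bounded_clinear (lift k)" by (rule projectorD(1)[OF projector_lift])
  show "bounded_clinear (P k)" by (rule projectorD(1)[OF P_simps(1)[OF k]])
  show "trace_op (img x y \<circ> lift k) = cinner y (P k x)" for x y
  proof -
    have "trace_op (img x y \<circ> lift k) = trace_op (lift k \<circ> img x y)"
      by (rule trace_op_cyclic[OF img_trace_class Q])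
    also have "lift k \<circ> img x y = img (P k x) y" by (simp add: fun_eq_iff lift_img[OF k])
    finally show ?thesis unfolding trace_img .
  qed
qed

text \<open>Since \<rho> need not have rank one, \<open>lift_img\<close> does not apply to it
  directly. Matrix elements of \<open>\<Phi> \<rho>\<close> are traces against rank one operators,
  and duality moves the question to those.\<close>

lemma channel_compressed:
  assumes k: "k \<in> I" and T: "T \<in> trace_class"
  defines "\<rho> \<equiv> P k \<circ> T \<circ> P k"
  shows "\<Phi> \<rho> = lift k \<circ> \<Phi> \<rho> \<circ> lift k"
proof
  fix d
  let ?P = "P k" and ?Q = "lift k" and ?\<sigma> = "\<Phi> \<rho>"
  note P = projectorD[OF P_simps(1)[OF k]] and Q = projectorD[OF projector_lift[of k]]
  have \<rho>: "\<rho> \<in> trace_class" unfolding \<rho>_def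
    by (intro trace_class_comp_left trace_class_comp_right T P(1))
  have \<sigma>: "?\<sigma> \<in> trace_class" by (rule channel_simps(1)[OF \<rho>])
  have entry: "trace_op (?\<sigma> \<circ> outer u v) = cinner v (?\<sigma> u)" for u v
    unfolding trace_op_cyclic[OF \<sigma> bounded_clinear_outer]
    by (rule trace_outer_comp[OF trace_class_bounded[OF \<sigma>]])
  have entry_img: "trace_op (img x y \<circ> outer u v) = cinner v (img x y u)" for x y u v
    unfolding trace_op_cyclic[OF img_trace_class bounded_clinear_outer]
    by (rule trace_outer_comp[OF bounded_clinear_img])
  show "?\<sigma> d = (?Q \<circ> ?\<sigma> \<circ> ?Q) d"
  proof (rule cinner_eqI)
    fix c
    let ?X = "dual_channel \<Phi> (outer d c)"
    have X: "bounded_clinear ?X" by (rule bounded_clinear_dual) simp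
    \<comment> \<open>Compressing the output by \<open>?Q\<close> amounts to compressing the dual by
      \<open>?P\<close>, a statement tested on rank one inputs alone.\<close>
    have "dual_channel \<Phi> (outer (?Q d) (?Q c)) = ?P \<circ> ?X \<circ> ?P"
    proof (rule dual_channel_eqI)
      show "bounded_clinear (?P \<circ> ?X \<circ> ?P)" by (simp add: P(1) X)
      fix x y
      have "trace_op (img x y \<circ> outer (?Q d) (?Q c)) = cinner (?Q c) (img x y (?Q d))" by (rule entry_img)
      also have "\<dots> = cinner c (img (?P x) y (?Q d))" by (simp add: Q(3) lift_img[OF k])
      \<comment> \<open>\<open>lift_img\<close> acts on the first argument of \<open>img\<close>
        only; the adjoint exchanges the arguments so that it can be used a second time.\<close>
      also have "\<dots> = cinner (?Q (img y (?P x) c)) d" by (simp add: img_adjoint[symmetric] Q(3))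
      also have "\<dots> = cinner c (img (?P x) (?P y) d)" by (simp add: lift_img[OF k] img_adjoint)
      also have "\<dots> = cinner (?P y) (?X (?P x))" by (simp add: cinner_dual entry_img)
      finally show "trace_op (img x y \<circ> outer (?Q d) (?Q c)) = cinner y ((?P \<circ> ?X \<circ> ?P) x)"
        by (simp add: P(3))
    qed simp
    then have "cinner (?Q c) (?\<sigma> (?Q d)) = trace_op (\<rho> \<circ> (?P \<circ> ?X \<circ> ?P))"
      using trace_dual[OF bounded_clinear_outer \<rho>, of "?Q d" "?Q c"] by (simp add: entry)
    also have "\<rho> \<circ> (?P \<circ> ?X \<circ> ?P) = (\<rho> \<circ> ?X) \<circ> ?P" by (simp add: fun_eq_iff \<rho>_def P(2))
    also have "trace_op \<dots> = trace_op (?P \<circ> (\<rho> \<circ> ?X))"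
      by (rule trace_op_cyclic[OF trace_class_comp_right[OF \<rho> X] P(1)])
    also have "?P \<circ> (\<rho> \<circ> ?X) = \<rho> \<circ> ?X" by (simp add: fun_eq_iff \<rho>_def P(2))
    also have "trace_op (\<rho> \<circ> ?X) = cinner c (?\<sigma> d)"
      using trace_dual[OF bounded_clinear_outer \<rho>, of d c] by (simp add: entry)
    finally show "cinner c (?\<sigma> d) = cinner c ((?Q \<circ> ?\<sigma> \<circ> ?Q) d)" by (simp add: Q(3))
  qed
qed

lemma channel_trace_class_on:
  assumes k: "k \<in> I"
  shows "\<Phi> ` trace_class_on (range (P k)) \<subseteq> trace_class_on (range (lift k))"
proof
  fix \<sigma> assume "\<sigma> \<in> \<Phi> ` trace_class_on (range (P k))"
  then obtain P' T where P': "projector P'" "range P' = range (P k)" and T: "T \<in> trace_class"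
    and \<sigma>: "\<sigma> = \<Phi> (P' \<circ> T \<circ> P')"
    unfolding trace_class_on_def by blast
  have "P' = P k" by (rule projector_eqI[OF P'(1) P_simps(1)[OF k] P'(2)])
  then have "\<sigma> = lift k \<circ> \<sigma> \<circ> lift k" using channel_compressed[OF k T] \<sigma> by simp
  moreover have "\<sigma> \<in> trace_class" unfolding \<sigma>
    by (intro channel_simps trace_class_comp_left trace_class_comp_right T projectorD(1)[OF P'(1)])
  ultimately show "\<sigma> \<in> trace_class_on (range (lift k))"
    unfolding trace_class_on_def using projector_lift by blast
qed

end

theorem proposition1:
  fixes \<Delta>A :: "'za::real_normed_vector \<Rightarrow> 'za \<Rightarrow> real"
    and \<Delta>B :: "'zb::real_normed_vector \<Rightarrow> 'zb \<Rightarrow> real"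
    and WA :: "'za \<Rightarrow> 'a::{chilbert_space, second_countable_topology} \<Rightarrow> 'a"
    and WB :: "'zb \<Rightarrow> 'b::{chilbert_space, second_countable_topology} \<Rightarrow> 'b"
    and K :: "'zb \<Rightarrow> 'za"
    and f :: "'zb \<Rightarrow> complex"
    and \<Phi> :: "('a \<Rightarrow> 'a) \<Rightarrow> ('b \<Rightarrow> 'b)"
    and I :: "'i set"
    and P :: "'i \<Rightarrow> 'a \<Rightarrow> 'a"
  assumes "symplectic_form \<Delta>A" and "symplectic_form \<Delta>B"
    and "weyl_system \<Delta>A WA" and "weyl_system \<Delta>B WB"
    and "bosonic_linear_channel \<Delta>A WA \<Delta>B WB K f \<Phi>"
    and "{z. f z = 1} \<noteq> {0}"
    and "orthogonal_resolution I P"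
    and "\<forall>k\<in>I. P k \<in> bicommutant ((\<lambda>z. WA (K z)) ` {z. f z = 1})"
  shows "\<exists>Q :: 'i \<Rightarrow> 'b \<Rightarrow> 'b.
           orthogonal_resolution I Q \<and>
           (\<forall>k\<in>I. Q k \<in> bicommutant (WB ` {z. f z = 1})) \<and>
           (\<forall>k\<in>I. P k = dual_channel \<Phi> (Q k)) \<and>
           (\<forall>k\<in>I. \<Phi> ` trace_class_on (range (P k)) \<subseteq> trace_class_on (range (Q k))) \<and>
           orthogonal_direct_sum I (\<lambda>k. range (P k)) \<and>
           orthogonal_direct_sum I (\<lambda>k. range (Q k))"
proof -
  \<comment> \<open>Irreducibility includes that the space is nonzero, so the index set is nonempty
    and an index \<open>k\<^sub>0\<close> to absorb the complement exists.\<close>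
  have "(UNIV :: 'a set) \<noteq> {0}"
    using assms(3) by (simp add: weyl_system_def irreducible_family_def)
  then obtain x :: 'a where "x \<noteq> 0" by auto
  have "I \<noteq> {}"
  proof
    assume "I = {}"
    then have "((\<lambda>k. P k x) has_sum x) {}" using assms(7) by (simp add: orthogonal_resolution_def)
    then show False using has_sum_unique[OF has_sum_empty] \<open>x \<noteq> 0\<close> by blast
  qed
  then obtain k\<^sub>0 where k\<^sub>0: "k\<^sub>0 \<in> I" by blast
  interpret channel_resolution \<Phi> "{z. f z = 1}" "\<lambda>z. WA (K z)" WB I P k\<^sub>0
  proof unfold_locales
    show "quantum_channel \<Phi>" using assms(5) by (simp add: bosonic_linear_channel_def)
    show "unitary_op (WA (K z))" "unitary_op (WB z)" for z
      using assms(3,4) by (simp_all add: weyl_system_def)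
    \<comment> \<open>On this set the scalar factor \<open>f z\<close> is 1, so the dual of a
      unitary is again a unitary.\<close>
    show "dual_channel \<Phi> (WB z) = WA (K z)" if "z \<in> {z. f z = 1}" for z
      using assms(5) that by (simp add: bosonic_linear_channel_def)
  qed (use assms(7,8) k\<^sub>0 in auto)
  show ?thesis
    by (intro exI[of _ lift] conjI ballI lift_resolution lift_bicommutant dual_lift[symmetric]
        channel_trace_class_on orthogonal_resolution_direct_sum assms(7))
qed

end
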